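(* Let $N\ge2$, $1<p<N$, $0<s<1$, $q>1$, $sq<N$. Let $\Omega\subset\mathbb{R}^N$ be open and let $u\in\mathcal{D}^{s,p,q}(\Omega)$ be a nonnegative (a.e. in $\mathbb{R}^N$) weak supersolution of $\mathcal{L}_{p,q}$ in $\Omega$. Let $d>0$, $r,R>0$, and let $B_R\subset\Omega$ be such that $B_{2r}\subset B_R$. Then there exists a constant $C=C(N,s,p,q)>0$ such that $$\int_{B_r}|\nabla\log(u+d)|^p\,dx+\int_{B_r}\int_{B_r}\Big|\log\Big(\frac{u(x)+d}{u(y)+d}\Big)\Big|^q\frac{(u(y)+d)^{q-p}}{|x-y|^{N+sq}}\,dy\,dx$$ $$\le C\,r^{N-p}+C\,r^{-sq}\int_{B_{2r}}(u+d)^{q-p}\,dx+C\int_{B_{3r/2}}\Big(\int_{\mathbb{R}^N\setminus B_{2r}}\frac{(u(x)+d)^{q-p}}{|x-y|^{N+sq}}\,dy\Big)dx.$$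
   Context: $B_\rho=\{x\in\mathbb{R}^N:|x|<\rho\}$. $p^*=\frac{pN}{N-p}$, $q_s^*=\frac{qN}{N-sq}$, $J_q(t)=|t|^{q-2}t$. For a set $E\subseteq\mathbb{R}^N$, $$[u]_{s,q,E}=\Big(\iint_{E\times E}\frac{|u(x)-u(y)|^q}{|x-y|^{N+sq}}\,dx\,dy\Big)^{1/q},\qquad [u]_{s,q}=[u]_{s,q,\mathbb{R}^N}.$$ For $\Omega\subseteq\mathbb{R}^N$ open: - $\mathcal{D}^{1,p}(\Omega)=\{u\in L^{p^*}(\Omega):\nabla u\in L^p(\Omega;\mathbb{R}^N)\}$; - $\mathcal{D}_0^{1,p}(\Omega)=\{u\in L^{p^*}(\mathbb{R}^N):\|\nabla u\|_{L^p(\mathbb{R}^N)}<\infty,\ u=0\text{ a.e. on }\Omega^c\}$; - $\mathcal{D}_0^{s,q}(\Omega)=\{u\in L^{q_s^*}(\mathbb{R}^N):[u]_{s,q}<\infty,\ u=0\text{ a.e. on }\Omega^c\}$; - $\mathcal{D}^{s,p,q}(\Omega)$ is the set of $u\in L^{q-1}_{\mathrm{loc}}(\mathbb{R}^N)\cap\mathcal{D}^{1,p}(\Omega)$ for which there is a set $E\supset\Omega$ with $E^c$ compact, $\mathrm{dist}(E^c,\Omega)>0$ and $[u]_{s,q,E}<\infty$. $\mathcal{L}_{p,q}=-\Delta_p+(-\Delta)_q^s$, and $u\in\mathcal{D}^{s,p,q}(\Omega)$ is a weak supersolution of $\mathcal{L}_{p,q}$ in $\Omega$ if for all nonnegative $\varphi\in\mathcal{D}_0^{1,p}(\Omega)\cap\mathcal{D}_0^{s,q}(\Omega)$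 $$\int_\Omega|\nabla u|^{p-2}\nabla u\cdot\nabla\varphi\,dx+\iint_{\mathbb{R}^{2N}}\frac{J_q(u(x)-u(y))(\varphi(x)-\varphi(y))}{|x-y|^{N+sq}}\,dx\,dy\ge0.$$ *)

theory Defs
  imports "HOL-Analysis.Analysis"
begin

text \<open>
  Functions on \<open>\<real>\<^sup>N\<close> are representatives \<open>real ^ 'n \<Rightarrow> real\<close> with \<open>N = CARD('n)\<close>, measurable with
  respect to Lebesgue measure. Integrals of nonnegative functions take values in \<^typ>\<open>ennreal\<close>, so
  that finiteness is a genuine condition. The quotients with denominator \<open>|x - y|\<close> are \<open>0\<close> on the
  diagonal, which is a null set of \<open>\<real>\<^sup>2\<^sup>N\<close>.
\<close>

subsection \<open>Lebesgue spaces\<close>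

definition Lp :: "real \<Rightarrow> (real ^ 'n) set \<Rightarrow> (real ^ 'n \<Rightarrow> 'b::euclidean_space) set" where
  "Lp p \<Omega> = {f. f \<in> borel_measurable (lebesgue_on \<Omega>) \<and>
                (\<integral>\<^sup>+x. ennreal (norm (f x) powr p) \<partial>lebesgue_on \<Omega>) < \<infinity>}"

definition Lp_loc :: "real \<Rightarrow> (real ^ 'n) set \<Rightarrow> (real ^ 'n \<Rightarrow> 'b::euclidean_space) set" where
  "Lp_loc p \<Omega> = {f. f \<in> borel_measurable (lebesgue_on \<Omega>) \<and>
                    (\<forall>K. compact K \<and> K \<subseteq> \<Omega> \<longrightarrow> f \<in> Lp p K)}"

subsection \<open>Weak gradients\<close>

definition partial_deriv :: "'n \<Rightarrow> (real ^ 'n \<Rightarrow> real) \<Rightarrow> real ^ 'n \<Rightarrow> real" where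
  "partial_deriv i f x = frechet_derivative f (at x) (axis i 1)"

primrec C_k :: "nat \<Rightarrow> (real ^ 'n \<Rightarrow> real) \<Rightarrow> bool" where
  "C_k 0 f \<longleftrightarrow> continuous_on UNIV f"
| "C_k (Suc k) f \<longleftrightarrow> (\<forall>x. f differentiable (at x)) \<and> (\<forall>i. C_k k (partial_deriv i f))"

text \<open>\<open>C\<^sub>c\<^sup>\<infinity>(\<Omega>)\<close>, with functions extended by zero to the whole space.\<close>

definition test_functions :: "(real ^ 'n) set \<Rightarrow> (real ^ 'n \<Rightarrow> real) set" where
  "test_functions \<Omega> = {\<phi>. (\<forall>k. C_k k \<phi>) \<and>
     compact (closure {x. \<phi> x \<noteq> 0}) \<and> closure {x. \<phi> x \<noteq> 0} \<subseteq> \<Omega>}"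

definition has_weak_grad ::
    "(real ^ 'n) set \<Rightarrow> (real ^ 'n \<Rightarrow> real) \<Rightarrow> (real ^ 'n \<Rightarrow> real ^ 'n) \<Rightarrow> bool" where
  "has_weak_grad \<Omega> u g \<longleftrightarrow> u \<in> Lp_loc 1 \<Omega> \<and> g \<in> Lp_loc 1 \<Omega> \<and>
     (\<forall>\<phi>\<in>test_functions \<Omega>. \<forall>i.
        (\<integral>x. u x * partial_deriv i \<phi> x \<partial>lebesgue_on \<Omega>) = - (\<integral>x. g x $ i * \<phi> x \<partial>lebesgue_on \<Omega>))"

text \<open>
  The weak gradient is unique up to null sets, so the choice below only picks a representative;
  it is meaningful only for functions that are \<open>weakly_differentiable\<close>.
\<close>

definition weakly_differentiable :: "(real ^ 'n) set \<Rightarrow> (real ^ 'n \<Rightarrow> real) \<Rightarrow> bool" where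
  "weakly_differentiable \<Omega> u \<longleftrightarrow> (\<exists>g. has_weak_grad \<Omega> u g)"

definition weak_grad :: "(real ^ 'n) set \<Rightarrow> (real ^ 'n \<Rightarrow> real) \<Rightarrow> real ^ 'n \<Rightarrow> real ^ 'n" where
  "weak_grad \<Omega> u = (SOME g. has_weak_grad \<Omega> u g)"

subsection \<open>Function spaces\<close>

text \<open>The \<open>q\<close>-th power of the seminorm \<open>[u]\<^bsub>s,q,E\<^esub>\<close>; only its finiteness is needed.\<close>

definition gagliardo_pow ::
    "real \<Rightarrow> real \<Rightarrow> (real ^ 'n) set \<Rightarrow> (real ^ 'n \<Rightarrow> real) \<Rightarrow> ennreal" where
  "gagliardo_pow s q E u =
     (\<integral>\<^sup>+(x, y). ennreal (\<bar>u x - u y\<bar> powr q / norm (x - y) powr (real CARD('n) + s * q))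
        \<partial>lebesgue_on (E \<times> E))"

definition D1p :: "real \<Rightarrow> (real ^ 'n) set \<Rightarrow> (real ^ 'n \<Rightarrow> real) set" where
  "D1p p \<Omega> = {u. u \<in> Lp (p * real CARD('n) / (real CARD('n) - p)) \<Omega> \<and>
                 weakly_differentiable \<Omega> u \<and> weak_grad \<Omega> u \<in> Lp p \<Omega>}"

definition D01p :: "real \<Rightarrow> (real ^ 'n) set \<Rightarrow> (real ^ 'n \<Rightarrow> real) set" where
  "D01p p \<Omega> = {u. u \<in> D1p p UNIV \<and> (AE x in lebesgue. x \<notin> \<Omega> \<longrightarrow> u x = 0)}"

definition D0sq :: "real \<Rightarrow> real \<Rightarrow> (real ^ 'n) set \<Rightarrow> (real ^ 'n \<Rightarrow> real) set" where
  "D0sq s q \<Omega> = {u. u \<in> Lp (q * real CARD('n) / (real CARD('n) - s * q)) UNIV \<and>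
                    gagliardo_pow s q UNIV u < \<infinity> \<and> (AE x in lebesgue. x \<notin> \<Omega> \<longrightarrow> u x = 0)}"

text \<open>
  The condition \<open>dist(E\<^sup>c, \<Omega>) > 0\<close> is spelled out because \<^const>\<open>setdist\<close> is \<open>0\<close>, rather than
  \<open>\<infinity>\<close>, when one of the sets is empty; \<open>E = \<real>\<^sup>N\<close> has to be admissible.
\<close>

definition Dspq :: "real \<Rightarrow> real \<Rightarrow> real \<Rightarrow> (real ^ 'n) set \<Rightarrow> (real ^ 'n \<Rightarrow> real) set" where
  "Dspq s p q \<Omega> = {u. u \<in> Lp_loc (q - 1) UNIV \<and> u \<in> D1p p \<Omega> \<and>
     (\<exists>E. \<Omega> \<subseteq> E \<and> compact (- E) \<and> (\<exists>\<delta>>0. \<forall>x\<in>- E. \<forall>y\<in>\<Omega>. \<delta> \<le> dist x y) \<and>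
          gagliardo_pow s q E u < \<infinity>)}"

subsection \<open>Weak supersolutions\<close>

definition J :: "real \<Rightarrow> real \<Rightarrow> real" where
  "J q t = \<bar>t\<bar> powr (q - 2) * t"

definition weak_supersolution ::
    "real \<Rightarrow> real \<Rightarrow> real \<Rightarrow> (real ^ 'n) set \<Rightarrow> (real ^ 'n \<Rightarrow> real) \<Rightarrow> bool" where
  "weak_supersolution s p q \<Omega> u \<longleftrightarrow> u \<in> Dspq s p q \<Omega> \<and>
     (\<forall>\<phi> \<in> D01p p \<Omega> \<inter> D0sq s q \<Omega>. (AE x in lebesgue. 0 \<le> \<phi> x) \<longrightarrow>
        (\<integral>x. norm (weak_grad \<Omega> u x) powr (p - 2) * (weak_grad \<Omega> u x \<bullet> weak_grad UNIV \<phi> x)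
            \<partial>lebesgue_on \<Omega>)
        + (\<integral>(x, y). J q (u x - u y) * (\<phi> x - \<phi> y) / norm (x - y) powr (real CARD('n) + s * q)
            \<partial>lebesgue) \<ge> 0)"

end

theory Submission
  imports Defs "HOL-Real_Asymp.Real_Asymp"
begin

text \<open>The supersolution inequality is tested with \<open>\<phi> = (u + d)\<^bsup>1 - p\<^esup> \<eta>\<^bsup>m\<^esup>\<close>, where \<open>\<eta>\<close> is a smooth cutoff at
scale \<open>r\<close>, supported inside \<open>B\<^bsub>3r/2\<^esub>\<close>, and \<open>m\<close> is an integer with \<open>m \<ge> max p q\<close>. In the local term
\<open>\<nabla>u \<cdot> \<nabla>\<phi>\<close> contributes \<open>- (p - 1) \<eta>\<^bsup>m\<^esup> |\<nabla> log (u + d)|\<^bsup>p\<^esup>\<close>, and half of it absorbs the term with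
\<open>\<nabla>\<eta>\<close> (\<open>local_pointwise_estimate\<close>). In the nonlocal term over \<open>B\<^bsub>2r\<^esub> \<times> B\<^bsub>2r\<^esub>\<close>, the monotonicity of
\<open>t \<mapsto> t\<^bsup>1 - p\<^esup>\<close> gives a negative multiple of \<open>|log (a / b)|\<^bsup>q\<^esup> b\<^bsup>q - p\<^esup>\<close> with \<open>a = u(x) + d\<close>,
\<open>b = u(y) + d\<close>, up to the error \<open>|\<eta>(x) - \<eta>(y)|\<^bsup>q\<^esup> (a\<^bsup>q - p\<^esup> + b\<^bsup>q - p\<^esup>)\<close>
(\<open>nonlocal_pointwise_estimate\<close>). That error is integrated with the Lipschitz bound for \<open>\<eta>\<close> and the
integral of \<open>|x - y|\<^bsup>q - N - sq\<^esup>\<close> over a ball. When one of the points lies outside \<open>B\<^bsub>2r\<^esub>\<close>, the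
nonnegativity of \<open>u\<close> bounds the integrand by \<open>(u(x) + d)\<^bsup>q - p\<^esup> |x - y|\<^bsup>- N - sq\<^esup>\<close>. Adding up
gives \<open>logarithmic_energy_estimate\<close>; no finiteness of the right-hand side is needed, because only the
energy terms themselves have to be integrable (\<open>nn_integral_le_of_integral_nonneg\<close>).

Most of the work is to show that \<open>\<phi>\<close> is an admissible test function and that \<open>log (u + d)\<close> has the
expected weak gradient. Both follow from the chain rule \<open>borel_weak_grad_chain\<close>. It is proved without
mollification: difference quotients of \<open>u\<close> converge to the weak derivative in \<open>L\<^sup>1\<close> on compact subsets
(\<open>L1_difference_quotient_le\<close>), and so do those of \<open>F(u)\<close>. The convergence rests on the
continuity of translations in \<open>L\<^sup>1\<close> and on a dual description of the \<open>L\<^sup>1\<close> norm by test functions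
(\<open>L1_norm_le_by_test_functions\<close>), which also yields the fundamental lemma and hence the uniqueness of
weak gradients. Throughout, \<open>u\<close> and its gradient are replaced by Borel representatives, so that all
integrals are taken with respect to the Lebesgue-Borel measure and Tonelli's theorem applies on
\<open>\<real>\<^sup>N \<times> \<real>\<^sup>N\<close>.\<close>

section \<open>Smooth functions and a flat bump\<close>

text \<open>Functions with continuous partial derivatives of every order on the whole space.\<close>

definition smooth_fun :: "(real ^ 'n \<Rightarrow> real) \<Rightarrow> bool" where
  "smooth_fun f \<longleftrightarrow> (\<forall>k. C_k k f)"

lemma partial_deriv_eq:
  assumes "(f has_derivative D) (at x)"
  shows "partial_deriv i f x = D (axis i 1)"
  using frechet_derivative_at[OF assms] by (simp add: partial_deriv_def)

lemma C_k_continuous: "C_k k f \<Longrightarrow> continuous_on UNIV f"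
  by (cases k) (auto intro: differentiable_imp_continuous_on simp: differentiable_on_def
      intro!: differentiable_at_withinI)

lemma C_k_SucD: "C_k (Suc k) f \<Longrightarrow> C_k k f"
proof (induction k arbitrary: f)
  case 0
  then show ?case using C_k_continuous by (metis C_k.simps(1))
next
  case (Suc k)
  then show ?case by (metis C_k.simps(2))
qed

lemma smooth_fun_differentiable: "smooth_fun f \<Longrightarrow> f differentiable (at x)"
  unfolding smooth_fun_def by (metis C_k.simps(2))

lemma smooth_fun_has_derivative:
  "smooth_fun f \<Longrightarrow> (f has_derivative frechet_derivative f (at x)) (at x)"
  using smooth_fun_differentiable frechet_derivative_works by blast

lemma smooth_fun_partial_deriv: "smooth_fun f \<Longrightarrow> smooth_fun (partial_deriv i f)"
  unfolding smooth_fun_def by (metis C_k.simps(2))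

lemma smooth_fun_continuous: "smooth_fun f \<Longrightarrow> continuous_on UNIV f"
  unfolding smooth_fun_def using C_k_continuous by blast

lemma C_k_const: "C_k k (\<lambda>x :: real ^ 'n. c)"
proof (induction k arbitrary: c)
  case (Suc k)
  have "partial_deriv i (\<lambda>x :: real ^ 'n. c) = (\<lambda>x. 0)" for i
    by (rule ext, subst partial_deriv_eq[OF has_derivative_const]) simp
  with Suc show ?case by simp
qed simp

lemma C_k_linear:
  assumes "bounded_linear f"
  shows "C_k k f"
proof (cases k)
  case 0
  then show ?thesis using assms by (simp add: linear_continuous_on)
next
  case (Suc j)
  have D: "(f has_derivative f) (at x)" for x
    using bounded_linear_imp_has_derivative[OF assms] .
  have "partial_deriv i f = (\<lambda>x. f (axis i 1))" for i
    by (rule ext, subst partial_deriv_eq[OF D]) simp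
  with D show ?thesis using C_k_const by (auto simp: Suc differentiable_def)
qed

lemma C_k_add: "C_k k f \<Longrightarrow> C_k k g \<Longrightarrow> C_k k (\<lambda>x. f x + g x)"
proof (induction k arbitrary: f g)
  case 0
  then show ?case by (simp add: continuous_on_add)
next
  case (Suc k)
  have D: "(f has_derivative frechet_derivative f (at x)) (at x)"
    "(g has_derivative frechet_derivative g (at x)) (at x)" for x
    using Suc.prems by (simp_all add: frechet_derivative_works[symmetric])
  have "partial_deriv i (\<lambda>x. f x + g x) = (\<lambda>x. partial_deriv i f x + partial_deriv i g x)" for i
    by (rule ext, subst partial_deriv_eq[OF has_derivative_add[OF D]]) (simp add: partial_deriv_def)
  then show ?case using Suc by (auto intro: differentiable_add)
qed

lemma partial_deriv_mult:
  assumes "f differentiable (at x)" "g differentiable (at x)"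
  shows "partial_deriv i (\<lambda>x. f x * g x) x = partial_deriv i f x * g x + f x * partial_deriv i g x"
proof -
  have D: "(f has_derivative frechet_derivative f (at x)) (at x)"
    "(g has_derivative frechet_derivative g (at x)) (at x)"
    using assms frechet_derivative_works by auto
  show ?thesis
    by (subst partial_deriv_eq[OF has_derivative_mult[OF D]]) (simp add: partial_deriv_def)
qed

lemma C_k_mult: "C_k k f \<Longrightarrow> C_k k g \<Longrightarrow> C_k k (\<lambda>x. f x * g x)"
proof (induction k arbitrary: f g)
  case 0
  then show ?case by (simp add: continuous_on_mult)
next
  case (Suc k)
  have "partial_deriv i (\<lambda>x. f x * g x) = (\<lambda>x. partial_deriv i f x * g x + f x * partial_deriv i g x)" for i
    using Suc.prems by (intro ext partial_deriv_mult) auto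
  moreover have "C_k k f" "C_k k g" using Suc.prems C_k_SucD by auto
  ultimately show ?case using Suc by (auto intro: differentiable_mult C_k_add)
qed

lemma smooth_fun_const: "smooth_fun (\<lambda>x. c)"
  by (simp add: smooth_fun_def C_k_const)

lemma smooth_fun_add: "smooth_fun f \<Longrightarrow> smooth_fun g \<Longrightarrow> smooth_fun (\<lambda>x. f x + g x)"
  by (simp add: smooth_fun_def C_k_add)

lemma smooth_fun_mult: "smooth_fun f \<Longrightarrow> smooth_fun g \<Longrightarrow> smooth_fun (\<lambda>x. f x * g x)"
  by (simp add: smooth_fun_def C_k_mult)

lemma smooth_fun_power: "smooth_fun f \<Longrightarrow> smooth_fun (\<lambda>x. f x ^ m)"
  by (induction m) (auto intro: smooth_fun_mult smooth_fun_const)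

lemma smooth_fun_polynomial:
  fixes f :: "real ^ 'n \<Rightarrow> real"
  shows "real_polynomial_function f \<Longrightarrow> smooth_fun f"
  by (induction rule: real_polynomial_function.induct)
    (simp_all add: smooth_fun_def C_k_linear C_k_const C_k_add C_k_mult)

lemma smooth_fun_quadratic:
  fixes a :: "real ^ 'n"
  shows "smooth_fun (\<lambda>x. b + c * (norm (x - a))\<^sup>2)"
proof (rule smooth_fun_polynomial)
  have "real_polynomial_function (\<lambda>x::real^'n. x $ i - a $ i)" for i
    using real_polynomial_function.intros(3)[OF real_polynomial_function.intros(1)[OF bounded_linear_vec_nth]
        real_polynomial_function.intros(2)[of "- a $ i"]] by simp
  then have "real_polynomial_function (\<lambda>x. b + c * (\<Sum>i\<in>UNIV. (x $ i - a $ i) * (x $ i - a $ i)))"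
    by (intro real_polynomial_function.intros(2-4)
        real_polynomial_function_sum) auto
  then show "real_polynomial_function (\<lambda>x. b + c * (norm (x - a))\<^sup>2)"
    by (simp add: power2_norm_eq_inner inner_vec_def)
qed

lemma partial_deriv_translate:
  assumes "f differentiable (at (x + a))"
  shows "partial_deriv i (\<lambda>x. f (x + a)) x = partial_deriv i f (x + a)"
proof -
  have D: "(f has_derivative frechet_derivative f (at (x + a))) (at (x + a))"
    using assms frechet_derivative_works by auto
  have T: "((\<lambda>x. x + a) has_derivative (\<lambda>x. x)) (at x)"
    by (auto intro!: derivative_eq_intros)
  show ?thesis
    by (subst partial_deriv_eq[OF has_derivative_compose[OF T D]]) (simp add: partial_deriv_def)
qed

lemma C_k_translate: "C_k k f \<Longrightarrow> C_k k (\<lambda>x. f (x + a))"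
proof (induction k arbitrary: f)
  case 0
  then show ?case
    by (auto intro!: continuous_on_compose2[of UNIV f] continuous_intros)
next
  case (Suc k)
  have "partial_deriv i (\<lambda>x. f (x + a)) = (\<lambda>x. partial_deriv i f (x + a))" for i
    using Suc.prems by (intro ext partial_deriv_translate) auto
  moreover have "(\<lambda>x. f (x + a)) differentiable at x" for x
    using Suc.prems differentiable_compose[of f "\<lambda>x. x + a" x UNIV] by simp
  ultimately show ?case using Suc by auto
qed

lemma smooth_fun_translate: "smooth_fun f \<Longrightarrow> smooth_fun (\<lambda>x. f (x + a))"
  by (simp add: smooth_fun_def C_k_translate)

text \<open>The functions \<open>P(1/t) exp(-1/t)\<close>, extended by \<open>0\<close> to \<open>t \<le> 0\<close>. This family is closed under
  differentiation, which makes its members smooth.\<close>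

definition flat_exp :: "real poly \<Rightarrow> real \<Rightarrow> real" where
  "flat_exp P t = (if 0 < t then poly P (1 / t) * exp (- (1 / t)) else 0)"

lemma poly_times_exp_neg_tendsto: "((\<lambda>s::real. poly P s * exp (- s)) \<longlongrightarrow> 0) at_top"
proof -
  have "((\<lambda>s::real. \<Sum>i\<le>degree P. coeff P i * (s ^ i / exp s)) \<longlongrightarrow> (\<Sum>i\<le>degree P. coeff P i * 0)) at_top"
    by (intro tendsto_intros tendsto_power_div_exp_0)
  moreover have "(\<Sum>i\<le>degree P. coeff P i * (s ^ i / exp s)) = poly P s * exp (- s)" for s :: real
    by (simp add: poly_altdef exp_minus sum_distrib_right divide_inverse mult.assoc)
  ultimately show ?thesis by simp
qed

lemma flat_exp_deriv:
  "(flat_exp P has_real_derivative flat_exp ((P - pderiv P) * [:0, 0, 1:]) t) (at t)"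
proof -
  consider "t < 0" | "0 < t" | "t = 0" by linarith
  then show ?thesis
  proof cases
    case 1
    have "((\<lambda>_. 0) has_real_derivative 0) (at t)" by simp
    then have "(flat_exp P has_real_derivative 0) (at t)"
      by (rule DERIV_cong_ev[THEN iffD1, rotated -1])
        (use 1 in \<open>auto simp: flat_exp_def intro!: eventually_nhds_in_open[of "{..<0}", THEN eventually_mono]\<close>)
    then show ?thesis using 1 by (simp add: flat_exp_def)
  next
    case 2
    have "((\<lambda>t. poly P (1 / t) * exp (- (1 / t))) has_real_derivative
      (poly (pderiv P) (1/t) * (- 1 / t^2)) * exp (- (1 / t)) + poly P (1/t) * (exp (- (1 / t)) * (1/ t^2))) (at t)"
      using 2 by (auto intro!: derivative_eq_intros DERIV_chain2[OF poly_DERIV] simp: power2_eq_square divide_simps)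
    then have "(flat_exp P has_real_derivative
      (poly (pderiv P) (1/t) * (- 1 / t^2)) * exp (- (1 / t)) + poly P (1/t) * (exp (- (1 / t)) * (1/ t^2))) (at t)"
      by (rule DERIV_cong_ev[THEN iffD1, rotated -1])
        (use 2 in \<open>auto simp: flat_exp_def intro!: eventually_nhds_in_open[of "{0<..}", THEN eventually_mono]\<close>)
    moreover have "(poly (pderiv P) (1/t) * (- 1 / t^2)) * exp (- (1 / t)) + poly P (1/t) * (exp (- (1 / t)) * (1/ t^2))
      = flat_exp ((P - pderiv P) * [:0, 0, 1:]) t"
      using 2 by (simp add: flat_exp_def field_simps power2_eq_square)
    ultimately show ?thesis by simp
  next
    case 3
    have "((\<lambda>h. flat_exp P h / h) \<longlongrightarrow> 0) (at_left 0)"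
      by (rule tendsto_eventually) (auto simp: flat_exp_def eventually_at_filter)
    moreover have "((\<lambda>h. flat_exp P h / h) \<longlongrightarrow> 0) (at_right 0)"
    proof -
      have "((\<lambda>h. poly (P * [:0, 1:]) (inverse h) * exp (- (inverse h))) \<longlongrightarrow> 0) (at_right (0::real))"
        by (rule filterlim_compose[OF poly_times_exp_neg_tendsto filterlim_inverse_at_top_right])
      moreover have "\<forall>\<^sub>F h in at_right 0. poly (P * [:0, 1:]) (inverse h) * exp (- (inverse h)) = flat_exp P h / h"
        by (auto simp: flat_exp_def eventually_at_filter divide_simps inverse_eq_divide)
      ultimately show ?thesis using Lim_transform_eventually by fast
    qed
    ultimately have "((\<lambda>h. flat_exp P h / h) \<longlongrightarrow> 0) (at 0)"
      using filterlim_split_at by blast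
    then show ?thesis
      using 3 by (simp add: has_field_derivative_iff flat_exp_def)
  qed
qed

lemma smooth_fun_flat_exp:
  assumes w: "smooth_fun w"
  shows "smooth_fun (\<lambda>x. flat_exp P (w x))"
proof -
  have "C_k k (\<lambda>x. flat_exp P (w x))" for k
  proof (induction k arbitrary: P)
    case 0
    have "continuous_on UNIV (flat_exp P)"
      using flat_exp_deriv DERIV_isCont by (simp add: continuous_on_eq_continuous_at) blast
    then show ?case
      using smooth_fun_continuous[OF w] continuous_on_compose2[of UNIV "flat_exp P" UNIV w] by simp
  next
    case (Suc k)
    have D: "((\<lambda>x. flat_exp P (w x)) has_derivative
       (\<lambda>v. flat_exp ((P - pderiv P) * [:0, 0, 1:]) (w x) * frechet_derivative w (at x) v)) (at x)" for x
      using has_derivative_compose[OF smooth_fun_has_derivative[OF w]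
          flat_exp_deriv[of P "w x", unfolded has_field_derivative_def]]
      by simp
    have "partial_deriv i (\<lambda>x. flat_exp P (w x)) =
        (\<lambda>x. flat_exp ((P - pderiv P) * [:0, 0, 1:]) (w x) * partial_deriv i w x)" for i
      by (rule ext, subst partial_deriv_eq[OF D]) (simp add: partial_deriv_def)
    moreover have "C_k k (partial_deriv i w)" for i
      using smooth_fun_partial_deriv[OF w] by (simp add: smooth_fun_def)
    moreover have "(\<lambda>x. flat_exp P (w x)) differentiable at x" for x
      using D unfolding differentiable_def by blast
    ultimately show ?case using Suc by (auto intro: C_k_mult)
  qed
  then show ?thesis by (simp add: smooth_fun_def)
qed

text \<open>The case \<open>P = 1\<close>: smooth, with values in \<open>[0, 1)\<close>, and positive exactly on \<open>t > 0\<close>. Composed with a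
  smooth \<open>w\<close> it gives smooth functions supported where \<open>w \<ge> 0\<close>.\<close>

abbreviation bump :: "real \<Rightarrow> real" where "bump \<equiv> flat_exp 1"

lemma bump_simps: "bump t = (if 0 < t then exp (- (1 / t)) else 0)"
  by (simp add: flat_exp_def)

lemma bump_bounds: "0 \<le> bump t" "bump t \<le> 1" 
  by (auto simp: bump_simps)

lemma bump_pos_iff: "0 < bump t \<longleftrightarrow> 0 < t"  "bump t = 0 \<longleftrightarrow> t \<le> 0"
  by (auto simp: bump_simps)

lemma bump_deriv: "\<exists>b. (bump has_real_derivative b) (at t) \<and> \<bar>b\<bar> \<le> 2"
proof (intro exI conjI)
  show "(bump has_real_derivative flat_exp [:0, 0, 1:] t) (at t)"
    using flat_exp_deriv[of 1 t] by simp
  have "s^2 * exp (- s) \<le> 2" if "0 \<le> s" for s :: real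
    using exp_lower_Taylor_quadratic[OF that] that by (simp add: exp_minus field_simps)
  from this[of "1/t"] show "\<bar>flat_exp [:0, 0, 1:] t\<bar> \<le> 2"
    by (auto simp: flat_exp_def power2_eq_square)
qed

section \<open>Continuity of translations in the mean\<close>

lemma integrable_lborel_translate:
  fixes f :: "'a::euclidean_space \<Rightarrow> real"
  assumes "integrable lborel f"
  shows "integrable lborel (\<lambda>x. f (x + v))"
proof -
  have "integrable (distr lborel borel ((+) v)) f"
    using assms by (simp add: lborel_distr_plus)
  then show ?thesis
    using borel_measurable_integrable[OF assms] by (subst (asm) integrable_distr_eq) (auto simp: add.commute)
qed

lemma integral_lborel_translate:
  fixes f :: "'a::euclidean_space \<Rightarrow> real"
  assumes "f \<in> borel_measurable borel"
  shows "(LBINT x. f (x + v)) = (LBINT x. f x)"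
proof -
  have "(\<integral>x. f x \<partial>distr lborel borel ((+) v)) = (LBINT x. f (v + x))"
    by (rule integral_distr) (use assms in auto)
  then show ?thesis by (simp add: lborel_distr_plus add.commute)
qed

lemma nn_integral_lborel_translate:
  fixes f :: "'a::euclidean_space \<Rightarrow> ennreal"
  assumes "f \<in> borel_measurable borel"
  shows "(\<integral>\<^sup>+x. f (x + v) \<partial>lborel) = (\<integral>\<^sup>+x. f x \<partial>lborel)"
proof -
  have "(\<integral>\<^sup>+x. f x \<partial>distr lborel borel ((+) v)) = (\<integral>\<^sup>+x. f (v + x) \<partial>lborel)"
    by (rule nn_integral_distr) (use assms in auto)
  then show ?thesis by (simp add: lborel_distr_plus add.commute)
qed

text \<open>A Lusin-type statement; clamping to \<open>[-M, M]\<close> keeps the bound along the approximating sequence.\<close>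

lemma bounded_borel_ae_limit_of_continuous:
  fixes f :: "'a::euclidean_space \<Rightarrow> real"
  assumes f: "f \<in> borel_measurable borel" and M: "\<And>x. \<bar>f x\<bar> \<le> M"
  obtains c where "\<And>n::nat. continuous_on UNIV (c n)" "\<And>n x. \<bar>c n x\<bar> \<le> M"
    "AE x in lborel. (\<lambda>n. c n x) \<longlonglongrightarrow> f x"
proof -
  have "f \<in> borel_measurable (lebesgue_on UNIV)"
    using measurable_completion[of f lborel borel] f by (simp add: lebesgue_on_UNIV_eq)
  then have "f measurable_on UNIV"
    using measurable_on_iff_borel_measurable[of UNIV f] by simp
  then obtain N g where N: "negligible N" and g: "\<And>n. continuous_on UNIV (g n)"
    and lim: "\<And>x. x \<notin> N \<Longrightarrow> (\<lambda>n. g n x) \<longlonglongrightarrow> f x"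
    unfolding measurable_on_def by auto
  have AE: "AE x in lborel. x \<notin> N"
    using N AE_not_in[of N lebesgue] by (simp add: negligible_iff_null_sets AE_completion_iff)
  show ?thesis
  proof
    show "continuous_on UNIV (\<lambda>x. max (- M) (min M (g n x)))" for n
      using g by (intro continuous_intros)
    show "\<bar>max (- M) (min M (g n x))\<bar> \<le> M" for n x
      using M[of x] by auto
    show "AE x in lborel. (\<lambda>n. max (- M) (min M (g n x))) \<longlonglongrightarrow> f x"
      using AE
    proof eventually_elim
      case (elim x)
      have "(\<lambda>n. max (- M) (min M (g n x))) \<longlonglongrightarrow> max (- M) (min M (f x))"
        by (intro tendsto_intros lim elim)
      moreover have "max (- M) (min M (f x)) = f x" using M[of x] by auto
      ultimately show ?case by simp
    qed
  qed
qed

lemma integrable_approx_continuous_compact_support: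
  fixes f :: "'a::euclidean_space \<Rightarrow> real"
  assumes f: "integrable lborel f" and e: "0 < e"
  obtains c R where "continuous_on UNIV c" "0 < R" "\<And>x. R < norm x \<Longrightarrow> c x = 0"
    "integrable lborel c" "(LBINT x. \<bar>f x - c x\<bar>) < e"
proof -
  have [measurable]: "f \<in> borel_measurable borel" using borel_measurable_integrable[OF f] by simp
  define t where "t n x = (if \<bar>f x\<bar> \<le> real n \<and> norm x \<le> real n then f x else 0)" for n :: nat and x
  have tm[measurable]: "t n \<in> borel_measurable borel" for n
    unfolding t_def by measurable
  have "(\<lambda>n. \<integral>x. \<bar>f x - t n x\<bar> \<partial>lborel) \<longlonglongrightarrow> integral\<^sup>L lborel (\<lambda>x::'a. 0)"
  proof (rule integral_dominated_convergence)
    show "integrable lborel (\<lambda>x. \<bar>f x\<bar>)" using f by simp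
    show "AE x in lborel. (\<lambda>n. \<bar>f x - t n x\<bar>) \<longlonglongrightarrow> 0"
    proof (intro AE_I2)
      fix x
      obtain m where m: "max \<bar>f x\<bar> (norm x) \<le> real m" using real_arch_simple by blast
      have "\<forall>\<^sub>F n in sequentially. \<bar>f x - t n x\<bar> = 0"
        using eventually_ge_at_top[of m] by eventually_elim (use m in \<open>auto simp: t_def\<close>)
      then show "(\<lambda>n. \<bar>f x - t n x\<bar>) \<longlonglongrightarrow> 0" by (rule tendsto_eventually)
    qed
    show "AE x in lborel. norm \<bar>f x - t n x\<bar> \<le> \<bar>f x\<bar>" for n by (auto simp: t_def)
  qed measurable
  then have "\<forall>\<^sub>F n in sequentially. (LBINT x. \<bar>f x - t n x\<bar>) < e / 2"
    using e by (intro order_tendstoD) auto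
  then obtain n where n: "(LBINT x. \<bar>f x - t n x\<bar>) < e / 2"
    using eventually_happens trivial_limit_sequentially by blast
  have tb: "\<bar>t n x\<bar> \<le> real n" "real n < norm x \<Longrightarrow> t n x = 0" for x by (auto simp: t_def)
  obtain c where c: "\<And>k::nat. continuous_on UNIV (c k)" "\<And>k x. \<bar>c k x\<bar> \<le> real n"
    "AE x in lborel. (\<lambda>k. c k x) \<longlonglongrightarrow> t n x"
    using bounded_borel_ae_limit_of_continuous[OF tm[of n] tb(1)] by blast
  define cut where "cut x = max 0 (min 1 (real n + 1 - norm x))" for x :: 'a
  have [simp]: "cut x = 0" if "real n + 1 \<le> norm x" for x using that by (simp add: cut_def)
  have cut_bounds: "0 \<le> cut x" "cut x \<le> 1" for x by (auto simp: cut_def)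
  have cont: "continuous_on UNIV (\<lambda>x. c k x * cut x)" for k
    unfolding cut_def by (intro continuous_intros c)
  then have cm[measurable]: "(\<lambda>x. c k x * cut x) \<in> borel_measurable borel" for k
    by (rule borel_measurable_continuous_onI)
  have dom: "integrable lborel (\<lambda>x. 2 * real n * indicator (cball 0 (real n + 1)) x :: real)"
    by (intro integrable_mult_right integrable_real_indicator) (use emeasure_bounded_finite[OF bounded_cball] in auto)
  have le1: "\<bar>c k x * cut x\<bar> \<le> real n" for k x
    using mult_mono[OF c(2)[of k x], of "cut x" 1] cut_bounds[of x] by (simp add: abs_mult)
  have "(\<lambda>k. \<integral>x. \<bar>t n x - c k x * cut x\<bar> \<partial>lborel) \<longlonglongrightarrow> integral\<^sup>L lborel (\<lambda>x::'a. 0)"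
  proof (rule integral_dominated_convergence[OF _ _ dom])
    show "AE x in lborel. (\<lambda>k. \<bar>t n x - c k x * cut x\<bar>) \<longlonglongrightarrow> 0"
      using c(3)
    proof eventually_elim
      case (elim x)
      have "(\<lambda>k. \<bar>t n x - c k x * cut x\<bar>) \<longlonglongrightarrow> \<bar>t n x - t n x * cut x\<bar>"
        by (intro tendsto_intros elim)
      moreover have "t n x - t n x * cut x = 0" by (auto simp: t_def cut_def)
      ultimately show ?case by simp
    qed
    show "AE x in lborel. norm \<bar>t n x - c k x * cut x\<bar> \<le> 2 * real n * indicator (cball 0 (real n + 1)) x" for k
    proof (intro AE_I2)
      fix x
      show "norm \<bar>t n x - c k x * cut x\<bar> \<le> 2 * real n * indicator (cball 0 (real n + 1)) x"
        using le1[of k x] tb[of x] by (auto simp: indicator_def not_le)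
    qed
  qed measurable
  then have "\<forall>\<^sub>F k in sequentially. (LBINT x. \<bar>t n x - c k x * cut x\<bar>) < e / 2"
    using e by (intro order_tendstoD) auto
  then obtain k where k: "(LBINT x. \<bar>t n x - c k x * cut x\<bar>) < e / 2"
    using eventually_happens trivial_limit_sequentially by blast
  have int: "integrable lborel (\<lambda>x. c k x * cut x)"
  proof (rule Bochner_Integration.integrable_bound[OF dom])
    show "AE x in lborel. norm (c k x * cut x) \<le> norm (2 * real n * indicator (cball 0 (real n + 1)) x :: real)"
    proof (intro AE_I2)
      fix x
      show "norm (c k x * cut x) \<le> norm (2 * real n * indicator (cball 0 (real n + 1)) x :: real)"
        using le1[of k x] by (auto simp: indicator_def not_le)
    qed
  qed measurable
  have tint: "integrable lborel (t n)"
    by (rule Bochner_Integration.integrable_bound[OF f]) (auto simp: t_def)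
  have "(LBINT x. \<bar>f x - c k x * cut x\<bar>) \<le> (LBINT x. \<bar>f x - t n x\<bar> + \<bar>t n x - c k x * cut x\<bar>)"
    using f int tint by (intro integral_mono) auto
  also have "\<dots> = (LBINT x. \<bar>f x - t n x\<bar>) + (LBINT x. \<bar>t n x - c k x * cut x\<bar>)"
    using f int tint by (intro Bochner_Integration.integral_add) auto
  finally show ?thesis
    using n k by (intro that[of "\<lambda>x. c k x * cut x" "real n + 1"] cont int) auto
qed

lemma L1_translation_continuous:
  fixes f :: "'a::euclidean_space \<Rightarrow> real"
  assumes f: "integrable lborel f" and e: "0 < e"
  obtains \<delta> where "0 < \<delta>" "\<And>v. norm v < \<delta> \<Longrightarrow> (LBINT x. \<bar>f (x + v) - f x\<bar>) < e"
proof -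
  obtain c R where c: "continuous_on UNIV c" "0 < R" "\<And>x. R < norm x \<Longrightarrow> c x = 0"
    "integrable lborel c" and fc: "(LBINT x. \<bar>f x - c x\<bar>) < e / 4"
    using integrable_approx_continuous_compact_support[OF f, of "e/4"] e by auto
  have [measurable]: "c \<in> borel_measurable borel" "f \<in> borel_measurable borel"
    using borel_measurable_integrable[OF c(4)] borel_measurable_integrable[OF f] by simp_all
  define V where "V = measure lborel (cball (0::'a) (R + 1)) + 1"
  have V: "0 < V" by (simp add: V_def add_nonneg_pos)
  have "uniformly_continuous_on (cball 0 (R + 2)) c"
    using c(1) by (intro compact_uniformly_continuous) (auto intro: continuous_on_subset)
  then obtain d where d: "0 < d" "\<And>x y. \<lbrakk>x \<in> cball 0 (R+2); y \<in> cball 0 (R+2); dist y x < d\<rbrakk> \<Longrightarrow> dist (c y) (c x) < e / (4 * V)"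
    unfolding uniformly_continuous_on_def using e V by (metis divide_pos_pos mult_pos_pos zero_less_numeral)
  have dom: "integrable lborel (\<lambda>x. e / (4 * V) * indicator (cball (0::'a) (R + 1)) x :: real)"
    by (intro integrable_mult_right integrable_real_indicator) (use emeasure_bounded_finite[OF bounded_cball] in auto)
  show ?thesis
  proof
    show "0 < min d 1" using d by simp
    fix v :: 'a assume v: "norm v < min d 1"
    have pt: "\<bar>c (x + v) - c x\<bar> \<le> e / (4 * V) * indicator (cball 0 (R + 1)) x" for x
    proof (cases "norm x \<le> R + 1")
      case True
      then have "x \<in> cball 0 (R + 2)" "x + v \<in> cball 0 (R + 2)"
        using v norm_triangle_ineq[of x v] by (simp_all add: mem_cball_0)
      then have "dist (c (x + v)) (c x) < e / (4 * V)"
        using v by (intro d(2)) (simp_all add: dist_norm)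
      then show ?thesis using True by (simp add: dist_norm)
    next
      case False
      then have "R < norm (x + v)" using v norm_triangle_ineq[of "x + v" "-v"] by simp
      then show ?thesis using False c(3)[of x] c(3)[of "x + v"] by simp
    qed
    have cv: "integrable lborel (\<lambda>x. c (x + v))" "integrable lborel (\<lambda>x. f (x + v))"
      using c f by (auto intro: integrable_lborel_translate)
    have "(LBINT x. \<bar>c (x + v) - c x\<bar>) \<le> (LBINT x. e / (4 * V) * indicator (cball (0::'a) (R + 1)) x)"
      using cv c dom pt by (intro integral_mono) auto
    also have "\<dots> = e / (4 * V) * measure lborel (cball (0::'a) (R + 1))" by simp
    also have "\<dots> \<le> e / (4 * V) * V" using e V by (intro mult_left_mono) (auto simp: V_def)
    also have "\<dots> = e / 4" using V by simp
    finally have 1: "(LBINT x. \<bar>c (x + v) - c x\<bar>) \<le> e / 4" .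
    have 2: "(LBINT x. \<bar>f (x + v) - c (x + v)\<bar>) = (LBINT x. \<bar>f x - c x\<bar>)"
      by (rule integral_lborel_translate) measurable
    have "(LBINT x. \<bar>f (x + v) - f x\<bar>) \<le>
       (LBINT x. \<bar>f (x + v) - c (x + v)\<bar> + \<bar>c (x + v) - c x\<bar> + \<bar>f x - c x\<bar>)"
      using cv c f by (intro integral_mono) auto
    also have "\<dots> = (LBINT x. \<bar>f (x + v) - c (x + v)\<bar>) + (LBINT x. \<bar>c (x + v) - c x\<bar>) + (LBINT x. \<bar>f x - c x\<bar>)"
      using cv c f by (subst Bochner_Integration.integral_add; auto)+
    finally show "(LBINT x. \<bar>f (x + v) - f x\<bar>) < e" using 1 2 fc e by simp
  qed
qed

section \<open>Test functions and the fundamental lemma\<close>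

lemma test_functionsI:
  assumes "smooth_fun \<phi>" "compact K" "K \<subseteq> \<Omega>" "\<And>x. x \<notin> K \<Longrightarrow> \<phi> x = 0"
  shows "\<phi> \<in> test_functions \<Omega>"
proof -
  have "closure {x. \<phi> x \<noteq> 0} \<subseteq> K"
    using assms by (intro closure_minimal compact_imp_closed) auto
  moreover from this have "compact (closure {x. \<phi> x \<noteq> 0})"
    using assms(2) compact_closure bounded_subset compact_imp_bounded closure_subset by (metis order_trans)
  ultimately show ?thesis
    using assms(1) order_trans[OF _ assms(3)] by (simp add: test_functions_def smooth_fun_def)
qed

lemma test_functionsE:
  assumes "\<phi> \<in> test_functions \<Omega>"
  obtains K where "compact K" "K \<subseteq> \<Omega>" "\<And>x. x \<notin> K \<Longrightarrow> \<phi> x = 0" "K = closure {x. \<phi> x \<noteq> 0}"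
proof
  show "compact (closure {x. \<phi> x \<noteq> 0})" "closure {x. \<phi> x \<noteq> 0} \<subseteq> \<Omega>"
    using assms by (auto simp: test_functions_def)
  show "\<phi> x = 0" if "x \<notin> closure {x. \<phi> x \<noteq> 0}" for x
    using that closure_subset[of "{x. \<phi> x \<noteq> 0}"] by blast
qed (rule refl)

lemma test_functions_smooth: "\<phi> \<in> test_functions \<Omega> \<Longrightarrow> smooth_fun \<phi>"
  by (auto simp: test_functions_def smooth_fun_def)

lemma test_functions_mono: "\<phi> \<in> test_functions \<Omega> \<Longrightarrow> \<Omega> \<subseteq> \<Omega>' \<Longrightarrow> \<phi> \<in> test_functions \<Omega>'"
  by (auto simp: test_functions_def)

lemma test_functions_measurable[measurable_dest]:
  "\<phi> \<in> test_functions \<Omega> \<Longrightarrow> \<phi> \<in> borel_measurable borel"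
  by (intro borel_measurable_continuous_onI smooth_fun_continuous test_functions_smooth)

lemma test_functions_bounded:
  assumes "\<phi> \<in> test_functions \<Omega>"
  obtains B where "0 < B" "\<And>x. \<bar>\<phi> x\<bar> \<le> B"
proof -
  obtain K where K: "compact K" "\<And>x. x \<notin> K \<Longrightarrow> \<phi> x = 0"
    using test_functionsE[OF assms] by metis
  have "continuous_on K \<phi>"
    using smooth_fun_continuous[OF test_functions_smooth[OF assms]] continuous_on_subset by blast
  then have "bounded (\<phi> ` K)" using K compact_continuous_image compact_imp_bounded by blast
  then obtain B where B: "0 < B" "\<And>x. x \<in> K \<Longrightarrow> \<bar>\<phi> x\<bar> \<le> B"
    unfolding bounded_pos by auto
  then have "\<bar>\<phi> x\<bar> \<le> B" for x using K(2)[of x] by (cases "x \<in> K") auto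
  with B show ?thesis using that by blast
qed

lemma partial_deriv_eq_0_outside:
  assumes "open U" "x \<in> U" "\<And>y. y \<in> U \<Longrightarrow> f y = 0"
  shows "partial_deriv i f x = 0"
proof -
  have "(f has_derivative (\<lambda>_. 0)) (at x)"
    by (rule has_derivative_transform_within_open[of "\<lambda>_. 0" _ _ _ U]) (use assms in auto)
  then show ?thesis by (simp add: partial_deriv_eq)
qed

lemma test_functions_partial_deriv:
  assumes "\<phi> \<in> test_functions \<Omega>"
  shows "partial_deriv i \<phi> \<in> test_functions \<Omega>"
proof -
  obtain K where K: "compact K" "K \<subseteq> \<Omega>" "\<And>x. x \<notin> K \<Longrightarrow> \<phi> x = 0"
    using test_functionsE[OF assms] by metis
  show ?thesis
  proof (rule test_functionsI[OF _ K(1,2)])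
    show "smooth_fun (partial_deriv i \<phi>)"
      by (intro smooth_fun_partial_deriv test_functions_smooth[OF assms])
    show "partial_deriv i \<phi> x = 0" if "x \<notin> K" for x
      by (rule partial_deriv_eq_0_outside[of "- K"]) (use K that compact_imp_closed in auto)
  qed
qed

lemma test_functions_mult:
  assumes "\<phi> \<in> test_functions \<Omega>" "smooth_fun \<psi>"
  shows "(\<lambda>x. \<phi> x * \<psi> x) \<in> test_functions \<Omega>"
proof -
  obtain K where K: "compact K" "K \<subseteq> \<Omega>" "\<And>x. x \<notin> K \<Longrightarrow> \<phi> x = 0"
    using test_functionsE[OF assms(1)] by metis
  show ?thesis
    by (rule test_functionsI[OF smooth_fun_mult[OF test_functions_smooth[OF assms(1)] assms(2)] K(1,2)])
      (use K in auto)
qed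

text \<open>Borel functions that are integrable over every compact subset of \<open>\<Omega>\<close>. Nothing is required of the
  values outside \<open>\<Omega>\<close> except measurability.\<close>

definition loc_integrable :: "'a::euclidean_space set \<Rightarrow> ('a \<Rightarrow> 'b::{banach, second_countable_topology}) \<Rightarrow> bool" where
  "loc_integrable \<Omega> f \<longleftrightarrow> f \<in> borel_measurable borel \<and>
     (\<forall>K. compact K \<and> K \<subseteq> \<Omega> \<longrightarrow> set_integrable lborel K f)"

lemma integrable_times_test_function:
  assumes f: "loc_integrable \<Omega> f" and \<phi>: "\<phi> \<in> test_functions \<Omega>"
  shows "integrable lborel (\<lambda>x. f x * \<phi> x)"
proof -
  obtain K where K: "compact K" "K \<subseteq> \<Omega>" "\<And>x. x \<notin> K \<Longrightarrow> \<phi> x = 0"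
    using test_functionsE[OF \<phi>] by metis
  obtain B where B: "0 < B" "\<And>x. \<bar>\<phi> x\<bar> \<le> B" using test_functions_bounded[OF \<phi>] by blast
  have [measurable]: "f \<in> borel_measurable borel" "\<phi> \<in> borel_measurable borel"
    using f \<phi> by (auto simp: loc_integrable_def test_functions_measurable)
  have "integrable lborel (\<lambda>x. B * (indicator K x *\<^sub>R f x))"
    using f K by (auto simp: loc_integrable_def set_integrable_def)
  then show ?thesis
  proof (rule Bochner_Integration.integrable_bound)
    have "norm (f x * \<phi> x) \<le> norm (B * (indicator K x *\<^sub>R f x))" for x
      using mult_right_mono[OF B(2)[of x], of "\<bar>f x\<bar>"] K(3)[of x] B(1)
      by (cases "x \<in> K") (auto simp: abs_mult mult.commute)
    then show "AE x in lborel. norm (f x * \<phi> x) \<le> norm (B * (indicator K x *\<^sub>R f x))"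
      by simp
  qed measurable
qed

text \<open>The \<open>L\<^sup>1\<close> norm over \<open>{w > 0}\<close> is determined by pairing with test functions bounded by \<open>1\<close>. The pairing
  is extended to continuous functions by the Stone-Weierstrass theorem, because a polynomial times a
  cutoff is a test function; then to \<open>sgn f\<close> by bounded convergence. The cutoffs
  \<open>bump (k w(x) - 1)\<close> increase to the indicator of \<open>{w > 0}\<close> as \<open>k \<rightarrow> \<infinity>\<close>, and each is supported in the compact
  set \<open>{w \<ge> 1/k}\<close>.\<close>

lemma L1_norm_le_by_test_functions:
  fixes w f :: "real ^ 'n \<Rightarrow> real"
  assumes w: "smooth_fun w" and bdd: "bounded {x. 0 < w x}"
    and f: "integrable lborel f"
    and le: "\<And>\<phi>. \<phi> \<in> test_functions {x. 0 < w x} \<Longrightarrow> (\<And>x. \<bar>\<phi> x\<bar> \<le> 1) \<Longrightarrow>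
      \<bar>\<integral>x. f x * \<phi> x \<partial>lborel\<bar> \<le> M"
  shows "(LBINT x. indicator {x. 0 < w x} x * \<bar>f x\<bar>) \<le> M"
proof -
  let ?V = "{x. 0 < w x}"
  have [measurable]: "f \<in> borel_measurable borel" using borel_measurable_integrable[OF f] by simp
  have wc: "continuous_on UNIV w" by (rule smooth_fun_continuous[OF w])
  have [measurable]: "w \<in> borel_measurable borel"
    by (rule borel_measurable_continuous_onI[OF wc])
  have V[measurable]: "?V \<in> sets borel"
    by measurable
  define \<zeta> where "\<zeta> n x = bump (real (Suc n) * w x - 1)" for n x
  have \<zeta>s: "smooth_fun (\<zeta> n)" for n
  proof -
    have "smooth_fun (\<lambda>x. real (Suc n) * w x + (-1))"
      by (intro smooth_fun_add smooth_fun_mult smooth_fun_const w)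
    then show ?thesis unfolding \<zeta>_def using smooth_fun_flat_exp by fastforce
  qed
  have [measurable]: "\<zeta> n \<in> borel_measurable borel" for n
    by (intro borel_measurable_continuous_onI smooth_fun_continuous \<zeta>s)
  have \<zeta>b: "0 \<le> \<zeta> n x" "\<zeta> n x \<le> 1" for n x by (auto simp: \<zeta>_def bump_bounds)
  define K where "K n = {x. 1 / real (Suc n) \<le> w x}" for n
  have KV: "K n \<subseteq> ?V" for n
    unfolding K_def by (auto intro: less_le_trans[of 0 "1 / real (Suc n)"])
  have K: "compact (K n)" for n
  proof -
    have "closed (K n)" unfolding K_def by (intro closed_Collect_le wc continuous_intros)
    then show ?thesis using bounded_subset[OF bdd KV] compact_eq_bounded_closed by blast
  qed
  have \<zeta>0: "\<zeta> n x = 0" if "x \<notin> K n" for n x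
    using that by (auto simp: \<zeta>_def K_def bump_pos_iff field_simps)
  have \<zeta>V: "\<zeta> n x = 0" if "\<not> 0 < w x" for n x using \<zeta>0[of x n] KV[of n] that by blast
  have int: "integrable lborel (\<lambda>x. f x * (\<zeta> n x * c x))"
    if [measurable]: "c \<in> borel_measurable borel" and "\<And>x. x \<in> K n \<Longrightarrow> \<bar>c x\<bar> \<le> b" for n c b
  proof (rule Bochner_Integration.integrable_bound)
    show "integrable lborel (\<lambda>x. \<bar>b\<bar> * f x)" using f by simp
    have "\<bar>\<zeta> n x * c x\<bar> \<le> \<bar>b\<bar>" for x
    proof (cases "x \<in> K n")
      case True
      then show ?thesis using mult_mono[OF \<zeta>b(2)[of n x] that(2)[OF True]] \<zeta>b[of n x] by (auto simp: abs_mult)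
    qed (simp add: \<zeta>0)
    from mult_left_mono[OF this, of "\<bar>f _\<bar>"]
    show "AE x in lborel. norm (f x * (\<zeta> n x * c x)) \<le> norm (\<bar>b\<bar> * f x)"
      by (simp add: abs_mult mult.commute)
  qed measurable
  have M0: "0 \<le> M"
    using le[of "\<lambda>x. 0"] test_functionsI[OF smooth_fun_const[of 0], of "{}" ?V] by simp
  define A where "A = (LBINT x. \<bar>f x\<bar>)"
  have A: "0 \<le> A" by (simp add: A_def)
  have cont: "\<bar>\<integral>x. f x * (\<zeta> n x * c x) \<partial>lborel\<bar> \<le> M"
    if c: "continuous_on UNIV c" "\<And>x. \<bar>c x\<bar> \<le> 1" for n c
  proof (rule field_le_epsilon)
    fix e :: real assume e: "0 < e"
    have [measurable]: "c \<in> borel_measurable borel" by (rule borel_measurable_continuous_onI[OF c(1)])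
    define \<epsilon> where "\<epsilon> = e / (M + A + 1)"
    have \<epsilon>: "0 < \<epsilon>" using e M0 A by (simp add: \<epsilon>_def)
    obtain P where P: "real_polynomial_function P" "\<And>x. x \<in> K n \<Longrightarrow> \<bar>c x - P x\<bar> < \<epsilon>"
      using Stone_Weierstrass_real_polynomial_function[OF K continuous_on_subset[OF c(1)] \<epsilon>] by blast
    have Ps: "smooth_fun P" by (rule smooth_fun_polynomial[OF P(1)])
    have [measurable]: "P \<in> borel_measurable borel"
      by (intro borel_measurable_continuous_onI smooth_fun_continuous Ps)
    have Pb: "\<bar>P x\<bar> \<le> 1 + \<epsilon>" if "x \<in> K n" for x using P(2)[OF that] c(2)[of x] by linarith
    let ?\<phi> = "\<lambda>x. \<zeta> n x * ((1 / (1 + \<epsilon>)) * P x)"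
    have "?\<phi> \<in> test_functions ?V"
      by (rule test_functionsI[OF _ K[of n] KV])
        (intro smooth_fun_mult \<zeta>s smooth_fun_const Ps, simp add: \<zeta>0)
    moreover have "\<bar>?\<phi> x\<bar> \<le> 1" for x
    proof (cases "x \<in> K n")
      case True
      have "\<bar>(1 / (1 + \<epsilon>)) * P x\<bar> \<le> 1" using Pb[OF True] \<epsilon> by (simp add: abs_mult)
      then show ?thesis
        using mult_mono[OF \<zeta>b(2)[of n x], of "\<bar>(1 / (1 + \<epsilon>)) * P x\<bar>" 1] \<zeta>b[of n x] by (simp add: abs_mult)
    qed (simp add: \<zeta>0)
    ultimately have "\<bar>\<integral>x. f x * ?\<phi> x \<partial>lborel\<bar> \<le> M" by (rule le)
    moreover have "(LBINT x. f x * ?\<phi> x) = (1 / (1 + \<epsilon>)) * (LBINT x. f x * (\<zeta> n x * P x))"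
      by (subst integral_mult_right_zero[symmetric]) (simp add: mult_ac)
    ultimately have 1: "\<bar>\<integral>x. f x * (\<zeta> n x * P x) \<partial>lborel\<bar> \<le> M * (1 + \<epsilon>)"
      using \<epsilon> by (simp add: abs_mult field_simps)
    have i1: "integrable lborel (\<lambda>x. f x * (\<zeta> n x * c x))" by (rule int[where b=1]) (use c in auto)
    have i2: "integrable lborel (\<lambda>x. f x * (\<zeta> n x * P x))" by (rule int[where b="1+\<epsilon>"]) (use Pb in auto)
    have "\<bar>(LBINT x. f x * (\<zeta> n x * c x)) - (LBINT x. f x * (\<zeta> n x * P x))\<bar>
        = \<bar>\<integral>x. f x * (\<zeta> n x * c x) - f x * (\<zeta> n x * P x) \<partial>lborel\<bar>"
      using i1 i2 by simp
    also have "\<dots> \<le> (LBINT x. \<bar>f x * (\<zeta> n x * c x) - f x * (\<zeta> n x * P x)\<bar>)"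
      by (rule integral_abs_bound)
    also have "\<dots> \<le> (LBINT x. \<epsilon> * \<bar>f x\<bar>)"
    proof (rule integral_mono)
      fix x
      have "\<bar>\<zeta> n x * (c x - P x)\<bar> \<le> \<epsilon>"
      proof (cases "x \<in> K n")
        case True
        have "\<zeta> n x * \<bar>c x - P x\<bar> \<le> 1 * \<epsilon>"
          using P(2)[OF True] \<zeta>b[of n x] by (intro mult_mono) auto
        then show ?thesis using \<zeta>b[of n x] by (simp add: abs_mult)
      qed (use \<epsilon> in \<open>simp add: \<zeta>0\<close>)
      from mult_right_mono[OF this, of "\<bar>f x\<bar>"]
      have "\<bar>\<zeta> n x * (c x - P x)\<bar> * \<bar>f x\<bar> \<le> \<epsilon> * \<bar>f x\<bar>" by simp
      moreover have "\<bar>\<zeta> n x * (c x - P x)\<bar> * \<bar>f x\<bar> = \<bar>f x * (\<zeta> n x * c x) - f x * (\<zeta> n x * P x)\<bar>"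
        by (simp add: abs_mult[symmetric] algebra_simps)
      ultimately show "\<bar>f x * (\<zeta> n x * c x) - f x * (\<zeta> n x * P x)\<bar> \<le> \<epsilon> * \<bar>f x\<bar>" by simp
    qed (use i1 i2 f in auto)
    also have "\<dots> = \<epsilon> * A" by (simp add: A_def)
    finally have "\<bar>\<integral>x. f x * (\<zeta> n x * c x) \<partial>lborel\<bar> \<le> M * (1 + \<epsilon>) + \<epsilon> * A" using 1 by linarith
    also have "\<dots> = M + \<epsilon> * (M + A)" by (simp add: algebra_simps)
    also have "\<dots> \<le> M + e"
      using M0 A e by (simp add: \<epsilon>_def field_simps)
    finally show "\<bar>\<integral>x. f x * (\<zeta> n x * c x) \<partial>lborel\<bar> \<le> M + e" .
  qed
  have sgn_meas: "(\<lambda>x. sgn (f x)) \<in> borel_measurable borel" by measurable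
  have sgn_le: "\<bar>sgn (f x)\<bar> \<le> 1" for x by (simp add: sgn_if)
  obtain c where c: "\<And>k::nat. continuous_on UNIV (c k)" "\<And>k x. \<bar>c k x\<bar> \<le> 1"
    "AE x in lborel. (\<lambda>k. c k x) \<longlonglongrightarrow> sgn (f x)"
    by (rule bounded_borel_ae_limit_of_continuous[OF sgn_meas sgn_le]) (rule that)
  have [measurable]: "c k \<in> borel_measurable borel" for k by (rule borel_measurable_continuous_onI[OF c(1)])
  have step: "(LBINT x. \<bar>f x\<bar> * \<zeta> n x) \<le> M" for n
  proof -
    have "(\<lambda>k. \<integral>x. f x * (\<zeta> n x * c k x) \<partial>lborel) \<longlonglongrightarrow> (LBINT x. f x * (\<zeta> n x * sgn (f x)))"
    proof (rule integral_dominated_convergence[where w="\<lambda>x. \<bar>f x\<bar>"])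
      show "integrable lborel (\<lambda>x. \<bar>f x\<bar>)" using f by simp
      show "AE x in lborel. (\<lambda>k. f x * (\<zeta> n x * c k x)) \<longlonglongrightarrow> f x * (\<zeta> n x * sgn (f x))"
        using c(3) by eventually_elim (intro tendsto_intros)
      have "\<bar>\<zeta> n x * c k x\<bar> \<le> 1" for k x
        using mult_mono[OF \<zeta>b(2)[of n x] c(2)[of k x]] \<zeta>b[of n x] by (simp add: abs_mult)
      from mult_left_mono[OF this, of "\<bar>f _\<bar>"]
      show "AE x in lborel. norm (f x * (\<zeta> n x * c k x)) \<le> \<bar>f x\<bar>" for k
        by (simp add: abs_mult)
    qed measurable
    moreover have "(LBINT x. f x * (\<zeta> n x * sgn (f x))) = (LBINT x. \<bar>f x\<bar> * \<zeta> n x)"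
      by (intro Bochner_Integration.integral_cong) (auto simp: sgn_if)
    moreover have "(LBINT x. f x * (\<zeta> n x * c k x)) \<le> M" for k
      using cont[of "c k" n, OF c(1,2)] by linarith
    ultimately show ?thesis by (auto intro: LIMSEQ_le_const2)
  qed
  have "(\<lambda>n. \<integral>x. \<bar>f x\<bar> * \<zeta> n x \<partial>lborel) \<longlonglongrightarrow> (LBINT x. indicator ?V x * \<bar>f x\<bar>)"
  proof (rule integral_dominated_convergence[where w="\<lambda>x. \<bar>f x\<bar>"])
    show "integrable lborel (\<lambda>x. \<bar>f x\<bar>)" using f by simp
    have "(\<lambda>n. \<bar>f x\<bar> * \<zeta> n x) \<longlonglongrightarrow> indicator ?V x * \<bar>f x\<bar>" for x
    proof (cases "0 < w x")
      case True
      have t: "filterlim (\<lambda>n. real (Suc n) * w x - 1) at_top sequentially"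
        using True by real_asymp
      have "((\<lambda>t::real. exp (- (1 / t))) \<longlongrightarrow> 1) at_top" by real_asymp
      from filterlim_compose[OF this t]
      have "(\<lambda>n. exp (- (1 / (real (Suc n) * w x - 1)))) \<longlonglongrightarrow> 1" .
      moreover have "\<forall>\<^sub>F n in sequentially. exp (- (1 / (real (Suc n) * w x - 1))) = \<zeta> n x"
        using filterlim_at_top_dense[THEN iffD1, OF t, rule_format, of 0]
        by eventually_elim (simp add: \<zeta>_def bump_simps)
      ultimately have "(\<lambda>n. \<zeta> n x) \<longlonglongrightarrow> 1" by (rule Lim_transform_eventually)
      from tendsto_mult_left[OF this, of "\<bar>f x\<bar>"] show ?thesis using True by simp
    qed (simp add: \<zeta>V)
    then show "AE x in lborel. (\<lambda>n. \<bar>f x\<bar> * \<zeta> n x) \<longlonglongrightarrow> indicator ?V x * \<bar>f x\<bar>" by simp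
    show "AE x in lborel. norm (\<bar>f x\<bar> * \<zeta> n x) \<le> \<bar>f x\<bar>" for n
      using \<zeta>b[of n] by (auto simp: abs_mult mult_left_le)
  qed measurable
  then show ?thesis using step by (auto intro: LIMSEQ_le_const2)
qed

text \<open>The fundamental lemma of the calculus of variations, by covering \<open>\<Omega>\<close> with countably many balls and
  applying the duality bound with \<open>M = 0\<close> on each.\<close>

lemma AE_zero_if_orthogonal_to_test_functions:
  fixes f :: "real ^ 'n \<Rightarrow> real"
  assumes \<Omega>: "open \<Omega>" and f: "loc_integrable \<Omega> f"
    and orth: "\<And>\<phi>. \<phi> \<in> test_functions \<Omega> \<Longrightarrow> (LBINT x. f x * \<phi> x) = 0"
  shows "AE x in lborel. x \<in> \<Omega> \<longrightarrow> f x = 0"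
proof -
  have fm[measurable]: "f \<in> borel_measurable borel" using f by (simp add: loc_integrable_def)
  define F where "F = {ball a \<rho> |a \<rho>. 0 < \<rho> \<and> cball a \<rho> \<subseteq> \<Omega>}"
  obtain F' where F': "F' \<subseteq> F" "countable F'" "\<Union>F' = \<Union>F"
    using Lindelof[of F] unfolding F_def by blast
  have "\<Omega> \<subseteq> \<Union>F"
  proof
    fix x assume "x \<in> \<Omega>"
    then obtain e where "e > 0" "cball x e \<subseteq> \<Omega>" using \<Omega> open_contains_cball by blast
    then show "x \<in> \<Union>F" unfolding F_def by (auto intro!: exI[of _ "ball x e"])
  qed
  have "AE x in lborel. x \<in> B \<longrightarrow> f x = 0" if B: "B \<in> F'" for B
  proof -
    obtain a \<rho> where a: "B = ball a \<rho>" "0 < \<rho>" "cball a \<rho> \<subseteq> \<Omega>" using B F' unfolding F_def by auto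
    let ?w = "\<lambda>x. \<rho>\<^sup>2 + (-1) * (norm (x - a))\<^sup>2"
    let ?f = "\<lambda>x. indicator (cball a \<rho>) x * f x"
    have B_eq: "{x. 0 < ?w x} = B"
      using a by (auto simp: dist_norm norm_minus_commute abs_square_less_1 power2_less_imp_less
          intro: power_strict_mono power2_less_imp_less)
    have int: "integrable lborel ?f"
      using f a unfolding loc_integrable_def set_integrable_def by (auto simp: compact_cball)
    have "(LBINT x. indicator {x. 0 < ?w x} x * \<bar>?f x\<bar>) \<le> 0"
    proof (rule L1_norm_le_by_test_functions[OF smooth_fun_quadratic _ int])
      show "bounded {x. 0 < ?w x}" unfolding B_eq a by simp
      fix \<phi> :: "real ^ 'n \<Rightarrow> real" assume \<phi>: "\<phi> \<in> test_functions {x. 0 < ?w x}"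
      then have \<phi>': "\<phi> \<in> test_functions B" unfolding B_eq .
      then have "\<phi> \<in> test_functions \<Omega>"
        using a by (intro test_functions_mono[OF \<phi>']) (auto simp: subset_iff)
      then have "(LBINT x. f x * \<phi> x) = 0" by (rule orth)
      moreover have "?f x * \<phi> x = f x * \<phi> x" for x
      proof (cases "x \<in> cball a \<rho>")
        case False
        then have "x \<notin> B" using a by auto
        then have "\<phi> x = 0" using test_functionsE[OF \<phi>'] by (metis subsetD)
        then show ?thesis by simp
      qed simp
      ultimately show "\<bar>\<integral>x. ?f x * \<phi> x \<partial>lborel\<bar> \<le> 0" by (simp only: abs_zero order_refl)
    qed
    then have le0: "(LBINT x. indicator B x * \<bar>?f x\<bar>) \<le> 0"
      unfolding B_eq .
    have [measurable]: "B \<in> sets borel" using a by simp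
    have "integrable lborel (\<lambda>x. indicator B x * \<bar>?f x\<bar>)"
      by (rule Bochner_Integration.integrable_bound[OF int]) (auto simp: indicator_def)
    then have iff: "(LBINT x. indicator B x * \<bar>?f x\<bar>) = 0 \<longleftrightarrow>
        (AE x in lborel. indicator B x * \<bar>?f x\<bar> = 0)"
      by (rule integral_nonneg_eq_0_iff_AE) simp
    have "0 \<le> (LBINT x. indicator B x * \<bar>?f x\<bar>)"
      by (intro integral_nonneg_AE) simp
    then have "AE x in lborel. indicator B x * \<bar>?f x\<bar> = 0"
      using le0 iff by linarith
    then show ?thesis
    proof eventually_elim
      case (elim x)
      show ?case
      proof
        assume x: "x \<in> B"
        then have "x \<in> cball a \<rho>" using ball_subset_cball[of a \<rho>] unfolding a(1) by blast
        then show "f x = 0" using elim x by simp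
      qed
    qed
  qed
  then have "AE x in lborel. \<forall>B\<in>F'. x \<in> B \<longrightarrow> f x = 0"
    unfolding AE_ball_countable[OF F'(2)] by (rule ballI)
  then show ?thesis
  proof eventually_elim
    case (elim x)
    show ?case
    proof
      assume "x \<in> \<Omega>"
      then have "x \<in> \<Union>F'" unfolding F'(3) by (rule subsetD[OF \<open>\<Omega> \<subseteq> \<Union>F\<close>])
      then obtain B where "B \<in> F'" "x \<in> B" by (rule UnionE)
      then show "f x = 0" using elim by blast
    qed
  qed
qed

section \<open>Weak gradients of Borel functions\<close>

text \<open>The weak gradient for Borel representatives, with integrals over the whole space: test functions vanish
  outside \<open>\<Omega>\<close>, so the values of \<open>u\<close> and \<open>g\<close> there play no role.\<close>

definition borel_weak_grad ::
    "(real ^ 'n) set \<Rightarrow> (real ^ 'n \<Rightarrow> real) \<Rightarrow> (real ^ 'n \<Rightarrow> real ^ 'n) \<Rightarrow> bool" where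
  "borel_weak_grad \<Omega> u g \<longleftrightarrow> loc_integrable \<Omega> u \<and> loc_integrable \<Omega> g \<and>
     (\<forall>\<phi>\<in>test_functions \<Omega>. \<forall>i.
        (LBINT x. u x * partial_deriv i \<phi> x) = - (LBINT x. g x $ i * \<phi> x))"

lemma measurable_vec_nth[measurable]: "(\<lambda>x::real ^ 'n. x $ i) \<in> borel_measurable borel"
  by (intro borel_measurable_continuous_onI continuous_intros)

lemma measurable_vec_lambda[measurable (raw)]:
  assumes "\<And>i. f i \<in> borel_measurable M"
  shows "(\<lambda>x. (\<chi> i. f i x) :: real ^ 'n) \<in> borel_measurable M"
  unfolding borel_measurable_euclidean_space[where f="\<lambda>x. \<chi> i. f i x"]
  using assms by (auto simp: Basis_vec_def inner_axis)

lemma loc_integrable_measurable: "loc_integrable \<Omega> f \<Longrightarrow> f \<in> borel_measurable borel"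
  by (simp add: loc_integrable_def)

lemma loc_integrable_nth:
  fixes g :: "real ^ 'n \<Rightarrow> real ^ 'n"
  assumes "loc_integrable \<Omega> g"
  shows "loc_integrable \<Omega> (\<lambda>x. g x $ i)"
  unfolding loc_integrable_def
proof (intro conjI allI impI)
  have [measurable]: "g \<in> borel_measurable borel" using assms by (rule loc_integrable_measurable)
  show m: "(\<lambda>x. g x $ i) \<in> borel_measurable borel" by measurable
  fix K assume "compact K \<and> K \<subseteq> \<Omega>"
  then have "integrable lborel (\<lambda>x. indicator K x *\<^sub>R g x)" and [measurable]: "K \<in> sets borel"
      using assms by (auto simp: loc_integrable_def set_integrable_def borel_compact)
  from this(1) have "integrable lborel (\<lambda>x. indicator K x *\<^sub>R (g x $ i))"
    by (rule Bochner_Integration.integrable_bound) (auto simp: component_le_norm_cart indicator_def)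
  then show "set_integrable lborel K (\<lambda>x. g x $ i)" by (simp add: set_integrable_def)
qed

lemma borel_weak_grad_subset:
  "borel_weak_grad \<Omega> u g \<Longrightarrow> \<Omega>' \<subseteq> \<Omega> \<Longrightarrow> borel_weak_grad \<Omega>' u g"
  unfolding borel_weak_grad_def loc_integrable_def by (auto dest: test_functions_mono)

lemma borel_weak_grad_unique:
  assumes \<Omega>: "open \<Omega>" and g: "borel_weak_grad \<Omega> u g" and g': "borel_weak_grad \<Omega> u g'"
  shows "AE x in lborel. x \<in> \<Omega> \<longrightarrow> g x = g' x"
proof -
  have "AE x in lborel. x \<in> \<Omega> \<longrightarrow> g x $ i - g' x $ i = 0" for i
  proof (rule AE_zero_if_orthogonal_to_test_functions[OF \<Omega>])
    have L: "loc_integrable \<Omega> (\<lambda>x. g x $ i)" "loc_integrable \<Omega> (\<lambda>x. g' x $ i)"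
      using g g' by (auto simp: borel_weak_grad_def loc_integrable_nth)
    then have [measurable]: "(\<lambda>x. g x $ i) \<in> borel_measurable borel" "(\<lambda>x. g' x $ i) \<in> borel_measurable borel"
      by (auto simp: loc_integrable_def)
    show "loc_integrable \<Omega> (\<lambda>x. g x $ i - g' x $ i)"
      unfolding loc_integrable_def
    proof (intro conjI allI impI)
      fix K assume "compact K \<and> K \<subseteq> \<Omega>"
      then have "set_integrable lborel K (\<lambda>x. g x $ i)" "set_integrable lborel K (\<lambda>x. g' x $ i)"
        using L by (simp_all add: loc_integrable_def)
      then show "set_integrable lborel K (\<lambda>x. g x $ i - g' x $ i)" by (rule set_integral_diff(1))
    qed measurable
    fix \<phi> assume \<phi>: "\<phi> \<in> test_functions \<Omega>"
    have "(LBINT x. g x $ i * \<phi> x) = (LBINT x. g' x $ i * \<phi> x)"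
      using g g' \<phi> unfolding borel_weak_grad_def by (metis minus_equation_iff)
    then show "(LBINT x. (g x $ i - g' x $ i) * \<phi> x) = 0"
      using integrable_times_test_function[OF L(1) \<phi>] integrable_times_test_function[OF L(2) \<phi>]
      by (simp add: left_diff_distrib)
  qed
  then have "AE x in lborel. \<forall>i. x \<in> \<Omega> \<longrightarrow> g x $ i - g' x $ i = 0"
    by (subst AE_all_countable) simp
  then show ?thesis by eventually_elim (auto simp: vec_eq_iff)
qed

lemma borel_weak_grad_mult_test:
  assumes u: "borel_weak_grad \<Omega> u g" and z: "z \<in> test_functions \<Omega>"
  shows "borel_weak_grad UNIV (\<lambda>x. u x * z x) (\<lambda>x. z x *\<^sub>R g x + u x *\<^sub>R (\<chi> i. partial_deriv i z x))"
proof -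
  have Lu: "loc_integrable \<Omega> u" and Lg: "loc_integrable \<Omega> g" using u by (auto simp: borel_weak_grad_def)
  have [measurable]: "u \<in> borel_measurable borel" "g \<in> borel_measurable borel"
    using Lu Lg by (auto simp: loc_integrable_measurable)
  have [measurable]: "z \<in> borel_measurable borel" "partial_deriv i z \<in> borel_measurable borel" for i
    using z test_functions_partial_deriv[OF z] by (auto simp: test_functions_measurable)
  have zs: "smooth_fun z" by (rule test_functions_smooth[OF z])
  have gm: "(\<lambda>x. z x *\<^sub>R g x + u x *\<^sub>R (\<chi> i. partial_deriv i z x)) \<in> borel_measurable borel"
    by measurable
  have iu: "integrable lborel (\<lambda>x. u x * z x)"
    by (rule integrable_times_test_function[OF Lu z])
  have ig: "integrable lborel (\<lambda>x. g x $ i * z x + u x * partial_deriv i z x)" for i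
    by (intro Bochner_Integration.integrable_add integrable_times_test_function[OF loc_integrable_nth[OF Lg] z]
        integrable_times_test_function[OF Lu test_functions_partial_deriv[OF z]])
  have igv: "integrable lborel (\<lambda>x. z x *\<^sub>R g x + u x *\<^sub>R (\<chi> i. partial_deriv i z x))"
  proof (rule Bochner_Integration.integrable_bound)
    show "integrable lborel (\<lambda>x. \<Sum>i\<in>UNIV. \<bar>g x $ i * z x + u x * partial_deriv i z x\<bar>)"
      using ig by (intro Bochner_Integration.integrable_sum integrable_abs)
    have "norm (z x *\<^sub>R g x + u x *\<^sub>R (\<chi> i. partial_deriv i z x)) \<le>
        (\<Sum>i\<in>UNIV. \<bar>g x $ i * z x + u x * partial_deriv i z x\<bar>)" for x
      using norm_le_l1_cart[of "z x *\<^sub>R g x + u x *\<^sub>R (\<chi> i. partial_deriv i z x)"] by (simp add: mult.commute)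
    then show "AE x in lborel. norm (z x *\<^sub>R g x + u x *\<^sub>R (\<chi> i. partial_deriv i z x)) \<le>
        norm (\<Sum>i\<in>UNIV. \<bar>g x $ i * z x + u x * partial_deriv i z x\<bar>)"
      by (auto intro: order_trans)
  qed (use gm in simp)
  have "(LBINT x. u x * z x * partial_deriv i \<phi> x) =
      - (LBINT x. (z x *\<^sub>R g x + u x *\<^sub>R (\<chi> i. partial_deriv i z x)) $ i * \<phi> x)"
    if \<phi>: "\<phi> \<in> test_functions UNIV" for \<phi> i
  proof -
    have \<phi>s: "smooth_fun \<phi>" by (rule test_functions_smooth[OF \<phi>])
    have t1: "(\<lambda>x. z x * \<phi> x) \<in> test_functions \<Omega>" by (rule test_functions_mult[OF z \<phi>s])
    have t2: "(\<lambda>x. partial_deriv i z x * \<phi> x) \<in> test_functions \<Omega>"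
      by (rule test_functions_mult[OF test_functions_partial_deriv[OF z] \<phi>s])
    have t3: "(\<lambda>x. z x * partial_deriv i \<phi> x) \<in> test_functions \<Omega>"
      by (rule test_functions_mult[OF z smooth_fun_partial_deriv[OF \<phi>s]])
    have pd: "partial_deriv i (\<lambda>x. z x * \<phi> x) x = partial_deriv i z x * \<phi> x + z x * partial_deriv i \<phi> x" for x
      by (rule partial_deriv_mult) (intro smooth_fun_differentiable zs \<phi>s)+
    note i2 = integrable_times_test_function[OF Lu t2]
    note i3 = integrable_times_test_function[OF Lu t3]
    note i1 = integrable_times_test_function[OF loc_integrable_nth[OF Lg, of i] t1]
    have "(LBINT x. u x * partial_deriv i (\<lambda>x. z x * \<phi> x) x) = - (LBINT x. g x $ i * (z x * \<phi> x))"
      using u t1 by (auto simp: borel_weak_grad_def)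
    moreover have "(LBINT x. u x * partial_deriv i (\<lambda>x. z x * \<phi> x) x) =
      (LBINT x. u x * (partial_deriv i z x * \<phi> x)) + (LBINT x. u x * (z x * partial_deriv i \<phi> x))"
      unfolding pd distrib_left by (rule Bochner_Integration.integral_add[OF i2 i3])
    moreover have "(LBINT x. (z x *\<^sub>R g x + u x *\<^sub>R (\<chi> i. partial_deriv i z x)) $ i * \<phi> x) =
      (LBINT x. g x $ i * (z x * \<phi> x)) + (LBINT x. u x * (partial_deriv i z x * \<phi> x))"
      by (subst Bochner_Integration.integral_add[OF i1 i2, symmetric])
        (intro Bochner_Integration.integral_cong; simp add: algebra_simps)
    ultimately show ?thesis by (simp add: mult.assoc)
  qed
  moreover have "loc_integrable UNIV (\<lambda>x. u x * z x)"
    unfolding loc_integrable_def set_integrable_def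
    using integrable_mult_indicator[OF _ iu] compact_imp_closed borel_closed by auto
  moreover have "loc_integrable UNIV (\<lambda>x. z x *\<^sub>R g x + u x *\<^sub>R (\<chi> i. partial_deriv i z x))"
    unfolding loc_integrable_def set_integrable_def
    using integrable_mult_indicator[OF _ igv] compact_imp_closed borel_closed gm by auto
  ultimately show ?thesis unfolding borel_weak_grad_def by auto
qed

text \<open>For a fixed integrable \<open>U\<close>, the translation parameter of the test function may be differentiated under
  the integral.\<close>

lemma DERIV_integral_translate_test:
  fixes U :: "real ^ 'n \<Rightarrow> real"
  assumes U: "integrable lborel U" and \<phi>: "\<phi> \<in> test_functions \<Omega>"
  shows "((\<lambda>t. \<integral>x. U x * \<phi> (x - t *\<^sub>R axis i 1) \<partial>lborel) has_real_derivative
     - (LBINT x. U x * partial_deriv i \<phi> (x - t *\<^sub>R axis i 1))) (at t)"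
proof -
  let ?e = "axis i 1 :: real ^ 'n"
  have d\<phi>: "partial_deriv i \<phi> \<in> test_functions \<Omega>" by (rule test_functions_partial_deriv[OF \<phi>])
  have \<phi>s: "smooth_fun \<phi>" by (rule test_functions_smooth[OF \<phi>])
  have [measurable]: "U \<in> borel_measurable borel" using borel_measurable_integrable[OF U] by simp
  have [measurable]: "\<phi> \<in> borel_measurable borel" "partial_deriv i \<phi> \<in> borel_measurable borel"
    using \<phi> d\<phi> by (auto simp: test_functions_measurable)
  obtain B0 where B0: "0 < B0" "\<And>x. \<bar>\<phi> x\<bar> \<le> B0" using test_functions_bounded[OF \<phi>] by blast
  obtain B where B: "0 < B" "\<And>x. \<bar>partial_deriv i \<phi> x\<bar> \<le> B" using test_functions_bounded[OF d\<phi>] by blast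
  have D: "((\<lambda>t. \<phi> (x - t *\<^sub>R ?e)) has_real_derivative - partial_deriv i \<phi> (x - t *\<^sub>R ?e)) (at t)" for x t
  proof -
    have "((\<lambda>t. x - t *\<^sub>R ?e) has_derivative (\<lambda>k. - (k *\<^sub>R ?e))) (at t)"
      by (auto intro!: derivative_eq_intros)
    from has_derivative_compose[OF this smooth_fun_has_derivative[OF \<phi>s]]
    have "((\<lambda>t. \<phi> (x - t *\<^sub>R ?e)) has_derivative
        (\<lambda>k. frechet_derivative \<phi> (at (x - t *\<^sub>R ?e)) (- (k *\<^sub>R ?e)))) (at t)" .
    moreover have "linear (frechet_derivative \<phi> (at (x - t *\<^sub>R ?e)))"
      by (rule linear_frechet_derivative[OF smooth_fun_differentiable[OF \<phi>s]])
    then have "frechet_derivative \<phi> (at (x - t *\<^sub>R ?e)) (- (k *\<^sub>R ?e)) = - partial_deriv i \<phi> (x - t *\<^sub>R ?e) * k" for k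
      by (simp add: linear_neg linear_cmul partial_deriv_def)
    ultimately show ?thesis
      unfolding has_field_derivative_def by (auto elim!: has_derivative_eq_rhs)
  qed
  have lip: "\<bar>\<phi> (x - s *\<^sub>R ?e) - \<phi> (x - t *\<^sub>R ?e)\<bar> \<le> B * \<bar>s - t\<bar>" for x s t
    using field_differentiable_bound[of UNIV "\<lambda>t. \<phi> (x - t *\<^sub>R ?e)" "\<lambda>t. - partial_deriv i \<phi> (x - t *\<^sub>R ?e)" B s t]
      D B by auto
  have int: "integrable lborel (\<lambda>x. U x * \<phi> (x - t *\<^sub>R ?e))" for t
  proof (rule Bochner_Integration.integrable_bound)
    show "integrable lborel (\<lambda>x. B0 * U x)" using U by simp
    show "AE x in lborel. norm (U x * \<phi> (x - t *\<^sub>R ?e)) \<le> norm (B0 * U x)"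
      using mult_right_mono[OF B0(2), of "\<bar>U _\<bar>"] B0(1) by (simp add: abs_mult mult.commute)
  qed measurable
  show ?thesis
    unfolding has_field_derivative_iff tendsto_at_iff_sequentially comp_def
  proof (intro allI impI)
    fix X :: "nat \<Rightarrow> real" assume X: "\<forall>k. X k \<in> UNIV - {t}" "X \<longlonglongrightarrow> t"
    have "(\<lambda>k. \<integral>x. U x * ((\<phi> (x - X k *\<^sub>R ?e) - \<phi> (x - t *\<^sub>R ?e)) / (X k - t)) \<partial>lborel) \<longlonglongrightarrow>
      (LBINT x. U x * (- partial_deriv i \<phi> (x - t *\<^sub>R ?e)))"
    proof (rule integral_dominated_convergence[where w="\<lambda>x. B * \<bar>U x\<bar>"])
      show "integrable lborel (\<lambda>x. B * \<bar>U x\<bar>)" using U by simp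
      have "(\<lambda>k. (\<phi> (x - X k *\<^sub>R ?e) - \<phi> (x - t *\<^sub>R ?e)) / (X k - t)) \<longlonglongrightarrow> - partial_deriv i \<phi> (x - t *\<^sub>R ?e)" for x
        using D[of x t] X unfolding has_field_derivative_iff tendsto_at_iff_sequentially comp_def by blast
      then show "AE x in lborel. (\<lambda>k. U x * ((\<phi> (x - X k *\<^sub>R ?e) - \<phi> (x - t *\<^sub>R ?e)) / (X k - t)))
          \<longlonglongrightarrow> U x * (- partial_deriv i \<phi> (x - t *\<^sub>R ?e))"
        by (intro AE_I2 tendsto_mult tendsto_const)
      have "\<bar>(\<phi> (x - X k *\<^sub>R ?e) - \<phi> (x - t *\<^sub>R ?e)) / (X k - t)\<bar> \<le> B" for k x
        using lip[of x "X k" t] X(1) by (simp add: divide_simps)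
      from mult_right_mono[OF this, of "\<bar>U _\<bar>"]
      show "AE x in lborel. norm (U x * ((\<phi> (x - X k *\<^sub>R ?e) - \<phi> (x - t *\<^sub>R ?e)) / (X k - t))) \<le> B * \<bar>U x\<bar>" for k
        unfolding real_norm_def abs_mult by (intro AE_I2) (simp add: mult.commute)
    qed measurable
    moreover have "(LBINT x. U x * ((\<phi> (x - X k *\<^sub>R ?e) - \<phi> (x - t *\<^sub>R ?e)) / (X k - t))) =
      ((LBINT x. U x * \<phi> (x - X k *\<^sub>R ?e)) - (LBINT x. U x * \<phi> (x - t *\<^sub>R ?e))) / (X k - t)" for k
    proof -
      have "U x * ((\<phi> (x - X k *\<^sub>R ?e) - \<phi> (x - t *\<^sub>R ?e)) / (X k - t)) =
          (U x * \<phi> (x - X k *\<^sub>R ?e) - U x * \<phi> (x - t *\<^sub>R ?e)) / (X k - t)" for x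
        by (simp add: right_diff_distrib)
      then show ?thesis
        using int by (simp only: integral_divide_zero Bochner_Integration.integral_diff)
    qed
    ultimately show "(\<lambda>k. ((LBINT x. U x * \<phi> (x - X k *\<^sub>R ?e)) - (LBINT x. U x * \<phi> (x - t *\<^sub>R ?e))) / (X k - t))
        \<longlonglongrightarrow> - (LBINT x. U x * partial_deriv i \<phi> (x - t *\<^sub>R ?e))"
      by (simp only: mult_minus_right Bochner_Integration.integral_minus)
  qed
qed

section \<open>Difference quotients and the chain rule\<close>

text \<open>With \<open>\<omega>\<close> the \<open>L\<^sup>1\<close> modulus of continuity of \<open>\<partial>\<^sub>iu\<close> under translations of length at most \<open>h\<close>, the
  difference quotient of \<open>u\<close> is \<open>\<omega>\<close>-close to \<open>\<partial>\<^sub>iu\<close> in \<open>L\<^sup>1\<close> on \<open>{w > 0}\<close>. For a test function \<open>\<phi>\<close>, the map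
  \<open>t \<mapsto> \<integral> u(x + te) \<phi>(x) dx\<close> has derivative \<open>\<integral> \<partial>\<^sub>iu(x + te) \<phi>(x) dx\<close>, so the mean value theorem bounds every
  such pairing, and the pairings control the \<open>L\<^sup>1\<close> norm.\<close>

lemma L1_difference_quotient_le:
  fixes u w :: "real ^ 'n \<Rightarrow> real" and i :: 'n
  defines "e \<equiv> axis i 1"
  assumes u: "borel_weak_grad \<Omega> u g" and K: "compact K" "K \<subseteq> \<Omega>"
    and w: "smooth_fun w" "bounded {x. 0 < w x}" and h: "0 < h"
    and seg: "\<And>x t. \<lbrakk>0 < w x; 0 \<le> t; t \<le> h\<rbrakk> \<Longrightarrow> x + t *\<^sub>R e \<in> K"
    and om: "\<And>t. \<lbrakk>0 \<le> t; t \<le> h\<rbrakk> \<Longrightarrow>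
      (LBINT x. \<bar>indicator K (x + t *\<^sub>R e) * g (x + t *\<^sub>R e) $ i - indicator K x * g x $ i\<bar>) \<le> \<omega>"
  shows "(LBINT x. indicator {x. 0 < w x} x *
      \<bar>(indicator K (x + h *\<^sub>R e) * u (x + h *\<^sub>R e) - indicator K x * u x) - h * (indicator K x * g x $ i)\<bar>) \<le> h * \<omega>"
proof -
  define U where "U x = indicator K x * u x" for x
  define G where "G x = indicator K x * g x $ i" for x
  have Lu: "loc_integrable \<Omega> u" and Lg: "loc_integrable \<Omega> (\<lambda>x. g x $ i)"
    using u by (auto simp: borel_weak_grad_def loc_integrable_nth)
  have U: "integrable lborel U" and G: "integrable lborel G"
    using Lu Lg K unfolding U_def[abs_def] G_def[abs_def] by (auto simp: loc_integrable_def set_integrable_def)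
  have [measurable]: "U \<in> borel_measurable borel" "G \<in> borel_measurable borel"
    using borel_measurable_integrable[OF U] borel_measurable_integrable[OF G] by simp_all
  have "(LBINT x. indicator {x. 0 < w x} x * \<bar>U (x + h *\<^sub>R e) - U x - h * G x\<bar>) \<le> h * \<omega>"
  proof (rule L1_norm_le_by_test_functions[OF w])
    show "integrable lborel (\<lambda>x. U (x + h *\<^sub>R e) - U x - h * G x)"
      using U G integrable_lborel_translate[OF U] by auto
    fix \<phi> assume \<phi>: "\<phi> \<in> test_functions {x. 0 < w x}" and \<phi>1: "\<And>x. \<bar>\<phi> x\<bar> \<le> 1"
    have [measurable]: "\<phi> \<in> borel_measurable borel" using \<phi> by (auto simp: test_functions_measurable)
    have \<phi>0: "\<phi> x = 0" if "\<not> 0 < w x" for x using test_functionsE[OF \<phi>] that by (metis mem_Collect_eq subsetD)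
    let ?a = "\<lambda>t. \<integral>x. U x * \<phi> (x - t *\<^sub>R e) \<partial>lborel"
    have shift: "(LBINT x. f (x + t *\<^sub>R e) * \<phi> x) = (LBINT x. f x * \<phi> (x - t *\<^sub>R e))"
      if [measurable]: "f \<in> borel_measurable borel" for f t
      using integral_lborel_translate[of "\<lambda>x. f x * \<phi> (x - t *\<^sub>R e)" "t *\<^sub>R e"] by simp
    have prod_int: "integrable lborel (\<lambda>x. f x * \<phi> x)" if f: "integrable lborel f" for f
      using f by (rule Bochner_Integration.integrable_bound)
        (use borel_measurable_integrable[OF f] \<phi>1 in \<open>auto simp: abs_mult mult_left_le\<close>)
    have deriv: "(?a has_real_derivative (LBINT x. G (x + t *\<^sub>R e) * \<phi> x)) (at t)"
      if t: "0 \<le> t" "t \<le> h" for t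
    proof -
      let ?\<psi> = "\<lambda>x. \<phi> (x + (- (t *\<^sub>R e)))"
      have \<psi>0: "?\<psi> x = 0" if "x \<notin> K" for x
      proof (rule ccontr)
        assume "?\<psi> x \<noteq> 0"
        then have "0 < w (x - t *\<^sub>R e)" using \<phi>0 by auto
        from seg[OF this t] that show False by simp
      qed
      have \<psi>s: "smooth_fun ?\<psi>" by (rule smooth_fun_translate[OF test_functions_smooth[OF \<phi>]])
      have \<psi>: "?\<psi> \<in> test_functions \<Omega>" by (rule test_functionsI[OF \<psi>s K \<psi>0])
      have pd: "partial_deriv i \<phi> (x - t *\<^sub>R e) = partial_deriv i ?\<psi> x" for x
        using partial_deriv_translate[of \<phi> x "- (t *\<^sub>R e)" i] smooth_fun_differentiable[OF test_functions_smooth[OF \<phi>]]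
        by simp
      have pd0: "partial_deriv i ?\<psi> x = 0" if "x \<notin> K" for x
        by (rule partial_deriv_eq_0_outside[of "- K"]) (use \<psi>0 that K compact_imp_closed in auto)
      have "- (LBINT x. U x * partial_deriv i \<phi> (x - t *\<^sub>R e)) = - (LBINT x. u x * partial_deriv i ?\<psi> x)"
        unfolding pd by (intro arg_cong[where f=uminus] Bochner_Integration.integral_cong)
          (auto simp: U_def indicator_def pd0[simplified])
      also have "\<dots> = (LBINT x. g x $ i * ?\<psi> x)"
        using u \<psi> by (auto simp: borel_weak_grad_def)
      also have "\<dots> = (LBINT x. G x * \<phi> (x - t *\<^sub>R e))"
        using \<psi>0 by (intro Bochner_Integration.integral_cong) (auto simp: G_def indicator_def)
      also have "\<dots> = (LBINT x. G (x + t *\<^sub>R e) * \<phi> x)"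
        by (rule shift[symmetric]) measurable
      finally show ?thesis
        using DERIV_integral_translate_test[OF U \<phi>, of i t] unfolding e_def by simp
    qed
    obtain \<xi> where \<xi>: "0 < \<xi>" "\<xi> < h" "?a h - ?a 0 = (h - 0) * (LBINT x. G (x + \<xi> *\<^sub>R e) * \<phi> x)"
      using MVT2[OF h, of ?a "\<lambda>t. \<integral>x. G (x + t *\<^sub>R e) * \<phi> x \<partial>lborel"] deriv by blast
    have "(LBINT x. (U (x + h *\<^sub>R e) - U x - h * G x) * \<phi> x) =
       (LBINT x. U (x + h *\<^sub>R e) * \<phi> x - U x * \<phi> x - h * (G x * \<phi> x))"
      by (simp add: algebra_simps)
    also have "\<dots> = (LBINT x. U (x + h *\<^sub>R e) * \<phi> x) - (LBINT x. U x * \<phi> x) - h * (LBINT x. G x * \<phi> x)"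
      using prod_int[OF U] prod_int[OF G] prod_int[OF integrable_lborel_translate[OF U]] by simp
    also have "\<dots> = h * (LBINT x. G (x + \<xi> *\<^sub>R e) * \<phi> x) - h * (LBINT x. G x * \<phi> x)"
      using \<xi>(3) shift[of U h] by simp
    also have "\<dots> = h * (LBINT x. (G (x + \<xi> *\<^sub>R e) - G x) * \<phi> x)"
      using prod_int[OF G] prod_int[OF integrable_lborel_translate[OF G]]
      by (simp add: left_diff_distrib right_diff_distrib)
    finally have eq: "(LBINT x. (U (x + h *\<^sub>R e) - U x - h * G x) * \<phi> x) =
       h * (LBINT x. (G (x + \<xi> *\<^sub>R e) - G x) * \<phi> x)" .
    have Gd: "integrable lborel (\<lambda>x. G (x + \<xi> *\<^sub>R e) - G x)"
      using G integrable_lborel_translate[OF G] by auto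
    have "\<bar>\<integral>x. (G (x + \<xi> *\<^sub>R e) - G x) * \<phi> x \<partial>lborel\<bar> \<le> (LBINT x. \<bar>(G (x + \<xi> *\<^sub>R e) - G x) * \<phi> x\<bar>)"
      by (rule integral_abs_bound)
    also have "\<dots> \<le> (LBINT x. \<bar>G (x + \<xi> *\<^sub>R e) - G x\<bar>)"
    proof (intro integral_mono integrable_abs prod_int Gd)
      show "\<bar>(G (x + \<xi> *\<^sub>R e) - G x) * \<phi> x\<bar> \<le> \<bar>G (x + \<xi> *\<^sub>R e) - G x\<bar>" for x
        using \<phi>1[of x] by (simp add: abs_mult mult_left_le)
    qed
    also have "\<dots> \<le> \<omega>" using om[of \<xi>] \<xi> by (simp add: G_def)
    finally show "\<bar>\<integral>x. (U (x + h *\<^sub>R e) - U x - h * G x) * \<phi> x \<partial>lborel\<bar> \<le> h * \<omega>"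
      unfolding eq using h by (simp add: abs_mult)
  qed
  then show ?thesis by (simp add: U_def G_def)
qed

text \<open>The difference quotient of \<open>F(u)\<close> is the slope of \<open>F\<close> over the chord from \<open>u(x)\<close> to \<open>u(x + he)\<close> times the
  difference quotient of \<open>u\<close>. The first factor is bounded by \<open>L\<close> and converges almost everywhere to \<open>F'(u)\<close> along
  a sequence of step sizes; the second converges in \<open>L\<^sup>1\<close>.\<close>

lemma borel_weak_grad_chain:
  fixes u :: "real ^ 'n \<Rightarrow> real"
  assumes \<Omega>: "open \<Omega>" and u: "borel_weak_grad \<Omega> u g" and u0: "\<And>x. 0 \<le> u x"
    and F: "\<And>t. 0 \<le> t \<Longrightarrow> (F has_real_derivative F' t) (at t)"
    and F'c: "continuous_on {0..} F'" and L: "\<And>t. 0 \<le> t \<Longrightarrow> \<bar>F' t\<bar> \<le> L"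
  shows "borel_weak_grad \<Omega> (\<lambda>x. F (u x)) (\<lambda>x. F' (u x) *\<^sub>R g x)"
proof -
  have Lu: "loc_integrable \<Omega> u" and Lg: "loc_integrable \<Omega> g"
    using u by (auto simp: borel_weak_grad_def)
  have [measurable]: "u \<in> borel_measurable borel" "g \<in> borel_measurable borel"
    using Lu Lg by (auto simp: loc_integrable_measurable)
  have meas_comp: "(\<lambda>x. H (v x)) \<in> borel_measurable borel"
    if "continuous_on {0..} H" "v \<in> borel_measurable borel" "\<And>x. 0 \<le> v x" for H v :: "_ \<Rightarrow> real"
  proof -
    have "continuous_on UNIV (\<lambda>t. H (max t 0))"
      by (rule continuous_on_compose2[OF that(1)]) (auto intro!: continuous_intros)
    from measurable_compose[OF that(2) borel_measurable_continuous_onI[OF this]]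
    show ?thesis using that(3) by (simp add: max_absorb1)
  qed
  have Fc: "continuous_on {0..} F"
    using F by (intro continuous_at_imp_continuous_on) (auto intro: DERIV_isCont)
  have Fm[measurable]: "(\<lambda>x. F (u x)) \<in> borel_measurable borel" and F'm[measurable]: "(\<lambda>x. F' (u x)) \<in> borel_measurable borel"
    by (rule meas_comp[OF Fc _ u0], measurable) (rule meas_comp[OF F'c _ u0], measurable)
  have L0: "0 \<le> L" using L[of 0] by simp
  have lip: "\<bar>F b - F a\<bar> \<le> L * \<bar>b - a\<bar>" if "0 \<le> a" "0 \<le> b" for a b
    using field_differentiable_bound[of "{0..}" F F' L b a] F L that
    by (auto intro: has_field_derivative_at_within)
  have LF: "loc_integrable \<Omega> (\<lambda>x. F (u x))"
    unfolding loc_integrable_def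
  proof (intro conjI allI impI)
    fix K assume K: "compact K \<and> K \<subseteq> \<Omega>"
    then have [measurable]: "K \<in> sets borel" by (auto intro: borel_compact)
    show "set_integrable lborel K (\<lambda>x. F (u x))"
      unfolding set_integrable_def
    proof (rule Bochner_Integration.integrable_bound)
      have "set_integrable lborel K u" using Lu K by (auto simp: loc_integrable_def)
      then show "integrable lborel (\<lambda>x. indicator K x * \<bar>F 0\<bar> + L * (indicator K x *\<^sub>R u x))"
        unfolding set_integrable_def using K emeasure_bounded_finite[OF compact_imp_bounded, of K]
        by (intro Bochner_Integration.integrable_add integrable_mult_left integrable_mult_right integrable_real_indicator) auto
      have "\<bar>F (u x)\<bar> \<le> \<bar>F 0\<bar> + L * u x" for x
        using lip[of 0 "u x"] u0[of x] by auto
      then show "AE x in lborel. norm (indicator K x *\<^sub>R F (u x)) \<le> norm (indicator K x * \<bar>F 0\<bar> + L * (indicator K x *\<^sub>R u x))"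
        using u0 L0 by (auto simp: indicator_def intro: order_trans[OF _ abs_ge_self])
    qed measurable
  qed (rule Fm)
  have LF': "loc_integrable \<Omega> (\<lambda>x. F' (u x) *\<^sub>R g x)"
    unfolding loc_integrable_def
  proof (intro conjI allI impI)
    fix K assume K: "compact K \<and> K \<subseteq> \<Omega>"
    then have [measurable]: "K \<in> sets borel" by (auto intro: borel_compact)
    show "set_integrable lborel K (\<lambda>x. F' (u x) *\<^sub>R g x)"
      unfolding set_integrable_def
    proof (rule Bochner_Integration.integrable_bound)
      show "integrable lborel (\<lambda>x. L *\<^sub>R (indicator K x *\<^sub>R g x))"
        using Lg K by (intro integrable_scaleR_right) (auto simp: loc_integrable_def set_integrable_def)
      show "AE x in lborel. norm (indicator K x *\<^sub>R F' (u x) *\<^sub>R g x) \<le> norm (L *\<^sub>R (indicator K x *\<^sub>R g x))"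
        using L[OF u0] L0 by (intro AE_I2) (auto simp: indicator_def intro: mult_right_mono)
    qed measurable
  qed measurable
  have "(LBINT x. F (u x) * partial_deriv i \<phi> x) = - (LBINT x. (F' (u x) *\<^sub>R g x) $ i * \<phi> x)"
    if \<phi>: "\<phi> \<in> test_functions \<Omega>" for \<phi> i
  proof -
    define e :: "real ^ 'n" where "e = axis i 1"
    have ne: "norm e = 1" by (simp add: e_def)
    obtain S where S: "compact S" "S \<subseteq> \<Omega>" "\<And>x. x \<notin> S \<Longrightarrow> \<phi> x = 0"
      using test_functionsE[OF \<phi>] by metis
    obtain B where B: "0 < B" "\<And>x. \<bar>\<phi> x\<bar> \<le> B" using test_functions_bounded[OF \<phi>] by blast
    have \<phi>s: "smooth_fun \<phi>" by (rule test_functions_smooth[OF \<phi>])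
    have [measurable]: "\<phi> \<in> borel_measurable borel" using \<phi> by (auto simp: test_functions_measurable)
    obtain \<delta> where \<delta>: "0 < \<delta>" "(\<Union>x\<in>S. cball x \<delta>) \<subseteq> \<Omega>"
      using compact_subset_open_imp_cball_epsilon_subset[OF S(1) \<Omega> S(2)] .
    \<comment> \<open>a compact subset of \<open>\<Omega>\<close> containing the support of \<open>\<phi>\<close> and all translates used below\<close>
    define K where "K = (\<lambda>(x, t). x + t *\<^sub>R e) ` (S \<times> {0..\<delta>})"
    have K: "compact K" unfolding K_def
      by (intro compact_continuous_image compact_Times S compact_Icc) (auto intro!: continuous_intros simp: case_prod_beta)
    have K\<Omega>: "K \<subseteq> \<Omega>"
    proof -
      have "x + t *\<^sub>R e \<in> cball x \<delta>" if "0 \<le> t" "t \<le> \<delta>" for x t using that ne by (simp add: dist_norm)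
      then show ?thesis using \<delta>(2) unfolding K_def by fastforce
    qed
    have SK: "x + t *\<^sub>R e \<in> K" if "x \<in> S" "0 \<le> t" "t \<le> \<delta>" for x t
      unfolding K_def using that by force
    have SK0: "x \<in> K" if "x \<in> S" for x using SK[OF that, of 0] \<delta>(1) by simp
    have [measurable]: "K \<in> sets borel" by (rule borel_compact[OF K])
    \<comment> \<open>a smooth function that is positive exactly where \<open>\<phi>\<close> does not vanish\<close>
    define w where "w x = \<phi> x * \<phi> x" for x
    have w: "smooth_fun w" unfolding w_def by (intro smooth_fun_mult \<phi>s)
    let ?V = "{x. 0 < w x}"
    have V: "x \<in> ?V \<longleftrightarrow> \<phi> x \<noteq> 0" for x by (simp add: w_def) (metis less_irrefl mult_eq_0_iff not_real_square_gt_zero)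
    have VS: "?V \<subseteq> S" using V S(3) by blast
    have Vb: "bounded ?V" using bounded_subset[OF compact_imp_bounded[OF S(1)] VS] .
    have [measurable]: "?V \<in> sets borel" unfolding w_def by measurable
    define U where "U x = indicator K x * u x" for x
    define G where "G x = indicator K x * g x $ i" for x
    define W where "W x = indicator K x * F (u x)" for x
    have U: "integrable lborel U" and G: "integrable lborel G" and W: "integrable lborel W"
      using Lu loc_integrable_nth[OF Lg] LF K K\<Omega> unfolding U_def[abs_def] G_def[abs_def] W_def[abs_def]
      by (auto simp: loc_integrable_def set_integrable_def)
    have [measurable]: "U \<in> borel_measurable borel" "G \<in> borel_measurable borel" "W \<in> borel_measurable borel"
      using borel_measurable_integrable[OF U] borel_measurable_integrable[OF G] borel_measurable_integrable[OF W] by simp_all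
    \<comment> \<open>step sizes; along a subsequence \<open>h\<close> of them the translates of \<open>U\<close> converge almost everywhere\<close>
    define t where "t k = \<delta> / real (Suc k)" for k
    have t0: "t \<longlonglongrightarrow> 0" unfolding t_def by real_asymp
    have "(\<lambda>k. \<integral>x. norm (U (x + t k *\<^sub>R e) - U x) \<partial>lborel) \<longlonglongrightarrow> 0"
    proof (rule LIMSEQ_I)
      fix r :: real assume "0 < r"
      then obtain \<rho> where \<rho>: "0 < \<rho>" "\<And>v. norm v < \<rho> \<Longrightarrow> (LBINT x. \<bar>U (x + v) - U x\<bar>) < r"
        using L1_translation_continuous[OF U] by metis
      have "\<forall>\<^sub>F k in sequentially. \<bar>t k\<bar> < \<rho>"
        using tendsto_rabs_zero[OF t0] \<rho>(1) order_tendstoD(2) by metis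
      then obtain no where "\<And>k. no \<le> k \<Longrightarrow> \<bar>t k\<bar> < \<rho>" unfolding eventually_sequentially by blast
      then have "norm ((LBINT x. norm (U (x + t k *\<^sub>R e) - U x)) - 0) < r" if "no \<le> k" for k
        using \<rho>(2)[of "t k *\<^sub>R e"] ne that by simp
      then show "\<exists>no. \<forall>k\<ge>no. norm ((LBINT x. norm (U (x + t k *\<^sub>R e) - U x)) - 0) < r"
        by blast
    qed
    from tendsto_L1_AE_subseq[OF _ this]
    obtain \<sigma> :: "nat \<Rightarrow> nat" where \<sigma>: "strict_mono \<sigma>" "AE x in lborel. (\<lambda>k. U (x + t (\<sigma> k) *\<^sub>R e) - U x) \<longlonglongrightarrow> 0"
      using U integrable_lborel_translate[OF U] by auto
    define h where "h k = t (\<sigma> k)" for k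
    have h0: "h \<longlonglongrightarrow> 0" using LIMSEQ_subseq_LIMSEQ[OF t0 \<sigma>(1)] by (simp add: h_def[abs_def] comp_def)
    have h: "0 < h k" "h k \<le> \<delta>" for k
      using \<delta>(1) by (auto simp: h_def t_def divide_le_eq mult_le_cancel_left1)
    have hAE: "AE x in lborel. (\<lambda>k. U (x + h k *\<^sub>R e)) \<longlonglongrightarrow> U x"
      using \<sigma>(2) by eventually_elim (simp add: h_def LIM_zero_iff)
    have Vh: "x \<in> K \<and> x + h k *\<^sub>R e \<in> K" if "x \<in> ?V" for x k
      using SK[of x "h k"] SK0[of x] h[of k] VS that by auto
    \<comment> \<open>the slope of \<open>F\<close> over the chord, extended by the derivative on the diagonal\<close>
    define m where "m a b = (if b = a then F' a else (F b - F a) / (b - a))" for a b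
    have m_eq: "F b - F a = m a b * (b - a)" for a b by (simp add: m_def)
    have m_le: "\<bar>m a b\<bar> \<le> L" if "0 \<le> a" "0 \<le> b" for a b
      using lip[OF that] L that by (auto simp: m_def divide_simps)
    have m_cont: "isCont (m a) a" if "0 \<le> a" for a
    proof -
      have "((\<lambda>b. (F b - F a) / (b - a)) \<longlongrightarrow> F' a) (at a)"
        using F[OF that] by (simp add: has_field_derivative_iff)
      then have "(m a \<longlongrightarrow> F' a) (at a)"
        by (rule Lim_transform_eventually) (auto simp: m_def eventually_at_filter)
      then show ?thesis by (simp add: isCont_def m_def)
    qed
    define D where "D k x = (U (x + h k *\<^sub>R e) - U x) / h k" for k x
    have D_G: "(\<lambda>k. \<integral>x. indicator ?V x * \<bar>D k x - G x\<bar> \<partial>lborel) \<longlonglongrightarrow> 0"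
    proof (rule LIMSEQ_I)
      fix r :: real assume r: "0 < r"
      then obtain \<rho> where \<rho>: "0 < \<rho>" "\<And>v. norm v < \<rho> \<Longrightarrow> (LBINT x. \<bar>G (x + v) - G x\<bar>) < r / 2"
        using L1_translation_continuous[OF G, of "r/2"] by (metis half_gt_zero)
      have "\<forall>\<^sub>F k in sequentially. h k < \<rho>" using h0 \<rho>(1) order_tendstoD(2) by metis
      then obtain no where no: "\<And>k. no \<le> k \<Longrightarrow> h k < \<rho>" unfolding eventually_sequentially by blast
      have "norm ((LBINT x. indicator ?V x * \<bar>D k x - G x\<bar>) - 0) < r" if k: "no \<le> k" for k
      proof -
        have "(LBINT x. indicator ?V x * \<bar>(U (x + h k *\<^sub>R e) - U x) - h k * G x\<bar>) \<le> h k * (r / 2)"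
          unfolding U_def G_def e_def
        proof (rule L1_difference_quotient_le[OF u K K\<Omega> w Vb h(1)])
          show "x + s *\<^sub>R axis i 1 \<in> K" if "0 < w x" "0 \<le> s" "s \<le> h k" for x s
            using SK[of x s] VS that h(2)[of k] unfolding e_def by auto
          show "(LBINT x. \<bar>indicator K (x + s *\<^sub>R axis i 1) * g (x + s *\<^sub>R axis i 1) $ i - indicator K x * g x $ i\<bar>) \<le> r / 2"
            if "0 \<le> s" "s \<le> h k" for s
            using \<rho>(2)[of "s *\<^sub>R e"] no[OF k] that unfolding G_def e_def by (simp add: less_imp_le)
        qed
        moreover have "indicator ?V x * \<bar>(U (x + h k *\<^sub>R e) - U x) - h k * G x\<bar> = h k * (indicator ?V x * \<bar>D k x - G x\<bar>)" for x
        proof -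
          have "(U (x + h k *\<^sub>R e) - U x) - h k * G x = h k * (D k x - G x)"
            using h(1)[of k] by (simp add: D_def right_diff_distrib diff_divide_distrib)
          then show ?thesis using h(1)[of k] by (simp add: abs_mult)
        qed
        ultimately have "h k * (LBINT x. indicator ?V x * \<bar>D k x - G x\<bar>) \<le> h k * (r / 2)" by simp
        then have "(LBINT x. indicator ?V x * \<bar>D k x - G x\<bar>) \<le> r / 2"
          using h(1)[of k] by simp
        moreover have "0 \<le> (LBINT x. indicator ?V x * \<bar>D k x - G x\<bar>)"
          by (intro integral_nonneg_AE) simp
        ultimately show ?thesis using r by simp
      qed
      then show "\<exists>no. \<forall>k\<ge>no. norm ((LBINT x. indicator ?V x * \<bar>D k x - G x\<bar>) - 0) < r" by blast
    qed
    define R where "R k x = indicator ?V x * (\<bar>m (u x) (u (x + h k *\<^sub>R e)) - F' (u x)\<bar> * \<bar>G x\<bar>)" for k x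
    have mm[measurable]: "(\<lambda>x. m (u x) (u (x + h k *\<^sub>R e))) \<in> borel_measurable borel" for k
      unfolding m_def using measurable_compose[OF _ Fm, of "\<lambda>x. x + h k *\<^sub>R e" borel] by measurable
    have Rm[measurable]: "R k \<in> borel_measurable borel" for k unfolding R_def[abs_def] by measurable
    have R_le: "\<bar>R k x\<bar> \<le> 2 * L * \<bar>G x\<bar>" for k x
    proof -
      have "\<bar>m (u x) (u (x + h k *\<^sub>R e)) - F' (u x)\<bar> \<le> 2 * L"
        using m_le[OF u0 u0, of x "x + h k *\<^sub>R e"] L[OF u0, of x] by linarith
      from mult_right_mono[OF this, of "\<bar>G x\<bar>"] show ?thesis
        using L0 by (auto simp: R_def indicator_def abs_mult)
    qed
    have iR: "integrable lborel (R k)" for k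
      by (rule Bochner_Integration.integrable_bound[of _ "\<lambda>x. 2 * L * \<bar>G x\<bar>"])
        (use G R_le[of k] in \<open>auto intro: order_trans[OF _ abs_ge_self]\<close>)
    have R0: "(\<lambda>k. \<integral>x. R k x \<partial>lborel) \<longlonglongrightarrow> integral\<^sup>L lborel (\<lambda>x :: real ^ 'n. 0)"
    proof (rule integral_dominated_convergence[where w="\<lambda>x. 2 * L * \<bar>G x\<bar>"])
      show "AE x in lborel. (\<lambda>k. R k x) \<longlonglongrightarrow> 0"
        using hAE
      proof eventually_elim
        case (elim x)
        show ?case
        proof (cases "x \<in> ?V")
          case True
          have "(\<lambda>k. u (x + h k *\<^sub>R e)) \<longlonglongrightarrow> u x"
            using elim Vh[OF True] by (simp add: U_def)
          from isCont_tendsto_compose[OF m_cont[OF u0[of x]] this]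
          have "(\<lambda>k. m (u x) (u (x + h k *\<^sub>R e))) \<longlonglongrightarrow> F' (u x)" by (simp add: m_def)
          then have "(\<lambda>k. indicator ?V x * (\<bar>m (u x) (u (x + h k *\<^sub>R e)) - F' (u x)\<bar> * \<bar>G x\<bar>)) \<longlonglongrightarrow> indicator ?V x * (\<bar>F' (u x) - F' (u x)\<bar> * \<bar>G x\<bar>)"
            by (intro tendsto_intros)
          then show ?thesis by (simp add: R_def)
        qed (simp add: R_def)
      qed
    qed (use G R_le in auto)
    have iD: "integrable lborel (D k)" for k
      unfolding D_def[abs_def] using U integrable_lborel_translate[OF U] by auto
    have iV: "integrable lborel (\<lambda>x. indicator ?V x * \<bar>D k x - G x\<bar>)" for k
    proof (rule Bochner_Integration.integrable_bound[of _ "\<lambda>x. D k x - G x"])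
      have [measurable]: "D k \<in> borel_measurable borel"
        using borel_measurable_integrable[OF iD[of k]] by simp
      show "(\<lambda>x. indicator ?V x * \<bar>D k x - G x\<bar>) \<in> borel_measurable lborel" by measurable
    qed (use iD[of k] G in \<open>auto simp: indicator_def\<close>)
    have prod_int: "integrable lborel (\<lambda>x. f x * \<phi> x)" if f: "integrable lborel f" for f
    proof (rule Bochner_Integration.integrable_bound)
      show "integrable lborel (\<lambda>x. B * f x)" using f by simp
      show "AE x in lborel. norm (f x * \<phi> x) \<le> norm (B * f x)"
        using mult_left_mono[OF B(2), of "\<bar>f _\<bar>"] B(1) by (simp add: abs_mult mult.commute)
    qed (use borel_measurable_integrable[OF f] in measurable)
    have iQ: "integrable lborel (\<lambda>x. (W (x + h k *\<^sub>R e) - W x) / h k * \<phi> x)" for k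
      by (intro prod_int) (use W integrable_lborel_translate[OF W] in auto)
    have iF: "integrable lborel (\<lambda>x. F' (u x) * g x $ i * \<phi> x)"
      using integrable_times_test_function[OF loc_integrable_nth[OF LF', of i] \<phi>] by simp
    have diff_le: "\<bar>(LBINT x. (W (x + h k *\<^sub>R e) - W x) / h k * \<phi> x) - (LBINT x. F' (u x) * g x $ i * \<phi> x)\<bar>
        \<le> B * (L * (LBINT x. indicator ?V x * \<bar>D k x - G x\<bar>) + (LBINT x. R k x))" for k
    proof -
      have "\<bar>(LBINT x. (W (x + h k *\<^sub>R e) - W x) / h k * \<phi> x) - (LBINT x. F' (u x) * g x $ i * \<phi> x)\<bar> =
        \<bar>\<integral>x. (W (x + h k *\<^sub>R e) - W x) / h k * \<phi> x - F' (u x) * g x $ i * \<phi> x \<partial>lborel\<bar>"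
        using iQ iF by simp
      also have "\<dots> \<le> (LBINT x. \<bar>(W (x + h k *\<^sub>R e) - W x) / h k * \<phi> x - F' (u x) * g x $ i * \<phi> x\<bar>)"
        by (rule integral_abs_bound)
      also have "\<dots> \<le> (LBINT x. B * (L * (indicator ?V x * \<bar>D k x - G x\<bar>) + R k x))"
      proof (rule integral_mono)
        fix x
        show "\<bar>(W (x + h k *\<^sub>R e) - W x) / h k * \<phi> x - F' (u x) * g x $ i * \<phi> x\<bar> \<le>
          B * (L * (indicator ?V x * \<bar>D k x - G x\<bar>) + R k x)"
        proof (cases "x \<in> ?V")
          case True
          let ?m = "m (u x) (u (x + h k *\<^sub>R e))"
          have "(W (x + h k *\<^sub>R e) - W x) / h k = ?m * D k x"
            using Vh[OF True, of k] m_eq[of "u (x + h k *\<^sub>R e)" "u x"] by (simp add: W_def D_def U_def)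
          moreover have "g x $ i = G x" using Vh[OF True] by (simp add: G_def)
          ultimately have "(W (x + h k *\<^sub>R e) - W x) / h k * \<phi> x - F' (u x) * g x $ i * \<phi> x =
             (?m * (D k x - G x) + (?m - F' (u x)) * G x) * \<phi> x"
            by (simp add: algebra_simps)
          also have "\<bar>\<dots>\<bar> \<le> (L * \<bar>D k x - G x\<bar> + \<bar>?m - F' (u x)\<bar> * \<bar>G x\<bar>) * B"
          proof -
            have "\<bar>?m * (D k x - G x) + (?m - F' (u x)) * G x\<bar> \<le> \<bar>?m\<bar> * \<bar>D k x - G x\<bar> + \<bar>?m - F' (u x)\<bar> * \<bar>G x\<bar>"
              by (metis abs_mult abs_triangle_ineq)
            also have "\<dots> \<le> L * \<bar>D k x - G x\<bar> + \<bar>?m - F' (u x)\<bar> * \<bar>G x\<bar>"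
              by (intro add_right_mono mult_right_mono m_le u0) auto
            finally show ?thesis unfolding abs_mult by (intro mult_mono B(2)) (auto intro!: add_nonneg_nonneg mult_nonneg_nonneg L0)
          qed
          finally show ?thesis using True by (simp add: R_def mult.commute)
        next
          case False
          then have "\<phi> x = 0" using V by blast
          then show ?thesis using False by (simp add: R_def)
        qed
      qed (use iQ iF iV iR in auto)
      also have "\<dots> = B * (L * (LBINT x. indicator ?V x * \<bar>D k x - G x\<bar>) + (LBINT x. R k x))"
        using iV iR by simp
      finally show ?thesis .
    qed
    have "(\<lambda>k. B * (L * (LBINT x. indicator ?V x * \<bar>D k x - G x\<bar>) + (LBINT x. R k x))) \<longlonglongrightarrow> B * (L * 0 + integral\<^sup>L lborel (\<lambda>x :: real ^ 'n. 0))"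
      by (intro tendsto_intros D_G R0)
    then have "(\<lambda>k. B * (L * (LBINT x. indicator ?V x * \<bar>D k x - G x\<bar>) + (LBINT x. R k x))) \<longlonglongrightarrow> 0" by simp
    then have "(\<lambda>k. (LBINT x. (W (x + h k *\<^sub>R e) - W x) / h k * \<phi> x) - (LBINT x. F' (u x) * g x $ i * \<phi> x)) \<longlonglongrightarrow> 0"
      by (rule Lim_null_comparison[rotated]) (use diff_le in auto)
    then have lim1: "(\<lambda>k. (LBINT x. (W (x + h k *\<^sub>R e) - W x) / h k * \<phi> x)) \<longlonglongrightarrow> (LBINT x. F' (u x) * g x $ i * \<phi> x)"
      by (simp add: LIM_zero_iff)
    let ?a = "\<lambda>s. \<integral>x. W x * \<phi> (x - s *\<^sub>R e) \<partial>lborel"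
    have "(?a has_real_derivative - (LBINT x. W x * partial_deriv i \<phi> (x - 0 *\<^sub>R e))) (at 0)"
      unfolding e_def by (rule DERIV_integral_translate_test[OF W \<phi>])
    then have "(\<lambda>k. (?a (h k) - ?a 0) / (h k - 0)) \<longlonglongrightarrow> - (LBINT x. W x * partial_deriv i \<phi> (x - 0 *\<^sub>R e))"
      unfolding has_field_derivative_iff tendsto_at_iff_sequentially comp_def
      using h(1) h0 by (auto dest!: spec[of _ h] simp: less_le)
    moreover have "(?a (h k) - ?a 0) / (h k - 0) = (LBINT x. (W (x + h k *\<^sub>R e) - W x) / h k * \<phi> x)" for k
    proof -
      have "?a (h k) = (LBINT x. W (x + h k *\<^sub>R e) * \<phi> x)"
        using integral_lborel_translate[of "\<lambda>x. W x * \<phi> (x - h k *\<^sub>R e)" "h k *\<^sub>R e"] by simp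
      moreover have "(W (x + h k *\<^sub>R e) - W x) / h k * \<phi> x = (W (x + h k *\<^sub>R e) * \<phi> x - W x * \<phi> x) / h k" for x
        by (simp add: left_diff_distrib)
      ultimately show ?thesis
        using prod_int[OF W] prod_int[OF integrable_lborel_translate[OF W]]
        by (simp only: integral_divide_zero Bochner_Integration.integral_diff diff_zero scaleR_zero_left)
    qed
    ultimately have "(\<lambda>k. (LBINT x. (W (x + h k *\<^sub>R e) - W x) / h k * \<phi> x)) \<longlonglongrightarrow>
        - (LBINT x. W x * partial_deriv i \<phi> (x - 0 *\<^sub>R e))"
      by (simp only:)
    from LIMSEQ_unique[OF lim1 this]
    have "(LBINT x. F' (u x) * g x $ i * \<phi> x) = - (LBINT x. W x * partial_deriv i \<phi> x)"
      by simp
    moreover have "(LBINT x. W x * partial_deriv i \<phi> x) = (LBINT x. F (u x) * partial_deriv i \<phi> x)"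
    proof (intro Bochner_Integration.integral_cong refl)
      fix x
      show "W x * partial_deriv i \<phi> x = F (u x) * partial_deriv i \<phi> x"
      proof (cases "x \<in> K")
        case False
        then have "x \<in> - S" using SK0 by blast
        then have "partial_deriv i \<phi> x = 0"
          by (rule partial_deriv_eq_0_outside[rotated]) (use S compact_imp_closed in auto)
        then show ?thesis by simp
      qed (simp add: W_def)
    qed
    ultimately show ?thesis by simp
  qed
  then show ?thesis unfolding borel_weak_grad_def using LF LF' by blast
qed

section \<open>Lebesgue measurable functions and Borel representatives\<close>

lemma measurable_lebesgue_on_AE:
  fixes f F :: "'a::euclidean_space \<Rightarrow> 'b::euclidean_space"
  assumes \<Omega>: "\<Omega> \<in> sets lebesgue" and F: "F \<in> borel_measurable borel"
    and AE: "AE x in lborel. x \<in> \<Omega> \<longrightarrow> f x = F x"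
  shows "f \<in> borel_measurable (lebesgue_on \<Omega>)"
proof -
  have "F \<in> borel_measurable lebesgue" using measurable_completion[of F lborel borel] F by simp
  then have "F measurable_on \<Omega>" by (rule lebesgue_measurable_imp_measurable_on[OF _ \<Omega>])
  moreover obtain N where N: "\<And>x. x \<in> space lborel - N \<Longrightarrow> x \<in> \<Omega> \<longrightarrow> f x = F x" "N \<in> null_sets lborel"
    using AE_E3[OF AE] by blast
  have "negligible N" using N(2) by (simp add: negligible_iff_null_sets null_sets_completionI)
  moreover have "f x = F x" if "x \<in> \<Omega> - N" for x using N(1)[of x] that by simp
  ultimately have "f measurable_on \<Omega>" by (rule measurable_on_spike)
  then show ?thesis using measurable_on_iff_borel_measurable[OF \<Omega>] by blast
qed

lemma ex_borel_representative:
  fixes f :: "'a::euclidean_space \<Rightarrow> real"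
  assumes \<Omega>: "\<Omega> \<in> sets lebesgue" and f: "f \<in> borel_measurable (lebesgue_on \<Omega>)"
  obtains F where "F \<in> borel_measurable borel" "AE x in lborel. x \<in> \<Omega> \<longrightarrow> f x = F x"
proof -
  have "(\<lambda>x. indicator \<Omega> x *\<^sub>R f x) \<in> borel_measurable lebesgue"
    using f \<Omega> by (simp add: borel_measurable_restrict_space_iff)
  from completion_ex_borel_measurable_real[OF this]
  obtain F where F: "F \<in> borel_measurable lborel" "AE x in lborel. indicator \<Omega> x *\<^sub>R f x = F x" by blast
  from F(2) have "AE x in lborel. x \<in> \<Omega> \<longrightarrow> f x = F x" by eventually_elim auto
  with F(1) show ?thesis using that by simp
qed

lemma ex_borel_representative_vec:
  fixes f :: "'a::euclidean_space \<Rightarrow> real ^ 'n"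
  assumes \<Omega>: "\<Omega> \<in> sets lebesgue" and f: "f \<in> borel_measurable (lebesgue_on \<Omega>)"
  obtains F where "F \<in> borel_measurable borel" "AE x in lborel. x \<in> \<Omega> \<longrightarrow> f x = F x"
proof -
  have "\<exists>F. F \<in> borel_measurable borel \<and> (AE x in lborel. x \<in> \<Omega> \<longrightarrow> f x $ i = F x)" for i
  proof -
    have "(\<lambda>x. f x $ i) \<in> borel_measurable (lebesgue_on \<Omega>)"
      by (rule measurable_compose[OF f measurable_vec_nth])
    from ex_borel_representative[OF \<Omega> this] show ?thesis by metis
  qed
  then obtain F where F: "\<And>i. F i \<in> borel_measurable borel" "\<And>i. AE x in lborel. x \<in> \<Omega> \<longrightarrow> f x $ i = F i x"
    by metis
  have "AE x in lborel. \<forall>i. x \<in> \<Omega> \<longrightarrow> f x $ i = F i x" using F(2) by (subst AE_all_countable) simp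
  then have "AE x in lborel. x \<in> \<Omega> \<longrightarrow> f x = (\<chi> i. F i x)" by eventually_elim (simp add: vec_eq_iff)
  then show ?thesis using that[OF measurable_vec_lambda[of F, OF F(1)]] by blast
qed

lemma nn_integral_lebesgue_on_eq:
  assumes \<Omega>: "\<Omega> \<in> sets lebesgue" and AE: "AE x in lborel. x \<in> \<Omega> \<longrightarrow> f x = F x"
  shows "(\<integral>\<^sup>+x. f x \<partial>lebesgue_on \<Omega>) = (\<integral>\<^sup>+x. F x * indicator \<Omega> x \<partial>lborel)"
proof -
  have "(\<integral>\<^sup>+x. f x \<partial>lebesgue_on \<Omega>) = (\<integral>\<^sup>+x. f x * indicator \<Omega> x \<partial>lborel)"
    using \<Omega> by (simp add: nn_integral_restrict_space nn_integral_completion)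
  also have "\<dots> = (\<integral>\<^sup>+x. F x * indicator \<Omega> x \<partial>lborel)"
    using AE by (intro nn_integral_cong_AE) (auto simp: indicator_def)
  finally show ?thesis .
qed

lemma integral_lebesgue_on_eq:
  fixes f F :: "'a::euclidean_space \<Rightarrow> real"
  assumes \<Omega>: "\<Omega> \<in> sets lebesgue" and F: "F \<in> borel_measurable borel"
    and AE: "AE x in lborel. x \<in> \<Omega> \<longrightarrow> f x = F x" and F0: "\<And>x. x \<notin> \<Omega> \<Longrightarrow> F x = 0"
  shows "(\<integral>x. f x \<partial>lebesgue_on \<Omega>) = (LBINT x. F x)"
proof -
  have "(\<integral>x. f x \<partial>lebesgue_on \<Omega>) = (\<integral>x. indicator \<Omega> x *\<^sub>R f x \<partial>lebesgue)"
    using \<Omega> by (simp add: integral_restrict_space)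
  also have "\<dots> = (\<integral>x. F x \<partial>lebesgue)"
  proof (rule integral_cong_AE)
    show "(\<lambda>x. indicator \<Omega> x *\<^sub>R f x) \<in> borel_measurable lebesgue"
      using measurable_lebesgue_on_AE[OF \<Omega> F AE] \<Omega> by (simp add: borel_measurable_restrict_space_iff)
    show "F \<in> borel_measurable lebesgue" using measurable_completion[of F lborel borel] F by simp
    show "AE x in lebesgue. indicator \<Omega> x *\<^sub>R f x = F x"
      using AE_completion[OF AE] by eventually_elim (auto simp: F0 indicator_def)
  qed
  also have "\<dots> = (LBINT x. F x)" using F by (intro integral_completion) simp
  finally show ?thesis .
qed

lemma Lp_loc_1_iff_loc_integrable:
  fixes f F :: "real ^ 'n \<Rightarrow> 'b::euclidean_space"
  assumes \<Omega>: "open \<Omega>" and F: "F \<in> borel_measurable borel"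
    and AE: "AE x in lborel. x \<in> \<Omega> \<longrightarrow> f x = F x"
  shows "f \<in> Lp_loc 1 \<Omega> \<longleftrightarrow> loc_integrable \<Omega> F"
proof -
  have [measurable]: "F \<in> borel_measurable borel" by (rule F)
  have "f \<in> Lp 1 K \<longleftrightarrow> set_integrable lborel K F" if K: "compact K" "K \<subseteq> \<Omega>" for K
  proof -
    have [measurable]: "K \<in> sets borel" by (rule borel_compact[OF K(1)])
    have Kl: "K \<in> sets lebesgue" by (auto intro: sets_completionI_sets)
    have AEK: "AE x in lborel. x \<in> K \<longrightarrow> f x = F x" using AE by eventually_elim (use K in auto)
    have "(\<integral>\<^sup>+x. ennreal (norm (f x) powr 1) \<partial>lebesgue_on K) = (\<integral>\<^sup>+x. ennreal (norm (F x)) * indicator K x \<partial>lborel)"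
      by (rule nn_integral_lebesgue_on_eq[OF Kl]) (use AEK in eventually_elim, auto)
    also have "\<dots> = (\<integral>\<^sup>+x. ennreal (norm (indicator K x *\<^sub>R F x)) \<partial>lborel)"
      by (intro nn_integral_cong) (auto simp: indicator_def)
    finally have eq: "(\<integral>\<^sup>+x. ennreal (norm (f x) powr 1) \<partial>lebesgue_on K) =
        (\<integral>\<^sup>+x. ennreal (norm (indicator K x *\<^sub>R F x)) \<partial>lborel)" .
    have "f \<in> Lp 1 K \<longleftrightarrow> (\<integral>\<^sup>+x. ennreal (norm (indicator K x *\<^sub>R F x)) \<partial>lborel) < \<infinity>"
      unfolding Lp_def mem_Collect_eq eq using measurable_lebesgue_on_AE[OF Kl F AEK] by blast
    moreover have "set_integrable lborel K F \<longleftrightarrow> (\<integral>\<^sup>+x. ennreal (norm (indicator K x *\<^sub>R F x)) \<partial>lborel) < \<infinity>"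
      unfolding set_integrable_def integrable_iff_bounded by measurable
    ultimately show ?thesis by blast
  qed
  moreover have "f \<in> borel_measurable (lebesgue_on \<Omega>)"
    using \<Omega> by (intro measurable_lebesgue_on_AE[OF _ F AE]) (auto intro: sets_completionI_sets)
  ultimately show ?thesis using F unfolding Lp_loc_def loc_integrable_def by blast
qed

lemma has_weak_grad_iff_borel_weak_grad:
  assumes \<Omega>: "open \<Omega>" and U: "U \<in> borel_measurable borel" and G: "G \<in> borel_measurable borel"
    and u: "AE x in lborel. x \<in> \<Omega> \<longrightarrow> u x = U x" and g: "AE x in lborel. x \<in> \<Omega> \<longrightarrow> g x = G x"
  shows "has_weak_grad \<Omega> u g \<longleftrightarrow> borel_weak_grad \<Omega> U G"
proof -
  note [measurable] = U G
  have \<Omega>l: "\<Omega> \<in> sets lebesgue" using \<Omega> by (auto intro: sets_completionI_sets)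
  have 1: "(\<integral>x. u x * \<phi> x \<partial>lebesgue_on \<Omega>) = (LBINT x. U x * \<phi> x)"
      "(\<integral>x. g x $ i * \<phi> x \<partial>lebesgue_on \<Omega>) = (LBINT x. G x $ i * \<phi> x)"
    if \<phi>: "\<phi> \<in> test_functions \<Omega>" for \<phi> i
  proof -
    have [measurable]: "\<phi> \<in> borel_measurable borel" by (rule test_functions_measurable[OF \<phi>])
    have z: "\<phi> x = 0" if "x \<notin> \<Omega>" for x using test_functionsE[OF \<phi>] that by (metis subsetD)
    show "(\<integral>x. u x * \<phi> x \<partial>lebesgue_on \<Omega>) = (LBINT x. U x * \<phi> x)"
    proof (rule integral_lebesgue_on_eq[OF \<Omega>l])
      show "AE x in lborel. x \<in> \<Omega> \<longrightarrow> u x * \<phi> x = U x * \<phi> x" using u by eventually_elim auto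
    qed (simp_all add: z)
    show "(\<integral>x. g x $ i * \<phi> x \<partial>lebesgue_on \<Omega>) = (LBINT x. G x $ i * \<phi> x)"
    proof (rule integral_lebesgue_on_eq[OF \<Omega>l])
      show "AE x in lborel. x \<in> \<Omega> \<longrightarrow> g x $ i * \<phi> x = G x $ i * \<phi> x" using g by eventually_elim auto
    qed (simp_all add: z)
  qed
  have "u \<in> Lp_loc 1 \<Omega> \<longleftrightarrow> loc_integrable \<Omega> U" "g \<in> Lp_loc 1 \<Omega> \<longleftrightarrow> loc_integrable \<Omega> G"
    by (rule Lp_loc_1_iff_loc_integrable[OF \<Omega>]; fact)+
  moreover have "(\<forall>\<phi>\<in>test_functions \<Omega>. \<forall>i.
        (\<integral>x. u x * partial_deriv i \<phi> x \<partial>lebesgue_on \<Omega>) = - (\<integral>x. g x $ i * \<phi> x \<partial>lebesgue_on \<Omega>)) \<longleftrightarrow>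
     (\<forall>\<phi>\<in>test_functions \<Omega>. \<forall>i.
        (LBINT x. U x * partial_deriv i \<phi> x) = - (LBINT x. G x $ i * \<phi> x))"
    by (intro ball_cong refl all_cong1) (simp add: 1 test_functions_partial_deriv)
  ultimately show ?thesis unfolding has_weak_grad_def borel_weak_grad_def by blast
qed

text \<open>The chosen weak gradient agrees almost everywhere with any known one.\<close>

lemma weak_grad_eq_borel_weak_grad:
  assumes \<Omega>: "open \<Omega>" and u: "AE x in lborel. x \<in> \<Omega> \<longrightarrow> u x = U x" and U: "borel_weak_grad \<Omega> U G"
  shows "weakly_differentiable \<Omega> u" "AE x in lborel. x \<in> \<Omega> \<longrightarrow> weak_grad \<Omega> u x = G x"
proof -
  have \<Omega>l: "\<Omega> \<in> sets lebesgue" using \<Omega> by (auto intro: sets_completionI_sets)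
  have m: "U \<in> borel_measurable borel" "G \<in> borel_measurable borel"
    using U by (auto simp: borel_weak_grad_def loc_integrable_measurable)
  have hG: "has_weak_grad \<Omega> u G"
    using has_weak_grad_iff_borel_weak_grad[OF \<Omega> m u, of G] U by simp
  then show "weakly_differentiable \<Omega> u" unfolding weakly_differentiable_def by blast
  have w: "has_weak_grad \<Omega> u (weak_grad \<Omega> u)"
    unfolding weak_grad_def by (rule someI[of "has_weak_grad \<Omega> u"]) (rule hG)
  then have wm: "weak_grad \<Omega> u \<in> borel_measurable (lebesgue_on \<Omega>)"
    unfolding has_weak_grad_def Lp_loc_def by (elim conjE CollectE)
  obtain G' where G': "G' \<in> borel_measurable borel" "AE x in lborel. x \<in> \<Omega> \<longrightarrow> weak_grad \<Omega> u x = G' x"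
    by (rule ex_borel_representative_vec[OF \<Omega>l wm]) (rule that)
  have "borel_weak_grad \<Omega> U G'"
    using has_weak_grad_iff_borel_weak_grad[OF \<Omega> m(1) G'(1) u G'(2)] w by simp
  from borel_weak_grad_unique[OF \<Omega> this U] G'(2)
  show "AE x in lborel. x \<in> \<Omega> \<longrightarrow> weak_grad \<Omega> u x = G x" by eventually_elim auto
qed

lemma AE_lborel_pair:
  fixes P :: "'a::euclidean_space \<Rightarrow> bool"
  assumes "AE x in lborel. P x"
  shows "AE z in (lborel :: ('a \<times> 'a) measure). P (fst z) \<and> P (snd z)"
proof -
  obtain N where N: "\<And>x. x \<in> space lborel - N \<Longrightarrow> P x" "N \<in> null_sets lborel"
    using AE_E3[OF assms] by blast
  have [measurable]: "N \<in> sets borel" using N(2) by auto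
  have n: "AE x in lborel. x \<notin> N" by (rule AE_not_in[OF N(2)])
  have "AE z in (lborel :: 'a measure) \<Otimes>\<^sub>M lborel. fst z \<notin> N \<and> snd z \<notin> N"
  proof (rule lborel_pair.AE_pair_measure)
    show "{z \<in> space (lborel \<Otimes>\<^sub>M lborel). fst z \<notin> N \<and> snd z \<notin> N} \<in> sets ((lborel :: 'a measure) \<Otimes>\<^sub>M lborel)"
      by measurable
    show "AE x in lborel. AE y in lborel. fst (x, y) \<notin> N \<and> snd (x, y) \<notin> N"
      using n by eventually_elim (use n in auto)
  qed
  then show ?thesis unfolding lborel_prod by eventually_elim (use N(1) in auto)
qed

lemma nn_integral_lborel_pair:
  fixes f :: "'a::euclidean_space \<times> 'a \<Rightarrow> ennreal"
  assumes "f \<in> borel_measurable borel"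
  shows "(\<integral>\<^sup>+z. f z \<partial>lborel) = (\<integral>\<^sup>+x. (\<integral>\<^sup>+y. f (x, y) \<partial>lborel) \<partial>lborel)"
proof -
  have "f \<in> borel_measurable (lborel \<Otimes>\<^sub>M lborel)" using assms by (simp add: lborel_prod)
  from lborel.nn_integral_fst[OF this] show ?thesis by (simp add: lborel_prod)
qed

section \<open>Integrals of the singular kernel\<close>

lemma powr_split: "x powr a * x powr b = x powr (a + b)" for x :: real
  by (simp add: powr_add)

lemma ennreal_le_suminf: "F j \<le> (\<Sum>i. F i)" for F :: "nat \<Rightarrow> ennreal"
  using sum_le_suminf[of F "{j}"] by simp

text \<open>Covering \<open>A\<close> by dyadic shells bounds the integral of \<open>|z|\<^bsup>\<gamma> - N\<^esup>\<close> over \<open>A\<close> by a multiple of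
  \<open>\<Sum> r\<^sub>j\<^bsup>\<gamma>\<^esup>\<close>. Radii shrinking to \<open>0\<close> with \<open>\<gamma> > 0\<close> treat balls, radii growing to \<open>\<infinity>\<close> with \<open>\<gamma> < 0\<close>
  treat complements of balls.\<close>

lemma nn_integral_dyadic_kernel:
  fixes A :: "'a::euclidean_space set" and r :: "nat \<Rightarrow> real" and \<gamma> :: real
  assumes r: "\<And>j. 0 < r j" and cover: "\<And>z. z \<in> A \<Longrightarrow> \<exists>j. r j / 2 \<le> norm z \<and> norm z < r j"
    and sum: "summable (\<lambda>j. r j powr \<gamma>)"
  shows "(\<integral>\<^sup>+z. ennreal (norm z powr (\<gamma> - DIM('a))) * indicator A z \<partial>lborel)
    \<le> ennreal (max 1 (2 powr (DIM('a) - \<gamma>)) * unit_ball_vol DIM('a) * (\<Sum>j. r j powr \<gamma>))"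
proof -
  define c :: real where "c = max 1 (2 powr (DIM('a) - \<gamma>))"
  have c: "0 < c" by (simp add: c_def)
  let ?f = "\<lambda>j z. ennreal (c * r j powr (\<gamma> - DIM('a))) * indicator (ball (0::'a) (r j)) z"
  have f_meas: "?f j \<in> borel_measurable lborel" for j
    by (intro borel_measurable_times_ennreal borel_measurable_const borel_measurable_indicator) simp
  have le: "ennreal (norm z powr (\<gamma> - DIM('a))) * indicator A z \<le> (\<Sum>j. ?f j z)" for z :: 'a
  proof (cases "z \<in> A")
    case True
    then obtain j where j: "r j / 2 \<le> norm z" "norm z < r j" using cover by blast
    have "norm z powr (\<gamma> - DIM('a)) \<le> c * r j powr (\<gamma> - DIM('a))"
    proof (cases "0 \<le> \<gamma> - DIM('a)")
      case True
      then have "norm z powr (\<gamma> - DIM('a)) \<le> r j powr (\<gamma> - DIM('a))"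
        using j by (intro powr_mono2) auto
      also have "\<dots> \<le> c * r j powr (\<gamma> - DIM('a))"
        using mult_right_mono[of 1 c "r j powr (\<gamma> - DIM('a))"] by (simp add: c_def)
      finally show ?thesis .
    next
      case False
      then have "norm z powr (\<gamma> - DIM('a)) \<le> (r j / 2) powr (\<gamma> - DIM('a))"
        using j r[of j] by (intro powr_mono2') auto
      also have "\<dots> = 2 powr (DIM('a) - \<gamma>) * r j powr (\<gamma> - DIM('a))"
        using r[of j] by (simp add: powr_divide powr_minus_divide powr_diff)
      also have "\<dots> \<le> c * r j powr (\<gamma> - DIM('a))"
        by (intro mult_right_mono) (auto simp: c_def)
      finally show ?thesis .
    qed
    then have "ennreal (norm z powr (\<gamma> - DIM('a))) * indicator A z \<le> ?f j z"
      using True j by (simp add: ennreal_leI)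
    also have "\<dots> \<le> (\<Sum>i. ?f i z)"
      by (rule ennreal_le_suminf)
    finally show ?thesis .
  qed simp
  have "(\<integral>\<^sup>+z. ennreal (norm z powr (\<gamma> - DIM('a))) * indicator A z \<partial>lborel) \<le> (\<integral>\<^sup>+z. (\<Sum>j. ?f j z) \<partial>lborel)"
    by (rule nn_integral_mono) (rule le)
  also have "\<dots> = (\<Sum>j. \<integral>\<^sup>+z. ?f j z \<partial>lborel)"
    by (rule nn_integral_suminf[of ?f lborel, OF f_meas])
  also have "\<dots> = (\<Sum>j. ennreal (c * unit_ball_vol DIM('a) * r j powr \<gamma>))"
  proof (intro suminf_cong)
    fix j
    have "(\<integral>\<^sup>+z. ?f j z \<partial>lborel) = ennreal (c * r j powr (\<gamma> - DIM('a))) * ennreal (unit_ball_vol DIM('a) * r j ^ DIM('a))"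
      using r[of j] by (simp add: nn_integral_cmult_indicator emeasure_ball)
    also have "\<dots> = ennreal ((c * r j powr (\<gamma> - DIM('a))) * (unit_ball_vol DIM('a) * r j ^ DIM('a)))"
      using c r[of j] by (intro ennreal_mult[symmetric]) (auto intro!: mult_nonneg_nonneg)
    also have "(c * r j powr (\<gamma> - DIM('a))) * (unit_ball_vol DIM('a) * r j ^ DIM('a)) = c * unit_ball_vol DIM('a) * r j powr \<gamma>"
    proof -
      have "r j powr (\<gamma> - DIM('a)) * r j ^ DIM('a) = r j powr \<gamma>"
        using r[of j] by (simp add: powr_realpow[symmetric] powr_add[symmetric])
      then show ?thesis by (metis mult.assoc mult.commute)
    qed
    finally show "(\<integral>\<^sup>+z. ?f j z \<partial>lborel) = ennreal (c * unit_ball_vol DIM('a) * r j powr \<gamma>)" .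
  qed
  also have "\<dots> = ennreal (\<Sum>j. c * unit_ball_vol DIM('a) * r j powr \<gamma>)"
    using c by (intro suminf_ennreal2 summable_mult sum) auto
  also have "(\<Sum>j. c * unit_ball_vol DIM('a) * r j powr \<gamma>) = c * unit_ball_vol DIM('a) * (\<Sum>j. r j powr \<gamma>)"
    by (rule suminf_mult[OF sum])
  finally show ?thesis by (simp add: c_def)
qed

lemma dyadic_bracket:
  fixes x \<rho> :: real
  assumes "0 < \<rho>" "\<rho> \<le> x"
  obtains j :: nat where "\<rho> * 2 ^ j \<le> x" "x < \<rho> * 2 ^ Suc j"
proof -
  obtain n :: nat where n: "x / \<rho> < 2 ^ n" using real_arch_pow[of 2 "x / \<rho>"] by auto
  define k where "k = (LEAST n::nat. x < \<rho> * 2 ^ n)"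
  have "x < \<rho> * 2 ^ n" using n assms by (simp add: field_simps)
  then have k: "x < \<rho> * 2 ^ k" "\<And>i. i < k \<Longrightarrow> \<rho> * 2 ^ i \<le> x"
    unfolding k_def using LeastI[of "\<lambda>n. x < \<rho> * 2 ^ n" n] not_less_Least[of _ "\<lambda>n. x < \<rho> * 2 ^ n"]
    by (auto simp: not_less)
  have "k \<noteq> 0"
  proof
    assume "k = 0"
    then show False using k(1) assms by simp
  qed
  then obtain j where "k = Suc j" using not0_implies_Suc by blast
  then show ?thesis using that[of j] k by auto
qed

lemma nn_integral_kernel_ball:
  fixes \<alpha> :: real
  assumes \<alpha>: "0 < \<alpha>"
  obtains C where "0 < C" "\<And>\<rho>. 0 < \<rho> \<Longrightarrow>
    (\<integral>\<^sup>+z. ennreal (norm z powr (\<alpha> - DIM('a))) * indicator (ball (0::'a::euclidean_space) \<rho>) z \<partial>lborel)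
      \<le> ennreal (C * \<rho> powr \<alpha>)"
proof
  let ?c = "max 1 (2 powr (DIM('a) - \<alpha>)) * unit_ball_vol DIM('a)"
  let ?C = "?c * (1 / (1 - 2 powr (-\<alpha>)))"
  have lt1: "2 powr (-\<alpha>) < 1" using \<alpha> by (simp add: powr_less_one)
  show "0 < ?C" using lt1 by (auto intro!: mult_pos_pos)
  fix \<rho> :: real assume \<rho>: "0 < \<rho>"
  let ?r = "\<lambda>j::nat. \<rho> / 2 ^ j"
  have pw: "?r j powr \<alpha> = \<rho> powr \<alpha> * (2 powr (-\<alpha>)) ^ j" for j
    using \<rho> by (simp add: powr_divide powr_realpow[symmetric] powr_powr powr_minus_divide mult.commute power_one_over field_simps)
  have sums: "(\<lambda>j. ?r j powr \<alpha>) sums (\<rho> powr \<alpha> * (1 / (1 - 2 powr (-\<alpha>))))"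
    unfolding pw by (intro sums_mult geometric_sums) (use lt1 in auto)
  have "(\<integral>\<^sup>+z. ennreal (norm z powr (\<alpha> - DIM('a))) * indicator (ball (0::'a) \<rho> - {0}) z \<partial>lborel)
      \<le> ennreal (max 1 (2 powr (DIM('a) - \<alpha>)) * unit_ball_vol DIM('a) * (\<Sum>j. ?r j powr \<alpha>))"
  proof (rule nn_integral_dyadic_kernel)
    show "summable (\<lambda>j. ?r j powr \<alpha>)" using sums by (rule sums_summable)
    show "\<exists>j. ?r j / 2 \<le> norm z \<and> norm z < ?r j" if z: "z \<in> ball (0::'a) \<rho> - {0}" for z
    proof -
      have "norm z > 0" "norm z < \<rho>" using z by auto
      then have "1 < \<rho> / norm z" by simp
      then have "1 \<le> \<rho> / norm z" by simp
      from dyadic_bracket[OF zero_less_one this] obtain j :: nat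
        where j: "1 * 2 ^ j \<le> \<rho> / norm z" "\<rho> / norm z < 1 * 2 ^ Suc j" .
      show ?thesis
      \<comment> \<open>the shells are half-open at the outer radius, so a point on a dyadic sphere belongs to the next larger shell\<close>
      proof (cases "2 ^ j = \<rho> / norm z")
        case True
        then have "j \<noteq> 0" using \<open>1 < \<rho> / norm z\<close> by (metis less_irrefl power_0)
        then obtain i where i: "j = Suc i" using not0_implies_Suc by blast
        have eq: "norm z * 2 ^ Suc i = \<rho>" using True \<open>norm z > 0\<close> i by (simp add: field_simps)
        show ?thesis
          using \<open>norm z > 0\<close> by (intro exI[of _ i]) (simp add: eq[symmetric])
      next
        case False
        then have "2 ^ j < \<rho> / norm z" using j by simp
        then show ?thesis using \<open>norm z > 0\<close> j(2)
          by (intro exI[of _ j]) (simp add: field_simps)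
      qed
    qed
  qed (use \<rho> in auto)
  also have "max 1 (2 powr (DIM('a) - \<alpha>)) * unit_ball_vol DIM('a) * (\<Sum>j. ?r j powr \<alpha>) = ?C * \<rho> powr \<alpha>"
    by (subst sums_unique[OF sums, symmetric]) (simp add: mult_ac)
  also have "(\<integral>\<^sup>+z. ennreal (norm z powr (\<alpha> - DIM('a))) * indicator (ball (0::'a) \<rho> - {0}) z \<partial>lborel)
     = (\<integral>\<^sup>+z. ennreal (norm z powr (\<alpha> - DIM('a))) * indicator (ball (0::'a) \<rho>) z \<partial>lborel)"
    by (intro nn_integral_cong) (auto simp: indicator_def)
  finally show "(\<integral>\<^sup>+z. ennreal (norm z powr (\<alpha> - DIM('a))) * indicator (ball (0::'a) \<rho>) z \<partial>lborel)
      \<le> ennreal (?C * \<rho> powr \<alpha>)" .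
qed

lemma nn_integral_kernel_tail_finite:
  fixes \<beta> \<rho> :: real
  assumes \<beta>: "0 < \<beta>" and \<rho>: "0 < \<rho>"
  shows "(\<integral>\<^sup>+z. ennreal (norm z powr (- real DIM('a) - \<beta>)) * indicator (- ball (0::'a::euclidean_space) \<rho>) z \<partial>lborel) < \<infinity>"
proof -
  let ?r = "\<lambda>j::nat. \<rho> * 2 ^ Suc j"
  have pw: "?r j powr (-\<beta>) = (2 * \<rho>) powr (-\<beta>) * (2 powr (-\<beta>)) ^ j" for j
  proof -
    have "?r j = (2 * \<rho>) * 2 powr real j" by (simp add: powr_realpow)
    then have "?r j powr (-\<beta>) = (2 * \<rho>) powr (-\<beta>) * (2 powr real j) powr (-\<beta>)"
      using \<rho> by (simp only: powr_mult) 
    also have "(2 powr real j) powr (-\<beta>) = (2 powr (-\<beta>)) powr real j" by (simp add: powr_powr mult.commute)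
    also have "\<dots> = (2 powr (-\<beta>)) ^ j" by (simp add: powr_realpow)
    finally show ?thesis .
  qed
  have sums: "(\<lambda>j. ?r j powr (-\<beta>)) sums ((2 * \<rho>) powr (-\<beta>) * (1 / (1 - 2 powr (-\<beta>))))"
    unfolding pw by (intro sums_mult geometric_sums) (use \<beta> in \<open>auto simp: powr_less_one\<close>)
  have "(\<integral>\<^sup>+z. ennreal (norm z powr (-\<beta> - DIM('a))) * indicator (- ball (0::'a) \<rho>) z \<partial>lborel)
      \<le> ennreal (max 1 (2 powr (DIM('a) - (-\<beta>))) * unit_ball_vol DIM('a) * (\<Sum>j. ?r j powr (-\<beta>)))"
  proof (rule nn_integral_dyadic_kernel)
    show "summable (\<lambda>j. ?r j powr (-\<beta>))" using sums by (rule sums_summable)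
    show "\<exists>j. ?r j / 2 \<le> norm z \<and> norm z < ?r j" if z: "z \<in> - ball (0::'a) \<rho>" for z
      using dyadic_bracket[OF \<rho>, of "norm z"] z by (auto simp: not_less)
  qed (use \<rho> in auto)
  also have "\<dots> < \<infinity>" by simp
  also have "- \<beta> - real DIM('a) = - real DIM('a) - \<beta>" by simp
  finally show ?thesis .
qed

section \<open>Pointwise inequalities\<close>

lemma power_diff_le:
  fixes x y :: real
  assumes "0 \<le> y" "y \<le> x"
  shows "x ^ m - y ^ m \<le> m * (x - y) * x ^ (m - 1)"
proof (induction m)
  case (Suc m)
  have "x ^ Suc m - y ^ Suc m = x * (x ^ m - y ^ m) + (x - y) * y ^ m" by (simp add: algebra_simps)
  also have "\<dots> \<le> x * (m * (x - y) * x ^ (m - 1)) + (x - y) * x ^ m"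
    using Suc assms by (intro add_mono mult_left_mono power_mono) auto
  also have "x * (m * (x - y) * x ^ (m - 1)) = m * (x - y) * x ^ m"
    by (cases m) auto
  finally show ?case by (simp add: algebra_simps)
qed simp

lemma powr_neg_diff_ge:
  fixes a b p :: real
  assumes "1 < p" "0 < b" "b \<le> a"
  shows "(p - 1) * (a - b) * a powr (-p) \<le> b powr (1 - p) - a powr (1 - p)"
proof (cases "b = a")
  case False
  then have ba: "b < a" using assms by simp
  have "\<exists>z. b < z \<and> z < a \<and> a powr (1-p) - b powr (1-p) = (a - b) * ((1 - p) * z powr (1 - p - 1))"
    using assms by (intro MVT2[OF ba]) (auto intro!: derivative_eq_intros)
  then obtain z where z: "b < z" "z < a" "a powr (1-p) - b powr (1-p) = (a - b) * ((1 - p) * z powr (- p))"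
    by auto
  have "a powr (-p) \<le> z powr (-p)" using z assms by (intro powr_mono2') auto
  then have "(p - 1) * (a - b) * a powr (-p) \<le> (p - 1) * (a - b) * z powr (-p)"
    using assms ba by (intro mult_left_mono) auto
  then show ?thesis using z(3) by (simp add: algebra_simps)
qed simp

text \<open>Both sides are of order \<open>(t - 1)\<^bsup>q\<^esup>\<close> near \<open>t = 1\<close> up to constants, and for large \<open>t\<close> the right-hand side
  grows like \<open>t\<^bsup>q - 1\<^esup>\<close>, which dominates any power of the logarithm times \<open>1\<close> or \<open>t\<^bsup>q - p\<^esup>\<close>. The two exponents
  \<open>e\<close> correspond to the weights \<open>b\<^bsup>q - p\<^esup>\<close> and \<open>a\<^bsup>q - p\<^esup>\<close> after scaling by \<open>t = a / b\<close>.\<close>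

lemma log_power_le:
  fixes p q :: real
  assumes p: "1 < p" and q: "1 < q"
  obtains c where "0 < c" "\<And>t e. \<lbrakk>1 \<le> t; e = 0 \<or> e = q - p\<rbrakk> \<Longrightarrow>
    c * (ln t powr q * t powr e) \<le> (t - 1) powr (q - 1) * (1 - t powr (1 - p))"
proof -
  define c1 where "c1 = (p - 1) * 2 powr (-p) * 2 powr (- \<bar>q - p\<bar>)"
  \<comment> \<open>\<open>(ln t)\<^bsup>q\<^esup>\<close> is bounded by a multiple of \<open>t\<^bsup>\<epsilon> q\<^esup>\<close>, and \<open>\<epsilon> q + e \<le> q - 1\<close> for both values of \<open>e\<close>\<close>
  define \<epsilon> where "\<epsilon> = min (q - 1) (p - 1) / q"
  have \<epsilon>: "0 < \<epsilon>" using p q by (simp add: \<epsilon>_def)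
  have \<epsilon>_q: "\<epsilon> * q = min (q - 1) (p - 1)" using q by (simp add: \<epsilon>_def)
  define k where "k = 1 - 2 powr (1 - p)"
  have k: "0 < k" using p by (simp add: k_def powr_less_one)
  define c2 where "c2 = k * (1/2) powr (q - 1) * \<epsilon> powr q"
  have c1: "0 < c1" using p by (simp add: c1_def)
  have c2: "0 < c2" using k \<epsilon> by (simp add: c2_def)
  have small: "c1 * (ln t powr q * t powr e) \<le> (t - 1) powr (q - 1) * (1 - t powr (1 - p))"
    if t: "1 \<le> t" "t \<le> 2" and e: "e = 0 \<or> e = q - p" for t e
  proof -
    have "t powr e \<le> 2 powr \<bar>q - p\<bar>"
    proof -
      have "t powr e \<le> t powr \<bar>q - p\<bar>" using t e by (intro powr_mono) auto
      also have "\<dots> \<le> 2 powr \<bar>q - p\<bar>" using t by (intro powr_mono2) auto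
      finally show ?thesis .
    qed
    moreover have "ln t powr q \<le> (t - 1) powr q"
      using t q ln_le_minus_one[of t] by (intro powr_mono2) auto
    ultimately have "c1 * (ln t powr q * t powr e) \<le> c1 * ((t - 1) powr q * 2 powr \<bar>q - p\<bar>)"
      using c1 by (intro mult_left_mono mult_mono) auto
    also have "\<dots> = (p - 1) * 2 powr (-p) * (t - 1) powr q"
      by (simp add: c1_def powr_minus)
    also have "(t - 1) powr q = (t - 1) powr (q - 1) * (t - 1)"
      using t by (cases "t = 1") (auto simp: powr_diff)
    also have "(p - 1) * 2 powr (-p) * ((t - 1) powr (q - 1) * (t - 1)) = (t - 1) powr (q - 1) * ((p - 1) * (t - 1) * 2 powr (-p))"
      by simp
    also have "\<dots> \<le> (t - 1) powr (q - 1) * (1 - t powr (1 - p))"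
    proof (intro mult_left_mono)
      have "(p - 1) * (t - 1) * 2 powr (-p) \<le> (p - 1) * (t - 1) * t powr (-p)"
        using p t by (intro mult_left_mono powr_mono2') auto
      also have "\<dots> \<le> 1 - t powr (1 - p)" using powr_neg_diff_ge[OF p, of 1 t] t by simp
      finally show "(p - 1) * (t - 1) * 2 powr (-p) \<le> 1 - t powr (1 - p)" .
    qed simp
    finally show ?thesis .
  qed
  have large: "c2 * (ln t powr q * t powr e) \<le> (t - 1) powr (q - 1) * (1 - t powr (1 - p))"
    if t: "2 \<le> t" and e: "e = 0 \<or> e = q - p" for t e
  proof -
    have "ln t powr q \<le> (t powr \<epsilon> / \<epsilon>) powr q"
      using t q \<epsilon> ln_powr_bound[of t \<epsilon>] by (intro powr_mono2) auto
    also have "\<dots> = t powr (min (q - 1) (p - 1)) / \<epsilon> powr q"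
      using t \<epsilon> by (simp add: powr_divide powr_powr \<epsilon>_q)
    finally have "\<epsilon> powr q * ln t powr q \<le> t powr (min (q - 1) (p - 1))"
      using \<epsilon> by (simp add: field_simps)
    then have "\<epsilon> powr q * ln t powr q * t powr e \<le> t powr (min (q - 1) (p - 1)) * t powr e"
      by (intro mult_right_mono) auto
    also have "\<dots> = t powr (min (q - 1) (p - 1) + e)" by (simp add: powr_add)
    also have "\<dots> \<le> t powr (q - 1)" using t e by (intro powr_mono) auto
    finally have 1: "\<epsilon> powr q * ln t powr q * t powr e \<le> t powr (q - 1)" .
    have "c2 * (ln t powr q * t powr e) = k * (1/2) powr (q - 1) * (\<epsilon> powr q * ln t powr q * t powr e)"
      by (simp add: c2_def)
    also have "\<dots> \<le> k * (1/2) powr (q - 1) * t powr (q - 1)" using 1 k by (intro mult_left_mono) auto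
    also have "\<dots> = (t / 2) powr (q - 1) * k" using t by (simp add: powr_divide)
    also have "\<dots> \<le> (t - 1) powr (q - 1) * (1 - t powr (1 - p))"
    proof (intro mult_mono)
      show "(t / 2) powr (q - 1) \<le> (t - 1) powr (q - 1)" using t q by (intro powr_mono2) auto
      show "k \<le> 1 - t powr (1 - p)" unfolding k_def using t p by (auto intro!: powr_mono2')
    qed (use k in auto)
    finally show ?thesis .
  qed
  show ?thesis
  proof
    show "0 < min c1 c2" using c1 c2 by simp
    fix t e :: real assume t: "1 \<le> t" and e: "e = 0 \<or> e = q - p"
    have nn: "0 \<le> ln t powr q * t powr e" by simp
    show "min c1 c2 * (ln t powr q * t powr e) \<le> (t - 1) powr (q - 1) * (1 - t powr (1 - p))"
      using small[OF t _ e] large[of t e, OF _ e] mult_right_mono[OF min.cobounded1[of c1 c2] nn]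
        mult_right_mono[OF min.cobounded2[of c1 c2] nn] by (cases "t \<le> 2") linarith+
  qed
qed

text \<open>With \<open>\<delta> = (a - b) / a\<close> and \<open>h = x - y\<close>, the difference of the cutoffs is absorbed if \<open>h \<le> k \<delta> y\<close>; otherwise
  \<open>\<delta> x \<le> 2h / k\<close>, and since \<open>m \<ge> q\<close> and \<open>x \<le> 1\<close> the factor \<open>\<delta>\<^bsup>q - 1\<^esup> x\<^bsup>m - 1\<^esup>\<close> is at most a multiple of
  \<open>h\<^bsup>q - 1\<^esup>\<close>.\<close>

lemma nonlocal_cutoff_absorption:
  fixes p q :: real and m :: nat
  assumes p: "1 < p" and q: "1 < q" and m: "q \<le> m"
  obtains C where "0 < C" "\<And>a b x y. \<lbrakk>0 < b; b \<le> a; 0 \<le> y; y \<le> x; x \<le> 1\<rbrakk> \<Longrightarrow>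
    (a - b) powr (q - 1) * a powr (1 - p) * (x ^ m - y ^ m) \<le>
      (p - 1) / 2 * ((a - b) powr q * a powr (-p)) * y ^ m + C * (x - y) powr q * a powr (q - p)"
proof -
  have m1: "1 \<le> m" using q m by (cases m) auto
  \<comment> \<open>small enough for the absorption, and at most \<open>1\<close> so that \<open>h \<le> k \<delta> y\<close> implies \<open>x \<le> 2y\<close>\<close>
  define k where "k = min 1 ((p - 1) / (2 * m * 2 ^ (m - 1)))"
  have k: "0 < k" "k \<le> 1" using p m1 by (auto simp: k_def)
  have km: "m * 2 ^ (m - 1) * k \<le> (p - 1) / 2"
  proof -
    have "m * 2 ^ (m - 1) * k \<le> m * 2 ^ (m - 1) * ((p - 1) / (2 * m * 2 ^ (m - 1)))"
      by (intro mult_left_mono) (auto simp: k_def)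
    also have "\<dots> = (p - 1) / 2" using m1 by simp
    finally show ?thesis .
  qed
  define C where "C = m * (2 / k) powr (q - 1)"
  show ?thesis
  proof
    show "0 < C" using m1 k by (simp add: C_def)
    fix a b x y :: real
    assume ab: "0 < b" "b \<le> a" and xy: "0 \<le> y" "y \<le> x" "x \<le> 1"
    define h where "h = x - y"
    define d where "d = (a - b) / a"
    have a0: "0 < a" using ab by simp
    have d: "0 \<le> d" "d \<le> 1" using ab by (auto simp: d_def divide_le_eq)
    have h: "0 \<le> h" "h \<le> 1" using xy by (auto simp: h_def)
    have ab_d: "(a - b) powr (q - 1) = d powr (q - 1) * a powr (q - 1)"
      using ab a0 by (simp add: d_def powr_divide)
    have diff: "x ^ m - y ^ m \<le> m * h * x ^ (m - 1)"
      using power_diff_le[OF xy(1,2), of m] by (simp add: h_def)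
    have nnC: "0 \<le> C * (x - y) powr q * a powr (q - p)"
      using \<open>0 < C\<close> by simp
    have nnX: "0 \<le> (p - 1) / 2 * ((a - b) powr q * a powr (-p)) * y ^ m"
      using p xy by simp
    show "(a - b) powr (q - 1) * a powr (1 - p) * (x ^ m - y ^ m) \<le>
      (p - 1) / 2 * ((a - b) powr q * a powr (-p)) * y ^ m + C * (x - y) powr q * a powr (q - p)"
    proof (cases "h \<le> k * d * y")
      case True
      have "k * d * y \<le> 1 * y"
        using k d xy by (intro mult_right_mono) (auto intro: mult_le_one)
      then have "x \<le> 2 * y" using True by (simp add: h_def)
      then have "x ^ (m - 1) \<le> (2 * y) ^ (m - 1)" using xy by (intro power_mono) auto
      then have "m * h * x ^ (m - 1) \<le> m * (k * d * y) * (2 * y) ^ (m - 1)"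
        using True h k d xy by (intro mult_mono) auto
      also have "\<dots> = (m * 2 ^ (m - 1) * k) * (d * y ^ m)"
        using m1 by (cases m) (auto simp: power_mult_distrib algebra_simps)
      also have "\<dots> \<le> (p - 1) / 2 * (d * y ^ m)"
        using km d xy by (intro mult_right_mono) auto
      finally have "x ^ m - y ^ m \<le> (p - 1) / 2 * (d * y ^ m)" using diff by simp
      then have "(a - b) powr (q - 1) * a powr (1 - p) * (x ^ m - y ^ m) \<le>
          (a - b) powr (q - 1) * a powr (1 - p) * ((p - 1) / 2 * (d * y ^ m))"
        by (intro mult_left_mono) auto
      also have "\<dots> = (p - 1) / 2 * (((a - b) powr (q - 1) * (a - b)) * (a powr (1 - p) / a)) * y ^ m"
        by (simp add: d_def)
      also have "(a - b) powr (q - 1) * (a - b) = (a - b) powr q"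
        using ab by (cases "a = b") (auto simp: powr_diff)
      also have "a powr (1 - p) / a = a powr (- p)"
        using a0 by (simp add: powr_diff powr_minus_divide)
      finally show ?thesis using nnC by linarith
    next
      case False
      have "d * k * h \<le> 1 * 1 * h" using d k h by (intro mult_mono) auto
      then have "k * (d * x) \<le> 2 * h" using False by (simp add: h_def algebra_simps)
      then have dx: "d * x \<le> 2 / k * h" using k by (simp add: field_simps)
      have "d powr (q - 1) * x ^ (m - 1) \<le> (d * x) powr (q - 1)"
      proof (cases "x = 0")
        case True
        then have "h = 0" using xy by (simp add: h_def)
        then show ?thesis using False True xy by (simp add: h_def)
      next
        case False
        then have "x ^ (m - 1) = x powr (real m - 1)" using xy m1 by (simp add: powr_realpow[symmetric] of_nat_diff)
        also have "\<dots> \<le> x powr (q - 1)" using xy m False by (intro powr_mono') auto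
        finally show ?thesis using d xy by (simp add: powr_mult mult_left_mono)
      qed
      also have "\<dots> \<le> (2 / k * h) powr (q - 1)" using dx d xy q by (intro powr_mono2) auto
      also have "\<dots> = (2 / k) powr (q - 1) * h powr (q - 1)" using powr_mult[of "2 / k" h "q - 1"] k h by simp
      finally have 1: "d powr (q - 1) * x ^ (m - 1) \<le> (2 / k) powr (q - 1) * h powr (q - 1)" .
      have "d powr (q - 1) * (x ^ m - y ^ m) \<le> d powr (q - 1) * (m * h * x ^ (m - 1))"
        using diff by (intro mult_left_mono) auto
      also have "\<dots> = m * h * (d powr (q - 1) * x ^ (m - 1))" by simp
      also have "\<dots> \<le> m * h * ((2 / k) powr (q - 1) * h powr (q - 1))"
        using 1 h by (intro mult_left_mono) auto
      also have "\<dots> = C * (h powr (q - 1) * h)" by (simp add: C_def)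
      also have "h powr (q - 1) * h = h powr q" using h by (cases "h = 0") (auto simp: powr_diff)
      finally have 2: "d powr (q - 1) * (x ^ m - y ^ m) \<le> C * h powr q" .
      have "(a - b) powr (q - 1) * a powr (1 - p) * (x ^ m - y ^ m) =
         (d powr (q - 1) * (x ^ m - y ^ m)) * (a powr (q - 1) * a powr (1 - p))"
        by (simp add: ab_d)
      also have "\<dots> \<le> C * h powr q * (a powr (q - 1) * a powr (1 - p))"
        using 2 by (intro mult_right_mono) auto
      also have "a powr (q - 1) * a powr (1 - p) = a powr (q - p)" by (simp add: powr_split)
      finally show ?thesis using nnX by (simp add: h_def)
    qed
  qed
qed

lemma J_pos: "0 < t \<Longrightarrow> J q t = t powr (q - 1)"
  by (simp add: J_def powr_diff power2_eq_square powr_minus field_simps)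

lemma J_minus: "J q (- t) = - J q t"
  by (simp add: J_def)

text \<open>The integrand of the nonlocal term for the test function \<open>a\<^bsup>1 - p\<^esup> x\<^bsup>m\<^esup>\<close>, where \<open>x\<close> and \<open>y\<close> are the values of
  the cutoff at the two points. For \<open>a > b\<close> the logarithmic term is controlled with either of the weights
  \<open>a\<^bsup>q - p\<^esup>\<close> and \<open>b\<^bsup>q - p\<^esup>\<close>, so the case \<open>a < b\<close> follows by exchanging the points.\<close>

lemma nonlocal_pointwise_estimate:
  fixes p q :: real and m :: nat
  assumes p: "1 < p" and q: "1 < q" and m: "q \<le> m"
  obtains c C where "0 < c" "0 < C" "\<And>a b x y. \<lbrakk>0 < a; 0 < b; 0 \<le> x; x \<le> 1; 0 \<le> y; y \<le> 1\<rbrakk> \<Longrightarrow>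
    J q (a - b) * (a powr (1 - p) * x ^ m - b powr (1 - p) * y ^ m)
      + c * (\<bar>ln (a / b)\<bar> powr q * b powr (q - p) * min x y ^ m)
      \<le> C * (\<bar>x - y\<bar> powr q * (a powr (q - p) + b powr (q - p)))"
proof -
  obtain c where c: "0 < c" "\<And>t e. \<lbrakk>1 \<le> t; e = 0 \<or> e = q - p\<rbrakk> \<Longrightarrow>
    c * (ln t powr q * t powr e) \<le> (t - 1) powr (q - 1) * (1 - t powr (1 - p))"
    using log_power_le[OF p q] by blast
  obtain C where C: "0 < C" "\<And>a b x y. \<lbrakk>0 < b; b \<le> a; 0 \<le> y; y \<le> x; x \<le> 1\<rbrakk> \<Longrightarrow>
    (a - b) powr (q - 1) * a powr (1 - p) * (x ^ m - y ^ m) \<le>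
      (p - 1) / 2 * ((a - b) powr q * a powr (-p)) * y ^ m + C * (x - y) powr q * a powr (q - p)"
    using nonlocal_cutoff_absorption[OF p q m] by blast
  have main: "J q (a - b) * (a powr (1 - p) * x ^ m - b powr (1 - p) * y ^ m)
      + c / 2 * (\<bar>ln (a / b)\<bar> powr q * f powr (q - p) * min x y ^ m)
      \<le> C * (\<bar>x - y\<bar> powr q * (a powr (q - p) + b powr (q - p)))"
    if ab: "0 < b" "b < a" and xy: "0 \<le> x" "x \<le> 1" "0 \<le> y" "y \<le> 1" and f: "f = a \<or> f = b"
    for a b x y f
  proof -
    have a0: "0 < a" using ab by simp
    define X where "X = (a - b) powr (q - 1) * (b powr (1 - p) - a powr (1 - p))"
    have X0: "0 \<le> X" using powr_mono2'[of "1 - p" b a] ab p by (simp add: X_def)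
    have logX: "c * (\<bar>ln (a / b)\<bar> powr q * f powr (q - p)) \<le> X"
    proof -
      define e where "e = (if f = a then q - p else 0)"
      have fe: "f powr (q - p) = b powr (q - p) * (a / b) powr e"
        using f ab by (auto simp: e_def powr_divide)
      have "c * (ln (a / b) powr q * (a / b) powr e) \<le> (a / b - 1) powr (q - 1) * (1 - (a / b) powr (1 - p))"
        using ab by (intro c(2)) (auto simp: e_def)
      then have "b powr (q - p) * (c * (ln (a / b) powr q * (a / b) powr e)) \<le>
          b powr (q - p) * ((a / b - 1) powr (q - 1) * (1 - (a / b) powr (1 - p)))"
        by (intro mult_left_mono) auto
      also have "\<dots> = (b powr (q - 1) * (a / b - 1) powr (q - 1)) * (b powr (1 - p) * (1 - (a / b) powr (1 - p)))"
        by (simp add: powr_split[symmetric, of b "q - 1" "1 - p"] flip: powr_add)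
      also have "b powr (q - 1) * (a / b - 1) powr (q - 1) = (a - b) powr (q - 1)"
        using ab by (subst powr_mult[symmetric]) (auto simp: right_diff_distrib)
      also have "b powr (1 - p) * (1 - (a / b) powr (1 - p)) = b powr (1 - p) - a powr (1 - p)"
        using ab by (simp add: right_diff_distrib powr_divide)
      finally have "b powr (q - p) * (c * (ln (a / b) powr q * (a / b) powr e)) \<le> X" unfolding X_def .
      moreover have "0 \<le> ln (a / b)" using ab by simp
      ultimately show ?thesis by (simp add: fe mult_ac)
    qed
    have Jab: "J q (a - b) = (a - b) powr (q - 1)" using ab by (simp add: J_pos)
    have T: "J q (a - b) * (a powr (1 - p) * x ^ m - b powr (1 - p) * y ^ m) =
        - X * y ^ m + (a - b) powr (q - 1) * a powr (1 - p) * (x ^ m - y ^ m)"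
      unfolding Jab X_def by (simp add: algebra_simps)
    have "(a - b) powr (q - 1) * a powr (1 - p) * (x ^ m - y ^ m) \<le>
        X / 2 * y ^ m + C * (\<bar>x - y\<bar> powr q * (a powr (q - p) + b powr (q - p)))"
    proof (cases "y \<le> x")
      case True
      have "(p - 1) * ((a - b) powr q * a powr (-p)) \<le> X"
      proof -
        have "(p - 1) * ((a - b) powr q * a powr (-p)) = (a - b) powr (q - 1) * ((p - 1) * (a - b) * a powr (-p))"
          using ab by (simp add: powr_diff)
        also have "\<dots> \<le> X" unfolding X_def
          using ab by (intro mult_left_mono powr_neg_diff_ge[OF p]) auto
        finally show ?thesis .
      qed
      then have "(p - 1) / 2 * ((a - b) powr q * a powr (-p)) * y ^ m \<le> X / 2 * y ^ m"
        using xy by (intro mult_right_mono) auto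
      moreover have "C * (x - y) powr q * a powr (q - p) \<le> C * (\<bar>x - y\<bar> powr q * (a powr (q - p) + b powr (q - p)))"
        using C(1) True by (simp add: distrib_left)
      ultimately show ?thesis using C(2)[of b a y x] True ab xy by linarith
    next
      case False
      then have "x ^ m - y ^ m \<le> 0" using xy power_mono[of x y m] by auto
      then have "(a - b) powr (q - 1) * a powr (1 - p) * (x ^ m - y ^ m) \<le> 0"
        by (intro mult_nonneg_nonpos) auto
      moreover have "0 \<le> X / 2 * y ^ m" "0 \<le> C * (\<bar>x - y\<bar> powr q * (a powr (q - p) + b powr (q - p)))"
        using X0 xy C(1) by auto
      ultimately show ?thesis by linarith
    qed
    moreover have "c / 2 * (\<bar>ln (a / b)\<bar> powr q * f powr (q - p) * min x y ^ m) \<le> X / 2 * y ^ m"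
    proof -
      have "c * (\<bar>ln (a / b)\<bar> powr q * f powr (q - p)) * min x y ^ m \<le> X * y ^ m"
        using logX X0 xy by (intro mult_mono power_mono) auto
      then show ?thesis by simp
    qed
    ultimately show ?thesis unfolding T by simp
  qed
  show ?thesis
  proof
    show "0 < c / 2" "0 < C" using c C by auto
    fix a b x y :: real
    assume ab: "0 < a" "0 < b" and xy: "0 \<le> x" "x \<le> 1" "0 \<le> y" "y \<le> 1"
    consider "b < a" | "a < b" | "a = b" by linarith
    then show "J q (a - b) * (a powr (1 - p) * x ^ m - b powr (1 - p) * y ^ m)
      + c / 2 * (\<bar>ln (a / b)\<bar> powr q * b powr (q - p) * min x y ^ m)
      \<le> C * (\<bar>x - y\<bar> powr q * (a powr (q - p) + b powr (q - p)))"
    proof cases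
      case 1
      show ?thesis by (rule main[OF ab(2) 1 xy]) simp
    next
      case 2
      have "J q (b - a) * (b powr (1 - p) * y ^ m - a powr (1 - p) * x ^ m)
        + c / 2 * (\<bar>ln (b / a)\<bar> powr q * b powr (q - p) * min y x ^ m)
        \<le> C * (\<bar>y - x\<bar> powr q * (b powr (q - p) + a powr (q - p)))"
        using main[OF ab(1) 2 xy(3,4,1,2), of b] by simp
      moreover have "J q (b - a) * (b powr (1 - p) * y ^ m - a powr (1 - p) * x ^ m) =
         J q (a - b) * (a powr (1 - p) * x ^ m - b powr (1 - p) * y ^ m)"
        using J_minus[of q "a - b"] by (simp add: algebra_simps)
      moreover have "\<bar>ln (b / a)\<bar> = \<bar>ln (a / b)\<bar>" using ab by (simp add: ln_div)
      ultimately show ?thesis by (simp add: min.commute abs_minus_commute add.commute)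
    next
      case 3
      then show ?thesis using C(1) ab by (simp add: J_def)
    qed
  qed
qed

text \<open>Here \<open>g\<close>, \<open>z\<close> and \<open>A\<close> stand for \<open>\<nabla>u\<close>, \<open>\<nabla>\<eta>\<close> and \<open>u + d\<close> at a point. With \<open>X = |g| / A\<close>, the mixed term
  \<open>m X\<^bsup>p - 1\<^esup> \<eta>\<^bsup>m - 1\<^esup> Z\<close> is absorbed if \<open>X \<eta>\<close> is at least \<open>2 m Z / (p - 1)\<close>, and is of order \<open>Z\<^bsup>p\<^esup>\<close> otherwise
  because \<open>m \<ge> p\<close>.\<close>

lemma local_pointwise_estimate:
  fixes p :: real and m :: nat
  assumes p: "1 < p" and m: "p \<le> m"
  obtains C where "0 < C" "\<And>(g :: 'a::real_inner) z (\<eta> :: real) A Z. \<lbrakk>0 < A; 0 \<le> \<eta>; \<eta> \<le> 1; norm z \<le> Z\<rbrakk> \<Longrightarrow>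
    norm g powr (p - 2) * (g \<bullet> (((1 - p) * A powr (-p) * \<eta> ^ m) *\<^sub>R g + (A powr (1 - p) * (m * \<eta> ^ (m - 1))) *\<^sub>R z))
      + (p - 1) / 2 * (\<eta> ^ m * (norm g / A) powr p) \<le> C * Z powr p"
proof -
  have m1: "1 \<le> m" using p m by (cases m) auto
  define l where "l = 2 * m / (p - 1)"
  have l: "0 < l" using p m1 by (simp add: l_def)
  define C where "C = m * l powr (p - 1)"
  show ?thesis
  proof
    show "0 < C" using l m1 by (simp add: C_def)
    fix g z :: 'a and \<eta> A Z :: real
    assume A: "0 < A" and \<eta>: "0 \<le> \<eta>" "\<eta> \<le> 1" and z: "norm z \<le> Z"
    define X where "X = norm g / A"
    have X: "0 \<le> X" using A by (simp add: X_def)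
    have Z: "0 \<le> Z" using z norm_ge_zero order_trans by blast
    have gg: "norm g powr (p - 2) * (g \<bullet> g) = norm g powr p"
      by (cases "g = 0") (auto simp: dot_square_norm powr_diff)
    have first: "norm g powr (p - 2) * (g \<bullet> (((1 - p) * A powr (-p) * \<eta> ^ m) *\<^sub>R g)) = - (p - 1) * (\<eta> ^ m * X powr p)"
    proof -
      have "norm g powr (p - 2) * (g \<bullet> (((1 - p) * A powr (-p) * \<eta> ^ m) *\<^sub>R g)) =
          (1 - p) * A powr (-p) * \<eta> ^ m * (norm g powr (p - 2) * (g \<bullet> g))" by simp
      also have "\<dots> = - (p - 1) * (\<eta> ^ m * X powr p)"
        unfolding gg using A by (simp add: X_def powr_divide powr_minus_divide)
      finally show ?thesis .
    qed
    have "norm g powr (p - 2) * (g \<bullet> z) \<le> norm g powr (p - 1) * Z"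
    proof -
      have "norm g powr (p - 2) * (g \<bullet> z) \<le> norm g powr (p - 2) * (norm g * Z)"
        using norm_cauchy_schwarz[of g z] mult_left_mono[OF z norm_ge_zero[of g]] by (intro mult_left_mono) auto
      also have "\<dots> = norm g powr (p - 1) * Z"
        by (cases "g = 0") (auto simp: powr_diff power2_eq_square)
      finally show ?thesis .
    qed
    then have "A powr (1 - p) * (m * \<eta> ^ (m - 1)) * (norm g powr (p - 2) * (g \<bullet> z)) \<le>
        A powr (1 - p) * (m * \<eta> ^ (m - 1)) * (norm g powr (p - 1) * Z)"
      using \<eta> by (intro mult_left_mono) auto
    also have "\<dots> = m * (X powr (p - 1) * \<eta> ^ (m - 1)) * Z"
    proof -
      have "X powr (p - 1) = A powr (1 - p) * norm g powr (p - 1)"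
        using A by (simp add: X_def powr_divide powr_diff field_simps)
      then show ?thesis by simp
    qed
    also have "\<dots> \<le> (p - 1) / 2 * (\<eta> ^ m * X powr p) + C * Z powr p"
    proof (cases "l * Z \<le> X * \<eta>")
      case True
      then have "Z \<le> X * \<eta> / l" using l by (simp add: field_simps)
      then have "m * (X powr (p - 1) * \<eta> ^ (m - 1)) * Z \<le> m * (X powr (p - 1) * \<eta> ^ (m - 1)) * (X * \<eta> / l)"
        using \<eta> by (intro mult_left_mono) auto
      also have "\<dots> = (m / l) * ((X powr (p - 1) * X) * (\<eta> ^ (m - 1) * \<eta>))" by simp
      also have "X powr (p - 1) * X = X powr p" using X by (cases "X = 0") (auto simp: powr_diff)
      also have "\<eta> ^ (m - 1) * \<eta> = \<eta> ^ m" using m1 by (cases m) auto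
      also have "m / l = (p - 1) / 2" using m1 by (simp add: l_def)
      finally have "m * (X powr (p - 1) * \<eta> ^ (m - 1)) * Z \<le> (p - 1) / 2 * (\<eta> ^ m * X powr p)"
        by (simp add: mult.commute)
      moreover have "0 \<le> C * Z powr p" using \<open>0 < C\<close> by simp
      ultimately show ?thesis by linarith
    next
      case False
      have "X powr (p - 1) * \<eta> ^ (m - 1) \<le> (X * \<eta>) powr (p - 1)"
      proof (cases "\<eta> = 0")
        case True
        have "0 < m - 1" using p m by (cases m) auto
        then have "\<eta> ^ (m - 1) = 0" using True by (simp only: zero_power)
        then show ?thesis by (simp only: mult_zero_right) simp
      next
        case False
        then have "\<eta> ^ (m - 1) = \<eta> powr (real m - 1)" using \<eta> m1 by (simp add: powr_realpow[symmetric] of_nat_diff)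
        also have "\<dots> \<le> \<eta> powr (p - 1)" using \<eta> m False by (intro powr_mono') auto
        finally show ?thesis using X \<eta> by (simp add: powr_mult mult_left_mono)
      qed
      also have "\<dots> \<le> (l * Z) powr (p - 1)" using False X \<eta> p by (intro powr_mono2) auto
      also have "\<dots> = l powr (p - 1) * Z powr (p - 1)" using l Z by (simp add: powr_mult)
      finally have "m * (X powr (p - 1) * \<eta> ^ (m - 1)) * Z \<le> m * (l powr (p - 1) * Z powr (p - 1)) * Z"
        using Z by (intro mult_right_mono mult_left_mono) auto
      also have "\<dots> = C * (Z powr (p - 1) * Z)" by (simp add: C_def)
      also have "Z powr (p - 1) * Z = Z powr p" using Z by (cases "Z = 0") (auto simp: powr_diff)
      finally have "m * (X powr (p - 1) * \<eta> ^ (m - 1)) * Z \<le> C * Z powr p" .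
      moreover have "0 \<le> (p - 1) / 2 * (\<eta> ^ m * X powr p)" using p \<eta> by simp
      ultimately show ?thesis by linarith
    qed
    finally have second: "A powr (1 - p) * (m * \<eta> ^ (m - 1)) * (norm g powr (p - 2) * (g \<bullet> z)) \<le>
      (p - 1) / 2 * (\<eta> ^ m * X powr p) + C * Z powr p" .
    have "norm g powr (p - 2) * (g \<bullet> (((1 - p) * A powr (-p) * \<eta> ^ m) *\<^sub>R g + (A powr (1 - p) * (m * \<eta> ^ (m - 1))) *\<^sub>R z)) =
       - (p - 1) * (\<eta> ^ m * X powr p) + A powr (1 - p) * (m * \<eta> ^ (m - 1)) * (norm g powr (p - 2) * (g \<bullet> z))"
      unfolding inner_add_right distrib_left first by (simp add: mult_ac)
    moreover have "- (p - 1) * (\<eta> ^ m * X powr p) = - ((p - 1) / 2 * (\<eta> ^ m * X powr p)) - (p - 1) / 2 * (\<eta> ^ m * X powr p)"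
      by (simp add: field_simps)
    ultimately show "norm g powr (p - 2) * (g \<bullet> (((1 - p) * A powr (-p) * \<eta> ^ m) *\<^sub>R g + (A powr (1 - p) * (m * \<eta> ^ (m - 1))) *\<^sub>R z))
      + (p - 1) / 2 * (\<eta> ^ m * (norm g / A) powr p) \<le> C * Z powr p"
      using second unfolding X_def by linarith
  qed
qed

section \<open>Cutoff functions and integral comparison\<close>

lemma partial_deriv_power:
  assumes "smooth_fun f"
  shows "partial_deriv i (\<lambda>x. f x ^ m) x = m * f x ^ (m - 1) * partial_deriv i f x"
proof (induction m)
  case 0
  show ?case by (simp add: partial_deriv_eq[OF has_derivative_const])
next
  case (Suc m)
  have "partial_deriv i (\<lambda>x. f x * f x ^ m) x = partial_deriv i f x * f x ^ m + f x * partial_deriv i (\<lambda>x. f x ^ m) x"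
    by (rule partial_deriv_mult) (intro smooth_fun_differentiable smooth_fun_power assms)+
  then show ?case unfolding Suc by (cases m) (auto simp: algebra_simps)
qed

text \<open>The cutoff \<open>bump (2 - |x|\<^sup>2 / r\<^sup>2)\<close> is not constant on \<open>B\<^sub>r\<close>; the lower bound \<open>exp (-1)\<close> there suffices.\<close>

lemma cutoff_function:
  fixes r :: real
  assumes r: "0 < r"
  obtains \<eta> :: "real ^ 'n \<Rightarrow> real" where "smooth_fun \<eta>" "\<And>x. 0 \<le> \<eta> x" "\<And>x. \<eta> x \<le> 1"
    "\<And>x. x \<notin> cball 0 (sqrt 2 * r) \<Longrightarrow> \<eta> x = 0" "\<And>x. x \<in> ball 0 r \<Longrightarrow> exp (-1) \<le> \<eta> x"
    "\<And>x y. \<bar>\<eta> x - \<eta> y\<bar> \<le> 6 / r * norm (x - y)" "\<And>x. norm (\<chi> i. partial_deriv i \<eta> x) \<le> 6 / r"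
proof -
  define w :: "real ^ 'n \<Rightarrow> real" where "w x = 2 + (- (1 / r\<^sup>2)) * (norm (x - 0))\<^sup>2" for x
  define \<eta> where "\<eta> x = bump (w x)" for x
  have w: "smooth_fun w" unfolding w_def by (rule smooth_fun_quadratic)
  have w': "w x = 2 - (norm x)\<^sup>2 / r\<^sup>2" for x by (simp add: w_def)
  let ?b = "flat_exp [:0, 0, 1:]"
  have b: "\<bar>?b t\<bar> \<le> 2" for t
    using bump_deriv[of t] flat_exp_deriv[of 1 t] DERIV_unique by fastforce
  have quad: "((\<lambda>x :: real ^ 'n. a + k * (x \<bullet> x)) has_derivative (\<lambda>v. 2 * k * (x \<bullet> v))) (at x)" for a k x
    by (auto intro!: derivative_eq_intros simp: inner_commute)
  have D: "(\<eta> has_derivative (\<lambda>v. ?b (w x) * (- (2 / r\<^sup>2) * (x \<bullet> v)))) (at x)" for x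
  proof -
    have "(w has_derivative (\<lambda>v. - (2 / r\<^sup>2) * (x \<bullet> v))) (at x)"
      using quad[of 2 "- (1 / r\<^sup>2)" x] unfolding w_def power2_norm_eq_inner by simp
    moreover have "(bump has_derivative (*) (?b (w x))) (at (w x))"
      using flat_exp_deriv[of 1 "w x"] by (simp add: has_field_derivative_def)
    ultimately show ?thesis unfolding \<eta>_def by (rule has_derivative_compose)
  qed
  have bx: "\<bar>?b (w x)\<bar> * (2 / r\<^sup>2) * norm x \<le> 6 / r" for x
  proof (cases "0 < w x")
    case True
    then have "(norm x)\<^sup>2 \<le> 2 * r\<^sup>2" using r by (simp add: w' field_simps)
    also have "\<dots> \<le> (3 / 2 * r)\<^sup>2" by (simp add: power_mult_distrib power2_eq_square)
    finally have nx: "norm x \<le> 3 / 2 * r" by (rule power2_le_imp_le) (use r in simp)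
    have "\<bar>?b (w x)\<bar> * (2 / r\<^sup>2) * norm x \<le> 2 * (2 / r\<^sup>2) * (3 / 2 * r)"
      using nx b r by (intro mult_mono) auto
    also have "\<dots> = 6 / r" using r by (simp add: power2_eq_square)
    finally show ?thesis .
  next
    case False
    then show ?thesis using r by (simp add: flat_exp_def)
  qed
  show ?thesis
  proof
    show "smooth_fun \<eta>" unfolding \<eta>_def by (rule smooth_fun_flat_exp[OF w])
    show "0 \<le> \<eta> x" "\<eta> x \<le> 1" for x by (auto simp: \<eta>_def bump_bounds)
    show "\<eta> x = 0" if "x \<notin> cball 0 (sqrt 2 * r)" for x
    proof -
      have "(sqrt 2 * r)\<^sup>2 \<le> (norm x)\<^sup>2" using that r by (intro power_mono) auto
      then have "w x \<le> 0" using r by (simp add: w' power_mult_distrib field_simps)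
      then show ?thesis by (simp add: \<eta>_def bump_pos_iff)
    qed
    show "exp (-1) \<le> \<eta> x" if "x \<in> ball 0 r" for x
    proof -
      have "(norm x)\<^sup>2 \<le> r\<^sup>2" using that r by (intro power_mono) auto
      then have "1 \<le> w x" using r by (simp add: w' field_simps)
      then show ?thesis by (simp add: \<eta>_def bump_simps)
    qed
    show "\<bar>\<eta> x - \<eta> y\<bar> \<le> 6 / r * norm (x - y)" for x y
    proof -
      have "norm (\<eta> x - \<eta> y) \<le> 6 / r * norm (x - y)"
      proof (rule differentiable_bound[where S=UNIV])
        show "(\<eta> has_derivative (\<lambda>v. ?b (w z) * (- (2 / r\<^sup>2) * (z \<bullet> v)))) (at z within UNIV)" for z
          using D by simp
        show "onorm (\<lambda>v. ?b (w z) * (- (2 / r\<^sup>2) * (z \<bullet> v))) \<le> 6 / r" for z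
        proof (rule onorm_le)
          fix v
          have "norm (?b (w z) * (- (2 / r\<^sup>2) * (z \<bullet> v))) = \<bar>?b (w z)\<bar> * (2 / r\<^sup>2) * \<bar>z \<bullet> v\<bar>"
            by (simp add: abs_mult)
          also have "\<dots> \<le> \<bar>?b (w z)\<bar> * (2 / r\<^sup>2) * (norm z * norm v)"
            by (intro mult_left_mono Cauchy_Schwarz_ineq2) auto
          also have "\<dots> \<le> 6 / r * norm v"
            using mult_right_mono[OF bx[of z], of "norm v"] by (simp add: mult.assoc)
          finally show "norm (?b (w z) * (- (2 / r\<^sup>2) * (z \<bullet> v))) \<le> 6 / r * norm v" .
        qed
      qed auto
      then show ?thesis by simp
    qed
    show "norm (\<chi> i. partial_deriv i \<eta> x) \<le> 6 / r" for x
    proof -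
      have "(\<chi> i. partial_deriv i \<eta> x) = (?b (w x) * (- (2 / r\<^sup>2))) *\<^sub>R x"
        by (simp add: vec_eq_iff partial_deriv_eq[OF D] inner_axis)
      then have "norm (\<chi> i. partial_deriv i \<eta> x) = \<bar>?b (w x)\<bar> * (2 / r\<^sup>2) * norm x"
        by (simp add: abs_mult)
      then show ?thesis using bx[of x] by simp
    qed
  qed
qed

lemma nn_integral_lborel_swap:
  fixes f :: "'a::euclidean_space \<times> 'a \<Rightarrow> ennreal"
  assumes [measurable]: "f \<in> borel_measurable borel"
  shows "(\<integral>\<^sup>+z. f (snd z, fst z) \<partial>lborel) = (\<integral>\<^sup>+z. f z \<partial>lborel)"
proof -
  have [measurable]: "(\<lambda>z::'a \<times> 'a. f (snd z, fst z)) \<in> borel_measurable borel"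
    by (rule measurable_compose[OF _ assms]) (intro borel_measurable_continuous_onI continuous_intros)
  have m: "(\<lambda>(x, y). f (x, y)) \<in> borel_measurable ((lborel :: 'a measure) \<Otimes>\<^sub>M lborel)"
    using assms by (simp add: lborel_prod)
  have "(\<integral>\<^sup>+z. f (snd z, fst z) \<partial>lborel) = (\<integral>\<^sup>+x. (\<integral>\<^sup>+y. f (y, x) \<partial>lborel) \<partial>lborel)"
    by (subst nn_integral_lborel_pair) simp_all
  also have "\<dots> = (\<integral>\<^sup>+x. (\<integral>\<^sup>+y. f (x, y) \<partial>lborel) \<partial>lborel)"
    using lborel_pair.Fubini'[OF m] by simp
  also have "\<dots> = (\<integral>\<^sup>+z. f z \<partial>lborel)"
    by (subst nn_integral_lborel_pair) simp_all
  finally show ?thesis .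
qed

text \<open>Positive and negative parts are balanced before any subtraction, so that the bounds
  \<open>B\<^sub>1\<close> and \<open>B\<^sub>2\<close> may have infinite integrals.\<close>

lemma nn_integral_le_of_integral_nonneg:
  fixes f1 :: "'a \<Rightarrow> real" and f2 :: "'b \<Rightarrow> real"
  assumes f1: "integrable M1 f1" and f2: "integrable M2 f2"
    and nn: "0 \<le> (\<integral>x. f1 x \<partial>M1) + (\<integral>x. f2 x \<partial>M2)"
    and [measurable]: "A1 \<in> borel_measurable M1" "B1 \<in> borel_measurable M1"
      "A2 \<in> borel_measurable M2" "B2 \<in> borel_measurable M2"
    and le1: "\<And>x. 0 \<le> A1 x \<and> 0 \<le> B1 x \<and> f1 x + A1 x \<le> B1 x"
    and le2: "\<And>x. 0 \<le> A2 x \<and> 0 \<le> B2 x \<and> f2 x + A2 x \<le> B2 x"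
  shows "(\<integral>\<^sup>+x. ennreal (A1 x) \<partial>M1) + (\<integral>\<^sup>+x. ennreal (A2 x) \<partial>M2) \<le>
    (\<integral>\<^sup>+x. ennreal (B1 x) \<partial>M1) + (\<integral>\<^sup>+x. ennreal (B2 x) \<partial>M2)"
proof -
  have split: "(\<integral>\<^sup>+x. ennreal (A x) \<partial>M) + (\<integral>\<^sup>+x. ennreal (f x) \<partial>M) \<le>
      (\<integral>\<^sup>+x. ennreal (B x) \<partial>M) + (\<integral>\<^sup>+x. ennreal (- f x) \<partial>M)"
    if [measurable]: "f \<in> borel_measurable M" "A \<in> borel_measurable M" "B \<in> borel_measurable M"
      and le: "\<And>x. 0 \<le> A x \<and> 0 \<le> B x \<and> f x + A x \<le> B x" for M :: "'c measure" and f A B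
  proof -
    have "ennreal (A x) + ennreal (f x) \<le> ennreal (B x) + ennreal (- f x)" for x
    proof (cases "0 \<le> f x")
      case True
      then show ?thesis using le[of x] by (simp add: ennreal_neg flip: ennreal_plus)
    next
      case False
      then have "ennreal (A x) \<le> ennreal (B x + (- f x))" using le[of x] by (intro ennreal_leI) linarith
      also have "\<dots> = ennreal (B x) + ennreal (- f x)" using False le[of x] by (intro ennreal_plus) auto
      finally show ?thesis using False by (simp add: ennreal_neg)
    qed
    then have "(\<integral>\<^sup>+x. ennreal (A x) + ennreal (f x) \<partial>M) \<le> (\<integral>\<^sup>+x. ennreal (B x) + ennreal (- f x) \<partial>M)"
      by (intro nn_integral_mono)
    then show ?thesis by (simp add: nn_integral_add)
  qed
  define P1 N1 P2 N2 where "P1 = (\<integral>\<^sup>+x. ennreal (f1 x) \<partial>M1)" and "N1 = (\<integral>\<^sup>+x. ennreal (- f1 x) \<partial>M1)"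
    and "P2 = (\<integral>\<^sup>+x. ennreal (f2 x) \<partial>M2)" and "N2 = (\<integral>\<^sup>+x. ennreal (- f2 x) \<partial>M2)"
  have fin: "P1 < \<infinity>" "N1 < \<infinity>" "P2 < \<infinity>" "N2 < \<infinity>"
    using f1 f2 unfolding real_integrable_def P1_def N1_def P2_def N2_def by (auto simp: less_top)
  have "enn2real N1 + enn2real N2 \<le> enn2real P1 + enn2real P2"
    using nn unfolding real_lebesgue_integral_def[OF f1] real_lebesgue_integral_def[OF f2]
      P1_def N1_def P2_def N2_def by linarith
  then have "ennreal (enn2real N1 + enn2real N2) \<le> ennreal (enn2real P1 + enn2real P2)" by (rule ennreal_leI)
  then have NP: "N1 + N2 \<le> P1 + P2" using fin by (simp add: ennreal_enn2real)
  have "((\<integral>\<^sup>+x. ennreal (A1 x) \<partial>M1) + (\<integral>\<^sup>+x. ennreal (A2 x) \<partial>M2)) + (P1 + P2) \<le>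
      ((\<integral>\<^sup>+x. ennreal (B1 x) \<partial>M1) + (\<integral>\<^sup>+x. ennreal (B2 x) \<partial>M2)) + (N1 + N2)"
  proof -
    have "((\<integral>\<^sup>+x. ennreal (A1 x) \<partial>M1) + P1) + ((\<integral>\<^sup>+x. ennreal (A2 x) \<partial>M2) + P2) \<le>
      ((\<integral>\<^sup>+x. ennreal (B1 x) \<partial>M1) + N1) + ((\<integral>\<^sup>+x. ennreal (B2 x) \<partial>M2) + N2)"
      unfolding P1_def N1_def P2_def N2_def
      using f1 f2 le1 le2 by (intro add_mono split) auto
    then show ?thesis by (simp add: ac_simps)
  qed
  also have "\<dots> \<le> ((\<integral>\<^sup>+x. ennreal (B1 x) \<partial>M1) + (\<integral>\<^sup>+x. ennreal (B2 x) \<partial>M2)) + (P1 + P2)"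
    by (intro add_left_mono NP)
  finally have "(P1 + P2) + ((\<integral>\<^sup>+x. ennreal (A1 x) \<partial>M1) + (\<integral>\<^sup>+x. ennreal (A2 x) \<partial>M2)) \<le>
      (P1 + P2) + ((\<integral>\<^sup>+x. ennreal (B1 x) \<partial>M1) + (\<integral>\<^sup>+x. ennreal (B2 x) \<partial>M2))"
    by (simp only: add.commute[of "P1 + P2"])
  moreover have "P1 + P2 < \<infinity>" using fin by simp
  ultimately show ?thesis
    by (subst (asm) ennreal_add_left_cancel_le) auto
qed

lemma bounded_support_in_Lp:
  fixes f :: "real ^ 'n \<Rightarrow> 'b::euclidean_space"
  assumes [measurable]: "f \<in> borel_measurable borel" and p: "0 \<le> p"
    and M: "\<And>x. norm (f x) \<le> M" and S: "bounded S" "\<And>x. x \<notin> S \<Longrightarrow> f x = 0"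
  shows "f \<in> Lp p UNIV"
proof -
  obtain R where "\<forall>x\<in>S. norm x \<le> R" using S(1) bounded_iff by blast
  then have R: "S \<subseteq> cball 0 R" by auto
  have "(\<integral>\<^sup>+x. ennreal (norm (f x) powr p) \<partial>lebesgue_on UNIV) = (\<integral>\<^sup>+x. ennreal (norm (f x) powr p) \<partial>lborel)"
    by (simp add: lebesgue_on_UNIV_eq nn_integral_completion)
  also have "\<dots> \<le> (\<integral>\<^sup>+x. ennreal (M powr p) * indicator (cball (0 :: real ^ 'n) R) x \<partial>lborel)"
  proof (rule nn_integral_mono)
    fix x :: "real ^ 'n"
    show "ennreal (norm (f x) powr p) \<le> ennreal (M powr p) * indicator (cball 0 R) x"
    proof (cases "x \<in> S")
      case True
      then show ?thesis using M[of x] R p by (auto simp: subset_iff intro!: ennreal_leI powr_mono2)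
    qed (simp add: S)
  qed
  also have "\<dots> < \<infinity>"
    using emeasure_bounded_finite[OF bounded_cball, of "0 :: real ^ 'n" R]
    by (simp add: nn_integral_cmult_indicator ennreal_mult_less_top)
  finally show ?thesis
    using measurable_lebesgue_on_AE[of UNIV f f] by (simp add: Lp_def)
qed

lemma powr_add_le:
  fixes x y p :: real
  assumes "0 \<le> x" "0 \<le> y" "0 \<le> p"
  shows "(x + y) powr p \<le> 2 powr p * (x powr p + y powr p)"
proof -
  have "(x + y) powr p \<le> (2 * max x y) powr p" using assms by (intro powr_mono2) auto
  also have "\<dots> = 2 powr p * max x y powr p" using assms by (simp add: powr_mult)
  also have "\<dots> \<le> 2 powr p * (x powr p + y powr p)"
    by (intro mult_left_mono) (auto simp: max_def)
  finally show ?thesis .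
qed

lemma powr_mult_le_add:
  fixes x y q :: real
  assumes "0 \<le> x" "0 \<le> y" "1 < q"
  shows "x powr (q - 1) * y \<le> x powr q + y powr q"
proof (cases "y \<le> x")
  case True
  then have "x powr (q - 1) * y \<le> x powr (q - 1) * x" using assms by (intro mult_left_mono) auto
  also have "\<dots> = x powr q" using assms by (cases "x = 0") (auto simp: powr_diff)
  finally show ?thesis by (simp add: add_increasing2)
next
  case False
  then have "x powr (q - 1) * y \<le> y powr (q - 1) * y" using assms by (intro mult_right_mono powr_mono2) auto
  also have "\<dots> = y powr q" using assms by (cases "y = 0") (auto simp: powr_diff)
  finally show ?thesis by (simp add: add_increasing)
qed

lemma abs_J: "\<bar>J q t\<bar> = \<bar>t\<bar> powr (q - 1)"
  by (cases "t = 0") (auto simp: J_def abs_mult powr_diff power2_eq_square)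

section \<open>The logarithmic test function\<close>

lemma measurable_fst_borel[measurable]: "fst \<in> borel_measurable (borel :: ('a::euclidean_space \<times> 'b::euclidean_space) measure)"
  by (intro borel_measurable_continuous_onI continuous_intros)

lemma measurable_snd_borel[measurable]: "snd \<in> borel_measurable (borel :: ('a::euclidean_space \<times> 'b::euclidean_space) measure)"
  by (intro borel_measurable_continuous_onI continuous_intros)

lemma integrable_lborel_swap:
  fixes f :: "'a::euclidean_space \<times> 'a \<Rightarrow> real"
  assumes f: "integrable lborel f"
  shows "integrable lborel (\<lambda>z. f (snd z, fst z))"
proof -
  have [measurable]: "f \<in> borel_measurable borel" using borel_measurable_integrable[OF f] by simp
  have sw: "(\<lambda>z::'a \<times> 'a. (snd z, fst z)) \<in> measurable borel borel"
    by (intro borel_measurable_continuous_onI continuous_intros)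
  have [measurable]: "(\<lambda>z. f (snd z, fst z)) \<in> borel_measurable borel"
    by (rule measurable_compose[OF sw]) measurable
  have "(\<integral>\<^sup>+z. ennreal (norm (f (snd z, fst z))) \<partial>lborel) = (\<integral>\<^sup>+z. ennreal (norm (f z)) \<partial>lborel)"
    by (rule nn_integral_lborel_swap) measurable
  then show ?thesis using f unfolding integrable_iff_bounded by auto
qed

lemma nn_integral_lborel_times:
  fixes a b :: "'a::euclidean_space \<Rightarrow> ennreal"
  assumes [measurable]: "a \<in> borel_measurable borel" "b \<in> borel_measurable borel"
  shows "(\<integral>\<^sup>+z. a (fst z) * b (snd z) \<partial>lborel) = (\<integral>\<^sup>+x. a x \<partial>lborel) * (\<integral>\<^sup>+x. b x \<partial>lborel)"
proof -
  have "(\<integral>\<^sup>+z. a (fst z) * b (snd z) \<partial>lborel) = (\<integral>\<^sup>+x. (\<integral>\<^sup>+y. a x * b y \<partial>lborel) \<partial>lborel)"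
    by (subst nn_integral_lborel_pair) simp_all
  then show ?thesis by (simp add: nn_integral_cmult nn_integral_multc)
qed

text \<open>The Gagliardo energy written with a representative and without the product pattern.\<close>

lemma gagliardo_pow_eq:
  fixes f F :: "real ^ 'n \<Rightarrow> real"
  assumes E: "E \<in> sets borel" and AE: "AE x in lborel. f x = F x"
  shows "gagliardo_pow s q E f = (\<integral>\<^sup>+z. ennreal (\<bar>F (fst z) - F (snd z)\<bar> powr q /
      norm (fst z - snd z) powr (real CARD('n) + s * q)) * indicator (E \<times> E) z \<partial>lborel)"
  unfolding gagliardo_pow_def
proof (rule nn_integral_lebesgue_on_eq)
  have "E \<times> E \<in> sets ((borel :: (real ^ 'n) measure) \<Otimes>\<^sub>M borel)" using E by auto
  then have "E \<times> E \<in> sets borel" by (simp only: borel_prod)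
  then show "E \<times> E \<in> sets lebesgue" by (auto intro: sets_completionI_sets)
  show "AE z in lborel. z \<in> E \<times> E \<longrightarrow> (case z of (x, y) \<Rightarrow> ennreal (\<bar>f x - f y\<bar> powr q / norm (x - y) powr (real CARD('n) + s * q))) =
      ennreal (\<bar>F (fst z) - F (snd z)\<bar> powr q / norm (fst z - snd z) powr (real CARD('n) + s * q))"
    using AE_lborel_pair[OF AE] by eventually_elim (simp add: case_prod_beta)
qed

lemma nn_integral_kernel_translate_le:
  fixes x :: "'a::euclidean_space" and h :: "real \<Rightarrow> real"
  assumes [measurable]: "h \<in> borel_measurable borel" "S \<in> sets borel" "T \<in> sets borel"
    and "\<And>y. y \<in> S \<Longrightarrow> y - x \<in> T"
  shows "(\<integral>\<^sup>+y. ennreal (h (norm (x - y))) * indicator S y \<partial>lborel) \<le> (\<integral>\<^sup>+z. ennreal (h (norm z)) * indicator T z \<partial>lborel)"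
proof -
  have "(\<integral>\<^sup>+y. ennreal (h (norm (x - y))) * indicator S y \<partial>lborel) \<le>
      (\<integral>\<^sup>+y. ennreal (h (norm (y + - x))) * indicator T (y + - x) \<partial>lborel)"
    using assms(4) by (intro nn_integral_mono) (auto simp: indicator_def norm_minus_commute)
  also have "\<dots> = (\<integral>\<^sup>+z. ennreal (h (norm z)) * indicator T z \<partial>lborel)"
    by (rule nn_integral_lborel_translate[of "\<lambda>z. ennreal (h (norm z)) * indicator T z" "- x"]) measurable
  finally show ?thesis .
qed

text \<open>The data of the argument: \<open>u\<close> with its Borel representative \<open>U \<ge> 0\<close> and gradient \<open>G\<close>, a set \<open>E\<close> on which \<open>u\<close> has
  finite Gagliardo energy, and a cutoff \<open>\<eta>\<close>. The supersolution property is not part of it.\<close>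

locale log_test =
  fixes s p q d r :: real and \<Omega> E :: "(real ^ 'n) set" and u U :: "real ^ 'n \<Rightarrow> real"
    and G :: "real ^ 'n \<Rightarrow> real ^ 'n" and \<eta> :: "real ^ 'n \<Rightarrow> real" and m :: nat
  assumes p: "1 < p" "p < real CARD('n)" and s: "0 < s" "s < 1"
    and q: "1 < q" "s * q < real CARD('n)" and pm: "p \<le> real m" and qm: "q \<le> real m"
    and d: "0 < d" and r: "0 < r" and \<Omega>: "open \<Omega>" and ball_\<Omega>: "ball 0 (2 * r) \<subseteq> \<Omega>"
    and \<Omega>_E: "\<Omega> \<subseteq> E" and E_compact: "compact (- E)" and E_finite: "gagliardo_pow s q E u < \<infinity>"
    and u_loc: "u \<in> Lp_loc (q - 1) UNIV" and u_D1p: "u \<in> D1p p \<Omega>"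
    and U_meas: "U \<in> borel_measurable borel" and U_nonneg: "\<And>x. 0 \<le> U x" and u_U: "AE x in lborel. u x = U x"
    and U_grad: "borel_weak_grad \<Omega> U G"
    and \<eta>_smooth: "smooth_fun \<eta>" and \<eta>_nonneg: "\<And>x. 0 \<le> \<eta> x" and \<eta>_le_1: "\<And>x. \<eta> x \<le> 1"
    and \<eta>_outside: "\<And>x. x \<notin> cball 0 (sqrt 2 * r) \<Longrightarrow> \<eta> x = 0"
    and \<eta>_inside: "\<And>x. x \<in> ball 0 r \<Longrightarrow> exp (-1) \<le> \<eta> x"
    and \<eta>_Lipschitz: "\<And>x y. \<bar>\<eta> x - \<eta> y\<bar> \<le> 6 / r * norm (x - y)"
    and \<eta>_grad: "\<And>x. norm (\<chi> i. partial_deriv i \<eta> x) \<le> 6 / r"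
begin

text \<open>The shifted representative \<open>U + d\<close>, bounded below by \<open>d > 0\<close>.\<close>

definition A :: "real ^ 'n \<Rightarrow> real" where "A x = U x + d"

text \<open>The test function; all powers of \<open>A\<close> have a base bounded below by \<open>d\<close>.\<close>

definition \<phi> :: "real ^ 'n \<Rightarrow> real" where "\<phi> x = A x powr (1 - p) * \<eta> x ^ m"

text \<open>The gradient of \<open>\<phi>\<close> given by the chain and product rules.\<close>

definition grad_\<phi> :: "real ^ 'n \<Rightarrow> real ^ 'n" where
  "grad_\<phi> x = ((1 - p) * A x powr (- p) * \<eta> x ^ m) *\<^sub>R G x +
     (A x powr (1 - p) * (m * \<eta> x ^ (m - 1))) *\<^sub>R (\<chi> i. partial_deriv i \<eta> x)"

text \<open>\<open>B'\<close> contains the support of the test function and has distance \<open>r/2\<close> from the complement of \<open>B\<close>;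
  \<open>M\<close> bounds \<open>t\<^bsup>1 - p\<^esup>\<close> on \<open>t \<ge> d\<close>, and \<open>L\<close> is a Lipschitz constant for it.\<close>

abbreviation "B \<equiv> ball (0 :: real ^ 'n) (2 * r)"
abbreviation "B' \<equiv> ball (0 :: real ^ 'n) (3 * r / 2)"
abbreviation "M \<equiv> d powr (1 - p)"
abbreviation "L \<equiv> (p - 1) * d powr (- p)"

lemma m2: "2 \<le> m" using p pm by linarith

lemma \<eta>_meas[measurable]: "\<eta> \<in> borel_measurable borel"
  by (intro borel_measurable_continuous_onI smooth_fun_continuous \<eta>_smooth)

lemma partial_\<eta>_meas[measurable]: "partial_deriv i \<eta> \<in> borel_measurable borel"
  by (intro borel_measurable_continuous_onI smooth_fun_continuous smooth_fun_partial_deriv \<eta>_smooth)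

lemma UG_meas[measurable]: "U \<in> borel_measurable borel" "G \<in> borel_measurable borel"
  using U_meas U_grad by (auto simp: borel_weak_grad_def loc_integrable_measurable)

lemma A_meas[measurable]: "A \<in> borel_measurable borel" unfolding A_def by measurable

lemma \<phi>_meas[measurable]: "\<phi> \<in> borel_measurable borel" unfolding \<phi>_def by measurable

lemma grad_\<phi>_meas[measurable]: "grad_\<phi> \<in> borel_measurable borel" unfolding grad_\<phi>_def by measurable

lemma E_open: "open E" using compact_imp_closed[OF E_compact] by (simp add: closed_def)

lemma E_meas[measurable]: "E \<in> sets borel" using E_open by simp

lemma A_ge: "d \<le> A x" using U_nonneg by (simp add: A_def)

lemma A_pos: "0 < A x" using A_ge[of x] d by linarith

lemma sqrt2: "sqrt 2 * r < 3 * r / 2"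
proof -
  have "sqrt 2 < 3 / 2" by (rule real_less_lsqrt) (auto simp: power2_eq_square)
  then show ?thesis using r by (simp add: field_simps)
qed

lemma \<eta>_0: "x \<notin> B' \<Longrightarrow> \<eta> x = 0"
  using \<eta>_outside[of x] sqrt2 by auto

lemma B'_B: "B' \<subseteq> B" using r by auto

lemma balls_meas[measurable]: "B \<in> sets borel" "B' \<in> sets borel" by simp_all

lemma \<eta>_power_0:
  assumes "x \<notin> B'"
  shows "\<eta> x ^ m = 0" "\<eta> x ^ (m - 1) = 0"
  unfolding \<eta>_0[OF assms] using m2 by (simp_all add: zero_power)

lemma \<phi>_0:
  assumes "x \<notin> B'"
  shows "\<phi> x = 0"
  unfolding \<phi>_def \<eta>_power_0[OF assms] by simp

lemma grad_\<phi>_0: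
  assumes "x \<notin> B'"
  shows "grad_\<phi> x = 0"
  unfolding grad_\<phi>_def \<eta>_power_0[OF assms] by simp

lemma \<eta>_power: "0 \<le> \<eta> x ^ k" "\<eta> x ^ k \<le> 1"
  using \<eta>_nonneg \<eta>_le_1 by (auto simp: power_le_one)

lemma A_powr_le: "A x powr (1 - p) \<le> M"
  using A_ge d p by (intro powr_mono2') auto

lemma \<phi>_bounds: "0 \<le> \<phi> x" "\<phi> x \<le> M"
proof -
  show "0 \<le> \<phi> x" using \<eta>_power by (simp add: \<phi>_def)
  have "\<phi> x \<le> M * 1" unfolding \<phi>_def using A_powr_le \<eta>_power by (intro mult_mono) auto
  then show "\<phi> x \<le> M" by simp
qed

lemma F_deriv: "0 \<le> t \<Longrightarrow> ((\<lambda>t. (t + d) powr (1 - p)) has_real_derivative (1 - p) * (t + d) powr (- p)) (at t)"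
  using d by (auto intro!: derivative_eq_intros)

lemma F'_le: "0 \<le> t \<Longrightarrow> \<bar>(1 - p) * (t + d) powr (- p)\<bar> \<le> L"
  using d p by (simp add: abs_mult) (intro mult_left_mono powr_mono2'; simp)

lemma F_Lipschitz: "\<bar>A x powr (1 - p) - A y powr (1 - p)\<bar> \<le> L * \<bar>U x - U y\<bar>"
  using field_differentiable_bound[of "{0..}" "\<lambda>t. (t + d) powr (1 - p)" "\<lambda>t. (1 - p) * (t + d) powr (- p)" L "U x" "U y"]
    F_deriv F'_le U_nonneg unfolding A_def by (auto intro: has_field_derivative_at_within)

lemma \<eta>m_test: "(\<lambda>x. \<eta> x ^ m) \<in> test_functions \<Omega>"
proof (rule test_functionsI[OF smooth_fun_power[OF \<eta>_smooth]])
  show "cball 0 (sqrt 2 * r) \<subseteq> \<Omega>" 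
    using sqrt2 r by (intro order_trans[OF _ ball_\<Omega>] subsetI)
      (unfold mem_cball_0 mem_ball_0, linarith)
  show "\<eta> x ^ m = 0" if "x \<notin> cball 0 (sqrt 2 * r)" for x using \<eta>_outside[OF that] m2 by simp
qed simp

lemma \<phi>_grad: "borel_weak_grad UNIV \<phi> grad_\<phi>"
proof -
  have "borel_weak_grad \<Omega> (\<lambda>x. (U x + d) powr (1 - p)) (\<lambda>x. ((1 - p) * (U x + d) powr (- p)) *\<^sub>R G x)"
  proof (rule borel_weak_grad_chain[OF \<Omega> U_grad U_nonneg F_deriv _ F'_le])
    show "continuous_on {0..} (\<lambda>t. (1 - p) * (t + d) powr (- p))"
      using d by (intro continuous_intros) auto
  qed
  from borel_weak_grad_mult_test[OF this \<eta>m_test]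
  have "borel_weak_grad UNIV (\<lambda>x. (U x + d) powr (1 - p) * \<eta> x ^ m)
    (\<lambda>x. \<eta> x ^ m *\<^sub>R ((1 - p) * (U x + d) powr (- p)) *\<^sub>R G x +
       (U x + d) powr (1 - p) *\<^sub>R (\<chi> i. partial_deriv i (\<lambda>x. \<eta> x ^ m) x))" .
  moreover have "\<eta> x ^ m *\<^sub>R ((1 - p) * (U x + d) powr (- p)) *\<^sub>R G x +
       (U x + d) powr (1 - p) *\<^sub>R (\<chi> i. partial_deriv i (\<lambda>x. \<eta> x ^ m) x) = grad_\<phi> x" for x
    by (simp add: grad_\<phi>_def A_def partial_deriv_power[OF \<eta>_smooth] vec_eq_iff)
  ultimately show ?thesis by (simp add: \<phi>_def[abs_def] A_def)
qed

lemma weak_grad_u: "AE x in lborel. x \<in> \<Omega> \<longrightarrow> weak_grad \<Omega> u x = G x"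
proof (rule weak_grad_eq_borel_weak_grad[OF \<Omega> _ U_grad])
  show "AE x in lborel. x \<in> \<Omega> \<longrightarrow> u x = U x" using u_U by eventually_elim simp
qed

lemma weak_grad_\<phi>: "weakly_differentiable UNIV \<phi>" "AE x in lborel. weak_grad UNIV \<phi> x = grad_\<phi> x"
  using weak_grad_eq_borel_weak_grad[OF open_UNIV _ \<phi>_grad, of \<phi>] by auto

lemma G_p_finite: "(\<integral>\<^sup>+x. ennreal (norm (G x) powr p) * indicator B x \<partial>lborel) < \<infinity>"
proof -
  have \<Omega>l: "\<Omega> \<in> sets lebesgue" using \<Omega> by (auto intro: sets_completionI_sets)
  have "(\<integral>\<^sup>+x. ennreal (norm (G x) powr p) * indicator B x \<partial>lborel) \<le> (\<integral>\<^sup>+x. ennreal (norm (G x) powr p) * indicator \<Omega> x \<partial>lborel)"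
    using ball_\<Omega> by (intro nn_integral_mono) (auto simp: indicator_def)
  also have "\<dots> = (\<integral>\<^sup>+x. ennreal (norm (weak_grad \<Omega> u x) powr p) \<partial>lebesgue_on \<Omega>)"
    by (rule nn_integral_lebesgue_on_eq[OF \<Omega>l, symmetric]) (use weak_grad_u in eventually_elim, simp)
  also have "\<dots> < \<infinity>" using u_D1p by (simp add: D1p_def Lp_def)
  finally show ?thesis .
qed

lemma integrable_G_p: "integrable lborel (\<lambda>x. indicator B x * norm (G x) powr p)"
proof (rule integrableI_bounded)
  have "(\<integral>\<^sup>+x. ennreal (norm (indicator B x * norm (G x) powr p)) \<partial>lborel) =
      (\<integral>\<^sup>+x. ennreal (norm (G x) powr p) * indicator B x \<partial>lborel)"
    by (intro nn_integral_cong) (simp add: indicator_def)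
  then show "(\<integral>\<^sup>+x. ennreal (norm (indicator B x * norm (G x) powr p)) \<partial>lborel) < \<infinity>"
    using G_p_finite by simp
qed measurable

lemma integrable_indicator_bounded:
  "S \<in> sets borel \<Longrightarrow> bounded S \<Longrightarrow> integrable lborel (indicator S :: 'a::euclidean_space \<Rightarrow> real)"
  using emeasure_bounded_finite[of S] by (intro integrable_real_indicator) auto

lemma integrable_grad_\<phi>_p: "integrable lborel (\<lambda>x. norm (grad_\<phi> x) powr p)"
proof (rule Bochner_Integration.integrable_bound)
  let ?c = "M * (m * (6 / r))"
  show "integrable lborel (\<lambda>x. 2 powr p * (L powr p * (indicator B x * norm (G x) powr p) + ?c powr p * indicator B x))"
    by (intro integrable_mult_right Bochner_Integration.integrable_add integrable_G_p integrable_indicator_bounded) auto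
  have "norm (grad_\<phi> x) powr p \<le> 2 powr p * (L powr p * (indicator B x * norm (G x) powr p) + ?c powr p * indicator B x)" for x
  proof (cases "x \<in> B")
    case True
    have "norm (((1 - p) * A x powr (- p) * \<eta> x ^ m) *\<^sub>R G x) \<le> L * norm (G x)"
    proof -
      have "\<bar>(1 - p) * A x powr (- p)\<bar> * \<eta> x ^ m \<le> L * 1"
        using F'_le[OF U_nonneg[of x]] \<eta>_power p unfolding A_def by (intro mult_mono) auto
      then show ?thesis using \<eta>_power(1)[of x m] by (simp add: abs_mult mult_right_mono)
    qed
    moreover have "norm ((A x powr (1 - p) * (m * \<eta> x ^ (m - 1))) *\<^sub>R (\<chi> i. partial_deriv i \<eta> x)) \<le> ?c"
    proof -
      have "\<bar>A x powr (1 - p) * (m * \<eta> x ^ (m - 1))\<bar> * norm (\<chi> i. partial_deriv i \<eta> x) \<le> (M * (m * 1)) * (6 / r)"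
        unfolding abs_mult using A_powr_le[of x] \<eta>_power[of x "m - 1"] \<eta>_grad[of x]
        by (intro mult_mono) (auto simp: mult_left_le)
      then show ?thesis by (simp add: mult_ac)
    qed
    ultimately have "norm (grad_\<phi> x) \<le> L * norm (G x) + ?c"
      unfolding grad_\<phi>_def by (rule norm_triangle_mono)
    then have "norm (grad_\<phi> x) powr p \<le> (L * norm (G x) + ?c) powr p"
      using p by (intro powr_mono2) auto
    also have "\<dots> \<le> 2 powr p * ((L * norm (G x)) powr p + ?c powr p)"
      using p r d by (intro powr_add_le) auto
    finally show ?thesis using True p by (simp add: powr_mult)
  next
    case False
    then have "x \<notin> B'" using B'_B by blast
    then show ?thesis using grad_\<phi>_0 p by simp
  qed
  then show "AE x in lborel. norm (norm (grad_\<phi> x) powr p) \<le>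
      norm (2 powr p * (L powr p * (indicator B x * norm (G x) powr p) + ?c powr p * indicator B x))"
    by (intro AE_I2) (auto intro: order_trans[OF _ abs_ge_self])
qed measurable

lemma \<phi>_D01p: "\<phi> \<in> D01p p \<Omega>"
proof -
  have "\<phi> \<in> Lp (p * real CARD('n) / (real CARD('n) - p)) UNIV"
    by (rule bounded_support_in_Lp[of _ _ M B']) (use p \<phi>_bounds \<phi>_0 in auto)
  moreover have "weak_grad UNIV \<phi> \<in> Lp p UNIV"
  proof -
    have AE: "AE x in lborel. x \<in> UNIV \<longrightarrow> weak_grad UNIV \<phi> x = grad_\<phi> x" using weak_grad_\<phi>(2) by simp
    have "(\<integral>\<^sup>+x. ennreal (norm (weak_grad UNIV \<phi> x) powr p) \<partial>lebesgue_on UNIV) =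
        (\<integral>\<^sup>+x. ennreal (norm (grad_\<phi> x) powr p) * indicator UNIV x \<partial>lborel)"
      by (rule nn_integral_lebesgue_on_eq) (use weak_grad_\<phi>(2) in \<open>auto elim: eventually_mono\<close>)
    also have "\<dots> < \<infinity>" using integrable_grad_\<phi>_p unfolding integrable_iff_bounded by simp
    finally show ?thesis
      using measurable_lebesgue_on_AE[OF _ grad_\<phi>_meas AE] by (simp add: Lp_def)
  qed
  moreover have "x \<notin> \<Omega> \<longrightarrow> \<phi> x = 0" for x using \<phi>_0[of x] B'_B ball_\<Omega> by blast
  ultimately show ?thesis using weak_grad_\<phi>(1) by (simp add: D01p_def D1p_def)
qed

end

section \<open>Integrability of the nonlocal energy\<close>

text \<open>The power \<open>|x - y|\<^bsup>q\<^esup>\<close> gained from a Lipschitz function leaves the integrable kernel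
  \<open>|x - y|\<^bsup>q(1 - s) - N\<^esup>\<close>.\<close>

lemma near_kernel_bound:
  fixes s q :: real
  assumes s: "s < 1" and q: "0 < q"
  obtains C where "0 < C" "\<And>x \<rho>. 0 < \<rho> \<Longrightarrow> x \<in> ball 0 (2 * \<rho>) \<Longrightarrow>
    (\<integral>\<^sup>+y. ennreal (norm (x - y) powr (q - (real CARD('n) + s * q))) * indicator (ball (0 :: real ^ 'n) (2 * \<rho>)) y \<partial>lborel)
      \<le> ennreal (C * \<rho> powr (q - s * q))"
proof -
  have a: "0 < q - s * q" using s q by simp
  obtain C where C: "0 < C" "\<And>\<rho>. 0 < \<rho> \<Longrightarrow>
    (\<integral>\<^sup>+z. ennreal (norm z powr ((q - s * q) - DIM(real ^ 'n))) * indicator (ball (0 :: real ^ 'n) \<rho>) z \<partial>lborel)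
      \<le> ennreal (C * \<rho> powr (q - s * q))"
    using nn_integral_kernel_ball[OF a, where 'a="real ^ 'n"] by blast
  show ?thesis
  proof
    show "0 < C * 4 powr (q - s * q)" using C by simp
    fix x :: "real ^ 'n" and \<rho> :: real assume \<rho>: "0 < \<rho>" and x: "x \<in> ball 0 (2 * \<rho>)"
    have "(\<integral>\<^sup>+y. ennreal (norm (x - y) powr (q - (real CARD('n) + s * q))) * indicator (ball (0 :: real ^ 'n) (2 * \<rho>)) y \<partial>lborel) \<le>
      (\<integral>\<^sup>+z. ennreal (norm z powr (q - (real CARD('n) + s * q))) * indicator (ball (0 :: real ^ 'n) (4 * \<rho>)) z \<partial>lborel)"
    proof (rule nn_integral_kernel_translate_le)
      show "y - x \<in> ball 0 (4 * \<rho>)" if "y \<in> ball 0 (2 * \<rho>)" for y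
        using x that norm_triangle_ineq4[of y x] by simp
    qed measurable
    also have "\<dots> \<le> ennreal (C * (4 * \<rho>) powr (q - s * q))"
      using C(2)[of "4 * \<rho>"] \<rho> by (simp add: algebra_simps)
    also have "C * (4 * \<rho>) powr (q - s * q) = C * 4 powr (q - s * q) * \<rho> powr (q - s * q)"
      using \<rho> by (simp add: powr_mult)
    finally show "(\<integral>\<^sup>+y. ennreal (norm (x - y) powr (q - (real CARD('n) + s * q))) * indicator (ball (0 :: real ^ 'n) (2 * \<rho>)) y \<partial>lborel) \<le>
      ennreal (C * 4 powr (q - s * q) * \<rho> powr (q - s * q))" .
  qed
qed

context log_test begin

abbreviation dst :: "(real ^ 'n) \<times> (real ^ 'n) \<Rightarrow> real" where "dst z \<equiv> norm (fst z - snd z)"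

text \<open>The absolute difference of the values of \<open>U\<close> at the two points.\<close>

definition dU :: "(real ^ 'n) \<times> (real ^ 'n) \<Rightarrow> real" where "dU z = \<bar>U (fst z) - U (snd z)\<bar>"

lemma dU_meas[measurable]: "dU \<in> borel_measurable borel" unfolding dU_def by measurable

lemma B_E: "B \<subseteq> E" using ball_\<Omega> \<Omega>_E by blast

lemma integrable_dU:
  "integrable lborel (\<lambda>z. indicator E (fst z) * indicator E (snd z) * (dU z powr q / dst z powr (real CARD('n) + s * q)))"
proof (rule integrableI_bounded)
  have "(\<integral>\<^sup>+z. ennreal (norm (indicator E (fst z) * indicator E (snd z) * (dU z powr q / dst z powr (real CARD('n) + s * q)))) \<partial>lborel) = gagliardo_pow s q E u"
    unfolding gagliardo_pow_eq[OF E_meas u_U]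
    by (intro nn_integral_cong) (auto simp: indicator_def dU_def mem_Times_iff)
  then show "(\<integral>\<^sup>+z. ennreal (norm (indicator E (fst z) * indicator E (snd z) * (dU z powr q / dst z powr (real CARD('n) + s * q)))) \<partial>lborel) < \<infinity>"
    using E_finite by simp
qed measurable

lemma integrable_near:
  "integrable lborel (\<lambda>z. indicator B (fst z) * indicator B (snd z) * dst z powr (q - (real CARD('n) + s * q)))"
proof (rule integrableI_bounded)
  obtain C where C: "0 < C" "\<And>x \<rho>. 0 < \<rho> \<Longrightarrow> x \<in> ball 0 (2 * \<rho>) \<Longrightarrow>
    (\<integral>\<^sup>+y. ennreal (norm (x - y) powr (q - (real CARD('n) + s * q))) * indicator (ball (0 :: real ^ 'n) (2 * \<rho>)) y \<partial>lborel)
      \<le> ennreal (C * \<rho> powr (q - s * q))" 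
    using near_kernel_bound[OF s(2), of q] q by auto
  have "(\<integral>\<^sup>+z. ennreal (norm (indicator B (fst z) * indicator B (snd z) * dst z powr (q - (real CARD('n) + s * q)))) \<partial>lborel) =
    (\<integral>\<^sup>+x. \<integral>\<^sup>+y. ennreal (norm (indicator B x * indicator B y * norm (x - y) powr (q - (real CARD('n) + s * q)))) \<partial>lborel \<partial>lborel)"
    by (subst nn_integral_lborel_pair) simp_all
  also have "\<dots> \<le> (\<integral>\<^sup>+x. ennreal (C * r powr (q - s * q)) * indicator B x \<partial>lborel)"
  proof (rule nn_integral_mono)
    fix x :: "real ^ 'n"
    show "(\<integral>\<^sup>+y. ennreal (norm (indicator B x * indicator B y * norm (x - y) powr (q - (real CARD('n) + s * q)))) \<partial>lborel) \<le>
      ennreal (C * r powr (q - s * q)) * indicator B x"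
    proof (cases "x \<in> B")
      case True
      have "(\<integral>\<^sup>+y. ennreal (norm (indicator B x * indicator B y * norm (x - y) powr (q - (real CARD('n) + s * q)))) \<partial>lborel) =
        (\<integral>\<^sup>+y. ennreal (norm (x - y) powr (q - (real CARD('n) + s * q))) * indicator B y \<partial>lborel)"
        using True by (intro nn_integral_cong) (simp add: indicator_def)
      then show ?thesis using C(2)[OF r True] True by simp
    qed simp
  qed
  also have "\<dots> < \<infinity>"
    using emeasure_bounded_finite[OF bounded_ball, of "0 :: real ^ 'n" "2 * r"]
    by (simp add: nn_integral_cmult_indicator ennreal_mult_less_top)
  finally show "(\<integral>\<^sup>+z. ennreal (norm (indicator B (fst z) * indicator B (snd z) * dst z powr (q - (real CARD('n) + s * q)))) \<partial>lborel) < \<infinity>" .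
qed measurable

lemma dist_far: "x \<in> B' \<Longrightarrow> y \<notin> B \<Longrightarrow> r / 2 \<le> norm (x - y)"
  using norm_triangle_ineq2[of y x] by (simp add: norm_minus_commute)

lemma integrable_far:
  "integrable lborel (\<lambda>z. indicator B' (fst z) * indicator (- B) (snd z) * (1 / dst z powr (real CARD('n) + s * q)))"
proof (rule integrableI_bounded)
  let ?T = "\<integral>\<^sup>+z. ennreal (norm z powr (- (real CARD('n) + s * q))) * indicator (- ball (0 :: real ^ 'n) (r / 2)) z \<partial>lborel"
  have T: "?T < \<infinity>"
    using nn_integral_kernel_tail_finite[of "s * q" "r / 2", where 'a="real ^ 'n"] s q r by simp
  have "(\<integral>\<^sup>+z. ennreal (norm (indicator B' (fst z) * indicator (- B) (snd z) * (1 / dst z powr (real CARD('n) + s * q)))) \<partial>lborel) =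
    (\<integral>\<^sup>+x. \<integral>\<^sup>+y. ennreal (norm (indicator B' x * indicator (- B) y * (1 / norm (x - y) powr (real CARD('n) + s * q)))) \<partial>lborel \<partial>lborel)"
    by (subst nn_integral_lborel_pair) simp_all
  also have "\<dots> \<le> (\<integral>\<^sup>+x. ?T * indicator B' x \<partial>lborel)"
  proof (rule nn_integral_mono)
    fix x :: "real ^ 'n"
    show "(\<integral>\<^sup>+y. ennreal (norm (indicator B' x * indicator (- B) y * (1 / norm (x - y) powr (real CARD('n) + s * q)))) \<partial>lborel) \<le> ?T * indicator B' x"
    proof (cases "x \<in> B'")
      case True
      have "(\<integral>\<^sup>+y. ennreal (norm (indicator B' x * indicator (- B) y * (1 / norm (x - y) powr (real CARD('n) + s * q)))) \<partial>lborel) =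
        (\<integral>\<^sup>+y. ennreal (norm (x - y) powr (- (real CARD('n) + s * q))) * indicator (- B) y \<partial>lborel)"
        using True by (intro nn_integral_cong) (simp add: indicator_def powr_minus_divide[of _ "real CARD('n) + s * q"] del: minus_add_distrib)
      also have "\<dots> \<le> ?T"
      proof (rule nn_integral_kernel_translate_le)
        show "y - x \<in> - ball 0 (r / 2)" if "y \<in> - B" for y
          using dist_far[OF True, of y] that by (simp add: norm_minus_commute)
      qed measurable
      finally show ?thesis using True by simp
    qed simp
  qed
  also have "\<dots> < \<infinity>"
    using emeasure_bounded_finite[OF bounded_ball, of "0 :: real ^ 'n" "3 * r / 2"] T
    by (simp add: nn_integral_cmult_indicator ennreal_mult_less_top)
  finally show "(\<integral>\<^sup>+z. ennreal (norm (indicator B' (fst z) * indicator (- B) (snd z) * (1 / dst z powr (real CARD('n) + s * q)))) \<partial>lborel) < \<infinity>" .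
qed measurable

lemma U_loc: "(\<integral>\<^sup>+x. ennreal (indicator K x * U x powr (q - 1)) \<partial>lborel) < \<infinity>" if K: "bounded K" "K \<in> sets borel"
proof -
  let ?K = "closure K"
  have cK: "compact ?K" using K by (simp add: compact_closure)
  have Kl: "?K \<in> sets lebesgue" by (auto intro: sets_completionI_sets)
  have "(\<integral>\<^sup>+x. ennreal (indicator K x * U x powr (q - 1)) \<partial>lborel) \<le> (\<integral>\<^sup>+x. ennreal (U x powr (q - 1)) * indicator ?K x \<partial>lborel)"
    using closure_subset[of K] by (intro nn_integral_mono) (auto simp: indicator_def)
  also have "\<dots> = (\<integral>\<^sup>+x. ennreal (norm (u x) powr (q - 1)) \<partial>lebesgue_on ?K)"
    by (rule nn_integral_lebesgue_on_eq[OF Kl, symmetric]) (use u_U U_nonneg in \<open>auto elim!: eventually_mono\<close>)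
  also have "\<dots> < \<infinity>" using u_loc cK by (auto simp: Lp_loc_def Lp_def)
  finally show ?thesis .
qed

lemma integrable_U_pair:
  "integrable lborel (\<lambda>z. indicator B' (fst z) * indicator (- E) (snd z) * (U (fst z) powr (q - 1) + U (snd z) powr (q - 1)))"
proof -
  have bE: "bounded (- E)" "- E \<in> sets borel" using E_compact compact_imp_bounded by auto
  have *: "integrable lborel (\<lambda>z :: (real ^ 'n) \<times> (real ^ 'n). a (fst z) * b (snd z))"
    if [measurable]: "a \<in> borel_measurable borel" "b \<in> borel_measurable borel"
      and nn: "\<And>x. 0 \<le> a x" "\<And>x. 0 \<le> b x"
      and fin: "(\<integral>\<^sup>+x. ennreal (a x) \<partial>lborel) < \<infinity>" "(\<integral>\<^sup>+x. ennreal (b x) \<partial>lborel) < \<infinity>" for a b :: "real ^ 'n \<Rightarrow> real"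
  proof (rule integrableI_bounded)
    have "(\<integral>\<^sup>+z. ennreal (norm (a (fst z) * b (snd z))) \<partial>lborel) = (\<integral>\<^sup>+z. ennreal (a (fst z)) * ennreal (b (snd z)) \<partial>lborel)"
      using nn by (intro nn_integral_cong) (simp add: abs_mult ennreal_mult)
    also have "\<dots> < \<infinity>"
      using fin by (subst nn_integral_lborel_times) (auto simp: ennreal_mult_less_top)
    finally show "(\<integral>\<^sup>+z. ennreal (norm (a (fst z) * b (snd z))) \<partial>lborel) < \<infinity>" .
  qed measurable
  have ind: "(\<integral>\<^sup>+x. ennreal (indicator K x) \<partial>lborel) < \<infinity>" if "bounded K" "K \<in> sets borel" for K :: "(real ^ 'n) set"
    using integrable_indicator_bounded[OF that(2,1)] unfolding integrable_iff_bounded by simp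
  have 1: "integrable lborel (\<lambda>z. (indicator B' (fst z) * U (fst z) powr (q - 1)) * indicator (- E) (snd z))"
    by (rule *) (use U_loc[of B'] ind[OF bE] bE in auto)
  have 2: "integrable lborel (\<lambda>z. indicator B' (fst z) * (indicator (- E) (snd z) * U (snd z) powr (q - 1)))"
    by (rule *) (use U_loc[OF bE] ind[of B'] bE in auto)
  have "integrable lborel (\<lambda>z. (indicator B' (fst z) * U (fst z) powr (q - 1)) * indicator (- E) (snd z) +
     indicator B' (fst z) * (indicator (- E) (snd z) * U (snd z) powr (q - 1)))"
    by (rule Bochner_Integration.integrable_add[OF 1 2])
  then show ?thesis by (simp add: algebra_simps)
qed

text \<open>Every pair of points is in \<open>B \<times> B\<close>, or consists of a point of \<open>B'\<close> and one outside \<open>B\<close>, or has both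
  points outside the support of the test function.\<close>

lemma pair_cases:
  obtains "x \<in> B" "y \<in> B" | "x \<in> B'" "y \<notin> B" | "x \<notin> B" "y \<in> B'" | "x \<notin> B'" "y \<notin> B'"
  using B'_B by blast

lemma power_\<eta>_Lipschitz: "\<bar>\<eta> x ^ m - \<eta> y ^ m\<bar> \<le> m * (6 / r) * norm (x - y)"
proof -
  have *: "\<bar>\<eta> x ^ m - \<eta> y ^ m\<bar> \<le> m * \<bar>\<eta> x - \<eta> y\<bar>" if le: "\<eta> y \<le> \<eta> x" for x y
  proof -
    have "\<eta> y ^ m \<le> \<eta> x ^ m" using le \<eta>_nonneg by (intro power_mono) auto
    then have "\<bar>\<eta> x ^ m - \<eta> y ^ m\<bar> \<le> m * (\<eta> x - \<eta> y) * \<eta> x ^ (m - 1)"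
      using power_diff_le[OF \<eta>_nonneg le, of m] by simp
    also have "\<dots> \<le> m * (\<eta> x - \<eta> y) * 1" using le \<eta>_power by (intro mult_left_mono) auto
    finally show ?thesis using le by simp
  qed
  have "\<bar>\<eta> x ^ m - \<eta> y ^ m\<bar> \<le> m * \<bar>\<eta> x - \<eta> y\<bar>"
    using *[of y x] *[of x y] by (cases "\<eta> y \<le> \<eta> x") (auto simp: abs_minus_commute)
  also have "\<dots> \<le> m * (6 / r * norm (x - y))" by (intro mult_left_mono \<eta>_Lipschitz) auto
  finally show ?thesis by simp
qed

lemma \<phi>_diff_le: "\<bar>\<phi> x - \<phi> y\<bar> \<le> L * \<bar>U x - U y\<bar> + M * (m * (6 / r)) * norm (x - y)"
proof -
  have "\<phi> x - \<phi> y = (A x powr (1 - p) - A y powr (1 - p)) * \<eta> x ^ m + A y powr (1 - p) * (\<eta> x ^ m - \<eta> y ^ m)"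
    by (simp add: \<phi>_def algebra_simps)
  also have "\<bar>\<dots>\<bar> \<le> \<bar>A x powr (1 - p) - A y powr (1 - p)\<bar> * \<eta> x ^ m + A y powr (1 - p) * \<bar>\<eta> x ^ m - \<eta> y ^ m\<bar>"
    using \<eta>_power by (intro order_trans[OF abs_triangle_ineq]) (simp add: abs_mult)
  also have "\<dots> \<le> (L * \<bar>U x - U y\<bar>) * 1 + M * (m * (6 / r) * norm (x - y))"
    using F_Lipschitz[of x y] A_powr_le[of y] \<eta>_power[of x m] power_\<eta>_Lipschitz[of x y] p
    by (intro add_mono mult_mono) auto
  finally show ?thesis by (simp add: mult.assoc)
qed

text \<open>The absolute difference of the values of \<open>\<phi>\<close> at the two points.\<close>

definition d\<phi> :: "(real ^ 'n) \<times> (real ^ 'n) \<Rightarrow> real" where "d\<phi> z = \<bar>\<phi> (fst z) - \<phi> (snd z)\<bar>"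

lemma d\<phi>_le: "d\<phi> z \<le> M"
  using \<phi>_bounds[of "fst z"] \<phi>_bounds[of "snd z"] unfolding d\<phi>_def by linarith

lemma d\<phi>_meas[measurable]: "d\<phi> \<in> borel_measurable borel" unfolding d\<phi>_def by measurable

text \<open>On \<open>B \<times> B\<close> the difference of \<open>\<phi>\<close> is bounded by the difference of \<open>U\<close> and a Lipschitz term; if one
  point is outside \<open>B\<close>, by \<open>M\<close>, and the points are then at distance at least \<open>r/2\<close>.\<close>

lemma integrable_d\<phi>: "integrable lborel (\<lambda>z. d\<phi> z powr q / dst z powr (real CARD('n) + s * q))"
proof (rule Bochner_Integration.integrable_bound)
  let ?c = "M * (m * (6 / r))"
  let ?W = "\<lambda>z. indicator E (fst z) * indicator E (snd z) * (dU z powr q / dst z powr (real CARD('n) + s * q))"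
  let ?N = "\<lambda>z. indicator B (fst z) * indicator B (snd z) * dst z powr (q - (real CARD('n) + s * q))"
  let ?T = "\<lambda>z. indicator B' (fst z) * indicator (- B) (snd z) * (1 / dst z powr (real CARD('n) + s * q))"
  let ?R = "\<lambda>z. (2 powr q * L powr q) * ?W z + (2 powr q * ?c powr q) * ?N z + M powr q * ?T z + M powr q * ?T (snd z, fst z)"
  show "integrable lborel ?R"
    by (intro Bochner_Integration.integrable_add integrable_mult_right integrable_dU integrable_near integrable_far
        integrable_lborel_swap[OF integrable_far])
  have "d\<phi> z powr q / dst z powr (real CARD('n) + s * q) \<le> ?R z" for z
  proof -
    obtain x y where z: "z = (x, y)" by (cases z)
    have nnR: "0 \<le> ?W z" "0 \<le> ?N z" "0 \<le> ?T z" "0 \<le> ?T (snd z, fst z)" by auto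
    have c: "0 \<le> ?c" using r by simp
    have nn: "0 \<le> (2 powr q * L powr q) * ?W z" "0 \<le> (2 powr q * ?c powr q) * ?N z"
      "0 \<le> M powr q * ?T z" "0 \<le> M powr q * ?T (snd z, fst z)"
      using nnR by (auto simp del: mult_eq_0_iff intro!: mult_nonneg_nonneg)
    show ?thesis
    proof (rule pair_cases[of x y])
      assume xy: "x \<in> B" "y \<in> B"
      have "d\<phi> z powr q \<le> (L * \<bar>U x - U y\<bar> + ?c * norm (x - y)) powr q"
        using \<phi>_diff_le[of x y] q by (intro powr_mono2) (auto simp: d\<phi>_def z)
      also have "\<dots> \<le> 2 powr q * ((L * \<bar>U x - U y\<bar>) powr q + (?c * norm (x - y)) powr q)"
        using p q mult_nonneg_nonneg[OF c norm_ge_zero[of "x - y"]] by (intro powr_add_le) auto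
      also have "\<dots> = 2 powr q * L powr q * \<bar>U x - U y\<bar> powr q + 2 powr q * ?c powr q * norm (x - y) powr q"
        by (simp only: powr_mult distrib_left mult.assoc)
      finally have "d\<phi> z powr q / dst z powr (real CARD('n) + s * q) \<le>
          (2 powr q * L powr q * \<bar>U x - U y\<bar> powr q + 2 powr q * ?c powr q * norm (x - y) powr q) / dst z powr (real CARD('n) + s * q)"
        by (intro divide_right_mono) auto
      also have "\<dots> = 2 powr q * L powr q * (\<bar>U x - U y\<bar> powr q / norm (x - y) powr (real CARD('n) + s * q)) + 2 powr q * ?c powr q * norm (x - y) powr (q - (real CARD('n) + s * q))"
        by (simp add: z add_divide_distrib powr_diff)
      also have "\<dots> = (2 powr q * L powr q) * ?W z + (2 powr q * ?c powr q) * ?N z"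
        using xy B_E by (auto simp: z dU_def subset_iff)
      finally show ?thesis using nn by linarith
    next
      assume xy: "x \<in> B'" "y \<notin> B"
      have "d\<phi> z powr q / dst z powr (real CARD('n) + s * q) \<le> M powr q / dst z powr (real CARD('n) + s * q)"
        using q by (intro divide_right_mono powr_mono2 d\<phi>_le) (auto simp: d\<phi>_def)
      also have "\<dots> = M powr q * ?T z" using xy by (simp add: z)
      finally show ?thesis using nn by linarith
    next
      assume xy: "x \<notin> B" "y \<in> B'"
      have "d\<phi> z powr q / dst z powr (real CARD('n) + s * q) \<le> M powr q / dst z powr (real CARD('n) + s * q)"
        using q by (intro divide_right_mono powr_mono2 d\<phi>_le) (auto simp: d\<phi>_def)
      also have "\<dots> = M powr q * ?T (snd z, fst z)" using xy by (simp add: z norm_minus_commute)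
      finally show ?thesis using nn by linarith
    next
      assume "x \<notin> B'" "y \<notin> B'"
      then have "d\<phi> z = 0" using \<phi>_0 by (simp add: d\<phi>_def z)
      then have "d\<phi> z powr q / dst z powr (real CARD('n) + s * q) = 0" by simp
      then show ?thesis using nn by linarith
    qed
  qed
  then show "AE z in lborel. norm (d\<phi> z powr q / dst z powr (real CARD('n) + s * q)) \<le> norm (?R z)"
    by (intro AE_I2) (auto intro: order_trans[OF _ abs_ge_self])
qed measurable

lemma \<phi>_D0sq: "\<phi> \<in> D0sq s q \<Omega>"
proof -
  have "\<phi> \<in> Lp (q * real CARD('n) / (real CARD('n) - s * q)) UNIV"
    by (rule bounded_support_in_Lp[of _ _ M B']) (use q \<phi>_bounds \<phi>_0 in auto)
  moreover have "gagliardo_pow s q UNIV \<phi> < \<infinity>"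
  proof -
    have "gagliardo_pow s q UNIV \<phi> = (\<integral>\<^sup>+z. ennreal (norm (d\<phi> z powr q / dst z powr (real CARD('n) + s * q))) \<partial>lborel)"
      by (subst gagliardo_pow_eq[of _ _ \<phi>]) (auto simp: d\<phi>_def)
    also have "\<dots> < \<infinity>" using integrable_d\<phi> unfolding integrable_iff_bounded by blast
    finally show ?thesis .
  qed
  moreover have "x \<notin> \<Omega> \<longrightarrow> \<phi> x = 0" for x using \<phi>_0[of x] B'_B ball_\<Omega> by blast
  ultimately show ?thesis by (simp add: D0sq_def)
qed

text \<open>The integrands of the two parts of the weak formulation for the test function \<open>\<phi>\<close>. On the diagonal
  the nonlocal one is \<open>0\<close>.\<close>

definition nonlocal_term :: "(real ^ 'n) \<times> (real ^ 'n) \<Rightarrow> real" where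
  "nonlocal_term z = J q (U (fst z) - U (snd z)) * (\<phi> (fst z) - \<phi> (snd z)) / dst z powr (real CARD('n) + s * q)"

definition local_term :: "real ^ 'n \<Rightarrow> real" where
  "local_term x = norm (G x) powr (p - 2) * (G x \<bullet> grad_\<phi> x)"

lemma nonlocal_term_meas[measurable]: "nonlocal_term \<in> borel_measurable borel"
  unfolding nonlocal_term_def J_def by measurable

lemma local_term_meas[measurable]: "local_term \<in> borel_measurable borel"
  unfolding local_term_def by measurable

lemma abs_nonlocal: "\<bar>nonlocal_term z\<bar> = dU z powr (q - 1) * d\<phi> z / dst z powr (real CARD('n) + s * q)"
  by (simp add: nonlocal_term_def abs_mult abs_J dU_def d\<phi>_def)

text \<open>On \<open>B \<times> B\<close> by Young's inequality. If \<open>x \<in> B'\<close> and \<open>y \<notin> B\<close>, the factor \<open>|U(x) - U(y)|\<^bsup>q - 1\<^esup>\<close> is at most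
  \<open>1 + |U(x) - U(y)|\<^bsup>q\<^esup>\<close> when \<open>y \<in> E\<close>; for \<open>y\<close> in the compact complement of \<open>E\<close> the local integrability of
  \<open>U\<^bsup>q - 1\<^esup>\<close> takes over.\<close>

lemma integrable_nonlocal: "integrable lborel nonlocal_term"
proof (rule Bochner_Integration.integrable_bound)
  let ?k = "2 powr (q - 1) / (r / 2) powr (real CARD('n) + s * q)"
  let ?W = "\<lambda>z. indicator E (fst z) * indicator E (snd z) * (dU z powr q / dst z powr (real CARD('n) + s * q))"
  let ?P = "\<lambda>z. d\<phi> z powr q / dst z powr (real CARD('n) + s * q)"
  let ?T = "\<lambda>z. indicator B' (fst z) * indicator (- B) (snd z) * (1 / dst z powr (real CARD('n) + s * q))"
  let ?V = "\<lambda>z. indicator B' (fst z) * indicator (- E) (snd z) * (U (fst z) powr (q - 1) + U (snd z) powr (q - 1))"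
  let ?g = "\<lambda>z. M * ?T z + M * ?W z + (M * ?k) * ?V z"
  let ?R = "\<lambda>z. ?W z + ?P z + ?g z + ?g (snd z, fst z)"
  have ig: "integrable lborel ?g"
    by (intro Bochner_Integration.integrable_add integrable_mult_right integrable_dU integrable_far integrable_U_pair)
  show "integrable lborel ?R"
    by (intro Bochner_Integration.integrable_add integrable_dU integrable_d\<phi> ig integrable_lborel_swap[OF ig])
  have nng: "0 \<le> ?g z" for z
    by (intro add_nonneg_nonneg mult_nonneg_nonneg) auto
  have far: "dU (x, y) powr (q - 1) * M / norm (x - y) powr (real CARD('n) + s * q) \<le> ?g (x, y)" if xy: "x \<in> B'" "y \<notin> B" for x y
  proof (cases "y \<in> E")
    case True
    have xE: "x \<in> E" using xy B'_B B_E by blast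
    have "dU (x, y) powr (q - 1) \<le> 1 + dU (x, y) powr q"
      using powr_mult_le_add[of "dU (x, y)" 1 q] q by (simp add: dU_def)
    then have "dU (x, y) powr (q - 1) * M / norm (x - y) powr (real CARD('n) + s * q) \<le> (1 + dU (x, y) powr q) * M / norm (x - y) powr (real CARD('n) + s * q)"
      by (intro divide_right_mono mult_right_mono) auto
    also have "\<dots> = M * ?T (x, y) + M * ?W (x, y)"
      using xy True xE by (simp add: add_divide_distrib distrib_left mult.commute)
    also have "\<dots> \<le> ?g (x, y)" using True by simp
    finally show ?thesis .
  next
    case False
    have "dU (x, y) powr (q - 1) \<le> (U x + U y) powr (q - 1)"
      using U_nonneg[of x] U_nonneg[of y] q by (intro powr_mono2) (auto simp: dU_def)
    also have "\<dots> \<le> 2 powr (q - 1) * (U x powr (q - 1) + U y powr (q - 1))"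
      using U_nonneg q by (intro powr_add_le) auto
    finally have 1: "dU (x, y) powr (q - 1) \<le> 2 powr (q - 1) * (U x powr (q - 1) + U y powr (q - 1))" .
    have 2: "(r / 2) powr (real CARD('n) + s * q) \<le> norm (x - y) powr (real CARD('n) + s * q)"
      using dist_far[OF xy] r s q by (intro powr_mono2) auto
    have "dU (x, y) powr (q - 1) * M / norm (x - y) powr (real CARD('n) + s * q) \<le>
        (2 powr (q - 1) * (U x powr (q - 1) + U y powr (q - 1))) * M / (r / 2) powr (real CARD('n) + s * q)"
      using 1 2 r by (intro frac_le mult_right_mono) auto
    also have "\<dots> = (M * ?k) * ?V (x, y)" using xy False by simp
    also have "\<dots> \<le> ?g (x, y)" by simp
    finally show ?thesis .
  qed
  have "\<bar>nonlocal_term z\<bar> \<le> ?R z" for z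
  proof -
    obtain x y where z: "z = (x, y)" by (cases z)
    have nn: "0 \<le> ?W z" "0 \<le> ?P z" "0 \<le> ?g z" "0 \<le> ?g (snd z, fst z)"
      using nng[of z] nng[of "(snd z, fst z)"] by auto
    show ?thesis
    proof (rule pair_cases[of x y])
      assume xy: "x \<in> B" "y \<in> B"
      have "\<bar>nonlocal_term z\<bar> \<le> (dU z powr q + d\<phi> z powr q) / dst z powr (real CARD('n) + s * q)"
        unfolding abs_nonlocal using q by (intro divide_right_mono powr_mult_le_add) (auto simp: dU_def d\<phi>_def)
      also have "\<dots> = ?W z + ?P z" using xy B_E by (auto simp: z add_divide_distrib subset_iff)
      finally show ?thesis using nn by linarith
    next
      assume xy: "x \<in> B'" "y \<notin> B"
      have "\<bar>nonlocal_term z\<bar> \<le> dU (x, y) powr (q - 1) * M / norm (x - y) powr (real CARD('n) + s * q)"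
        
        unfolding abs_nonlocal z fst_conv snd_conv using d\<phi>_le[of "(x, y)"]
        by (intro divide_right_mono mult_left_mono) auto
      also have "\<dots> \<le> ?g z" unfolding z by (rule far[OF xy])
      finally show ?thesis using nn by linarith
    next
      assume xy: "x \<notin> B" "y \<in> B'"
      have "\<bar>nonlocal_term z\<bar> \<le> dU (x, y) powr (q - 1) * M / norm (x - y) powr (real CARD('n) + s * q)"
        
        unfolding abs_nonlocal z fst_conv snd_conv using d\<phi>_le[of "(x, y)"]
        by (intro divide_right_mono mult_left_mono) auto
      also have "\<dots> = dU (y, x) powr (q - 1) * M / norm (y - x) powr (real CARD('n) + s * q)"
        by (simp add: dU_def norm_minus_commute abs_minus_commute)
      also have "\<dots> \<le> ?g (snd z, fst z)" using far[OF xy(2,1)] by (simp only: z fst_conv snd_conv)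
      finally show ?thesis using nn by linarith
    next
      assume "x \<notin> B'" "y \<notin> B'"
      then have "nonlocal_term z = 0" using \<phi>_0 by (simp add: nonlocal_term_def z)
      then have "\<bar>nonlocal_term z\<bar> = 0" by simp
      then show ?thesis using nn by linarith
    qed
  qed
  then show "AE z in lborel. norm (nonlocal_term z) \<le> norm (?R z)"
    by (intro AE_I2) (auto intro: order_trans[OF _ abs_ge_self])
qed measurable

lemma local_term_0: "x \<notin> B' \<Longrightarrow> local_term x = 0"
  unfolding local_term_def using grad_\<phi>_0[of x] by simp

lemma integrable_local: "integrable lborel local_term"
proof (rule Bochner_Integration.integrable_bound)
  let ?R = "\<lambda>x. indicator B x * norm (G x) powr p + norm (grad_\<phi> x) powr p"
  show "integrable lborel ?R"
    by (intro Bochner_Integration.integrable_add integrable_G_p integrable_grad_\<phi>_p)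
  have "\<bar>local_term x\<bar> \<le> ?R x" for x
  proof (cases "x \<in> B'")
    case True
    have "\<bar>local_term x\<bar> \<le> norm (G x) powr (p - 2) * (norm (G x) * norm (grad_\<phi> x))"
      unfolding local_term_def abs_mult using Cauchy_Schwarz_ineq2[of "G x" "grad_\<phi> x"] by (intro mult_mono) auto
    also have "\<dots> = norm (G x) powr (p - 1) * norm (grad_\<phi> x)"
      by (cases "G x = 0") (auto simp: powr_diff power2_eq_square)
    also have "\<dots> \<le> norm (G x) powr p + norm (grad_\<phi> x) powr p"
      using p by (intro powr_mult_le_add) auto
    finally show ?thesis using True B'_B by (auto simp: subset_iff)
  qed (simp add: local_term_0 del: mem_ball_0)
  then show "AE x in lborel. norm (local_term x) \<le> norm (?R x)"
    by (intro AE_I2) (auto intro: order_trans[OF _ abs_ge_self])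
qed measurable

text \<open>Since both integrals in the weak formulation converge absolutely, their values are genuine and the
  inequality carries information.\<close>

lemma energy_inequality:
  assumes "weak_supersolution s p q \<Omega> u"
  shows "0 \<le> (LBINT x. local_term x) + (LBINT z. nonlocal_term z)"
proof -
  have \<Omega>l: "\<Omega> \<in> sets lebesgue" using \<Omega> by (auto intro: sets_completionI_sets)
  have "\<phi> \<in> D01p p \<Omega> \<inter> D0sq s q \<Omega>" using \<phi>_D01p \<phi>_D0sq by blast
  moreover have "AE x in lebesgue. 0 \<le> \<phi> x" using \<phi>_bounds by simp
  ultimately have *: "0 \<le> (\<integral>x. norm (weak_grad \<Omega> u x) powr (p - 2) * (weak_grad \<Omega> u x \<bullet> weak_grad UNIV \<phi> x) \<partial>lebesgue_on \<Omega>)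
        + (\<integral>(x, y). J q (u x - u y) * (\<phi> x - \<phi> y) / norm (x - y) powr (real CARD('n) + s * q) \<partial>lebesgue)"
    using assms unfolding weak_supersolution_def by blast
  have 1: "(\<integral>x. norm (weak_grad \<Omega> u x) powr (p - 2) * (weak_grad \<Omega> u x \<bullet> weak_grad UNIV \<phi> x) \<partial>lebesgue_on \<Omega>) = (LBINT x. local_term x)"
  proof (rule integral_lebesgue_on_eq[OF \<Omega>l local_term_meas])
    show "AE x in lborel. x \<in> \<Omega> \<longrightarrow> norm (weak_grad \<Omega> u x) powr (p - 2) * (weak_grad \<Omega> u x \<bullet> weak_grad UNIV \<phi> x) = local_term x"
      using weak_grad_u weak_grad_\<phi>(2) by eventually_elim (simp add: local_term_def)
    show "local_term x = 0" if "x \<notin> \<Omega>" for x using that local_term_0[of x] B'_B ball_\<Omega> by blast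
  qed
  have 2: "(\<integral>(x, y). J q (u x - u y) * (\<phi> x - \<phi> y) / norm (x - y) powr (real CARD('n) + s * q) \<partial>lebesgue) = (LBINT z. nonlocal_term z)"
  proof -
    have "(\<integral>(x, y). J q (u x - u y) * (\<phi> x - \<phi> y) / norm (x - y) powr (real CARD('n) + s * q) \<partial>lebesgue_on UNIV) = (LBINT z. nonlocal_term z)"
    proof (rule integral_lebesgue_on_eq[OF _ nonlocal_term_meas])
      show "AE z in lborel. z \<in> UNIV \<longrightarrow> (case z of (x, y) \<Rightarrow> J q (u x - u y) * (\<phi> x - \<phi> y) / norm (x - y) powr (real CARD('n) + s * q)) = nonlocal_term z"
        using AE_lborel_pair[OF u_U] by eventually_elim (simp add: nonlocal_term_def case_prod_beta)
    qed auto
    then show ?thesis by (simp add: lebesgue_on_UNIV_eq)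
  qed
  show ?thesis using * unfolding 1 2 .
qed

end

section \<open>The logarithmic energy estimate\<close>

context log_test begin

lemma nonlocal_term_swap: "nonlocal_term (y, x) = nonlocal_term (x, y)"
  using J_minus[of q "U x - U y"] by (simp add: nonlocal_term_def norm_minus_commute algebra_simps)

text \<open>The sign of \<open>U(y)\<close> gives \<open>U(x) - U(y) \<le> A(x)\<close>, so no information about the size of \<open>U\<close> far away enters.\<close>

lemma nonlocal_term_far_le:
  assumes "x \<in> B'" "y \<notin> B"
  shows "nonlocal_term (x, y) \<le> A x powr (q - p) / norm (x - y) powr (real CARD('n) + s * q)"
proof -
  have y: "\<phi> y = 0" using \<phi>_0[of y] assms B'_B by blast
  have "J q (U x - U y) * \<phi> x \<le> A x powr (q - p)"
  proof (cases "U y < U x")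
    case True
    have "J q (U x - U y) \<le> A x powr (q - 1)"
      using True U_nonneg[of y] d q by (auto simp: J_pos A_def intro!: powr_mono2)
    moreover have "\<phi> x \<le> A x powr (1 - p)"
      using \<eta>_power[of x m] by (simp add: \<phi>_def mult_left_le)
    ultimately have "J q (U x - U y) * \<phi> x \<le> A x powr (q - 1) * A x powr (1 - p)"
      using \<phi>_bounds by (intro mult_mono) auto
    then show ?thesis by (simp add: powr_split)
  next
    case False
    then have "J q (U x - U y) \<le> 0" by (simp add: J_def mult_nonneg_nonpos)
    then have "J q (U x - U y) * \<phi> x \<le> 0" using \<phi>_bounds by (intro mult_nonpos_nonneg)
    then show ?thesis by (rule order_trans) simp
  qed
  then show ?thesis unfolding nonlocal_term_def by (simp add: y divide_right_mono)
qed

lemma exp_le_\<eta>_power: "x \<in> ball 0 r \<Longrightarrow> exp (- real m) \<le> \<eta> x ^ m"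
  using power_mono[OF \<eta>_inside, of x m] by (simp add: exp_of_nat_mult[symmetric])

lemma small_ball: "ball 0 r \<subseteq> B'" using r by auto

text \<open>The estimate before division by the constant on the left, with the constants \<open>C1\<close>, \<open>c2\<close>, \<open>C2\<close>, \<open>C3\<close> of the
  pointwise and kernel bounds as parameters, which do not depend on \<open>u\<close>, \<open>\<Omega>\<close>, \<open>d\<close> or \<open>r\<close>.\<close>

lemma logarithmic_energy_estimate:
  assumes sup: "weak_supersolution s p q \<Omega> u"
    and C1: "0 < C1" "\<And>(g :: real ^ 'n) z (e :: real) a Z. \<lbrakk>0 < a; 0 \<le> e; e \<le> 1; norm z \<le> Z\<rbrakk> \<Longrightarrow>
      norm g powr (p - 2) * (g \<bullet> (((1 - p) * a powr (-p) * e ^ m) *\<^sub>R g + (a powr (1 - p) * (m * e ^ (m - 1))) *\<^sub>R z))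
        + (p - 1) / 2 * (e ^ m * (norm g / a) powr p) \<le> C1 * Z powr p"
    and C2: "0 < c2" "0 < C2" "\<And>a b x y. \<lbrakk>0 < a; 0 < b; 0 \<le> x; x \<le> 1; 0 \<le> y; y \<le> 1\<rbrakk> \<Longrightarrow>
      J q (a - b) * (a powr (1 - p) * x ^ m - b powr (1 - p) * y ^ m)
        + c2 * (\<bar>ln (a / b)\<bar> powr q * b powr (q - p) * min x y ^ m)
        \<le> C2 * (\<bar>x - y\<bar> powr q * (a powr (q - p) + b powr (q - p)))"
    and C3: "0 < C3" "\<And>x. x \<in> B \<Longrightarrow>
      (\<integral>\<^sup>+y. ennreal (norm (x - y) powr (q - (real CARD('n) + s * q))) * indicator B y \<partial>lborel) \<le> ennreal (C3 * r powr (q - s * q))"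
  shows "ennreal (min ((p - 1) / 2) c2 * exp (- real m)) *
      ((\<integral>\<^sup>+x. ennreal ((norm (G x) / A x) powr p) * indicator (ball 0 r) x \<partial>lborel)
      + (\<integral>\<^sup>+x. (\<integral>\<^sup>+y. ennreal (\<bar>ln (A x / A y)\<bar> powr q * A y powr (q - p) / norm (x - y) powr (real CARD('n) + s * q))
            * indicator (ball 0 r) y \<partial>lborel) * indicator (ball 0 r) x \<partial>lborel))
    \<le> ennreal (C1 * 6 powr p * (unit_ball_vol CARD('n) * (3 / 2) ^ CARD('n)) * r powr (real CARD('n) - p))
      + ennreal (2 * C2 * 6 powr q * C3 * r powr (- (s * q))) * (\<integral>\<^sup>+x. ennreal (A x powr (q - p)) * indicator B x \<partial>lborel)
      + ennreal 2 * (\<integral>\<^sup>+x. (\<integral>\<^sup>+y. ennreal (A x powr (q - p) / norm (x - y) powr (real CARD('n) + s * q)) * indicator (- B) y \<partial>lborel)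
            * indicator B' x \<partial>lborel)"
proof -
  let ?K = "real CARD('n) + s * q"
  let ?S = "ball (0 :: real ^ 'n) r"
  define A1 where "A1 x = indicator ?S x * ((p - 1) / 2 * exp (- real m) * (norm (G x) / A x) powr p)" for x
  \<comment> \<open>\<open>A1\<close>, \<open>A2\<close> are the good terms and \<open>B1\<close>, \<open>B2\<close> the bounds; \<open>exp (- m)\<close> is the minimum of \<open>\<eta>\<^bsup>m\<^esup>\<close> guaranteed on the small ball\<close>
  define B1 where "B1 x = indicator B' x * (C1 * (6 / r) powr p)" for x
  define lg where "lg z = \<bar>ln (A (fst z) / A (snd z))\<bar> powr q * A (snd z) powr (q - p) / dst z powr ?K" for z
  define A2 where "A2 z = indicator ?S (fst z) * indicator ?S (snd z) * (c2 * exp (- real m) * lg z)" for z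
  define f where "f z = indicator B (fst z) * indicator B (snd z) * (C2 * (6 / r) powr q * (dst z powr (q - ?K) * A (fst z) powr (q - p)))" for z
  define g where "g z = indicator B' (fst z) * indicator (- B) (snd z) * (A (fst z) powr (q - p) / dst z powr ?K)" for z
  define B2 where "B2 z = f z + f (snd z, fst z) + (g z + g (snd z, fst z))" for z
  have Sm[measurable]: "?S \<in> sets borel" by simp
  have sw[measurable]: "(\<lambda>z :: (real ^ 'n) \<times> (real ^ 'n). (snd z, fst z)) \<in> measurable borel borel"
    by (intro borel_measurable_continuous_onI continuous_intros)
  have m1[measurable]: "A1 \<in> borel_measurable borel" "B1 \<in> borel_measurable borel"
    unfolding A1_def[abs_def] B1_def[abs_def] by measurable
  have lgm[measurable]: "lg \<in> borel_measurable borel" unfolding lg_def[abs_def] by measurable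
  have m2'[measurable]: "A2 \<in> borel_measurable borel" "f \<in> borel_measurable borel" "g \<in> borel_measurable borel"
    unfolding A2_def[abs_def] f_def[abs_def] g_def[abs_def] by measurable
  have m3[measurable]: "(\<lambda>z. f (snd z, fst z)) \<in> borel_measurable borel" "(\<lambda>z. g (snd z, fst z)) \<in> borel_measurable borel"
    by (rule measurable_compose[OF sw]; measurable)+
  have m4[measurable]: "B2 \<in> borel_measurable borel" unfolding B2_def[abs_def] by measurable
  have f0: "0 \<le> f z" and g0: "0 \<le> g z" for z using C2 r by (auto simp: f_def g_def)
  have lg0: "0 \<le> lg z" for z by (simp add: lg_def)
  have le1: "0 \<le> A1 x \<and> 0 \<le> B1 x \<and> local_term x + A1 x \<le> B1 x" for x
  proof (intro conjI)
    show "0 \<le> A1 x" "0 \<le> B1 x" using p C1(1) by (auto simp: A1_def B1_def)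
    show "local_term x + A1 x \<le> B1 x"
    proof (cases "x \<in> B'")
      case True
      have "A1 x \<le> (p - 1) / 2 * (\<eta> x ^ m * (norm (G x) / A x) powr p)"
      proof (cases "x \<in> ?S")
        case True
        have "(p - 1) / 2 * (exp (- real m) * (norm (G x) / A x) powr p) \<le> (p - 1) / 2 * (\<eta> x ^ m * (norm (G x) / A x) powr p)"
          using exp_le_\<eta>_power[OF True] p by (intro mult_left_mono mult_right_mono) auto
        then show ?thesis using True by (simp add: A1_def mult.assoc)
      next
        case False
        then show ?thesis using p \<eta>_power by (simp add: A1_def)
      qed
      moreover have "local_term x + (p - 1) / 2 * (\<eta> x ^ m * (norm (G x) / A x) powr p) \<le> C1 * (6 / r) powr p"
        unfolding local_term_def grad_\<phi>_def by (rule C1(2)) (intro A_pos \<eta>_nonneg \<eta>_le_1 \<eta>_grad)+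
      ultimately show ?thesis using True by (simp add: B1_def)
    next
      case False
      then have "x \<notin> ?S" using small_ball by blast
      then show ?thesis using False local_term_0[OF False] C1(1) by (simp add: A1_def B1_def)
    qed
  qed
  have le2: "0 \<le> A2 z \<and> 0 \<le> B2 z \<and> nonlocal_term z + A2 z \<le> B2 z" for z
  proof (intro conjI)
    obtain x y where z: "z = (x, y)" by (cases z)
    show "0 \<le> A2 z" "0 \<le> B2 z" using C2 lg0 f0 g0 by (auto simp: A2_def B2_def)
    have A2_0: "A2 (x, y) = 0" if "x \<notin> ?S \<or> y \<notin> ?S" for x y using that by (auto simp: A2_def)
    have fg: "0 \<le> f (x, y)" "0 \<le> f (y, x)" "0 \<le> g (x, y)" "0 \<le> g (y, x)" by (rule f0 g0)+
    show "nonlocal_term z + A2 z \<le> B2 z"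
    proof (rule pair_cases[of x y])
      assume xy: "x \<in> B" "y \<in> B"
      let ?lg = "\<bar>ln (A x / A y)\<bar> powr q * A y powr (q - p)"
      let ?D = "norm (x - y) powr ?K"
      have "A2 z \<le> c2 * (?lg * min (\<eta> x) (\<eta> y) ^ m) / ?D"
      proof (cases "x \<in> ?S \<and> y \<in> ?S")
        case True
        then have "exp (- real m) \<le> min (\<eta> x) (\<eta> y) ^ m"
          using exp_le_\<eta>_power by (simp add: min_def)
        then have "c2 * (?lg * exp (- real m)) / ?D \<le> c2 * (?lg * min (\<eta> x) (\<eta> y) ^ m) / ?D"
          using C2(1) by (intro divide_right_mono mult_left_mono) auto
        moreover have "A2 z = c2 * (?lg * exp (- real m)) / ?D"
          using True by (simp add: A2_def lg_def z)
        ultimately show ?thesis by simp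
      next
        case False
        then show ?thesis using A2_0 C2(1) \<eta>_nonneg by (simp add: z)
      qed
      then have "nonlocal_term z + A2 z \<le> (J q (A x - A y) * (A x powr (1 - p) * \<eta> x ^ m - A y powr (1 - p) * \<eta> y ^ m)
          + c2 * (?lg * min (\<eta> x) (\<eta> y) ^ m)) / ?D"
        by (simp add: nonlocal_term_def z \<phi>_def add_divide_distrib A_def)
      also have "\<dots> \<le> C2 * (\<bar>\<eta> x - \<eta> y\<bar> powr q * (A x powr (q - p) + A y powr (q - p))) / ?D"
        by (intro divide_right_mono C2(3) A_pos \<eta>_nonneg \<eta>_le_1) simp
      also have "\<dots> \<le> C2 * ((6 / r * norm (x - y)) powr q * (A x powr (q - p) + A y powr (q - p))) / ?D"
        using C2(2) q \<eta>_Lipschitz[of x y]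
        by (intro divide_right_mono mult_left_mono mult_right_mono powr_mono2) auto
      also have "\<dots> = C2 * (6 / r) powr q * ((norm (x - y) powr q / ?D) * (A x powr (q - p) + A y powr (q - p)))"
        using powr_mult[of "6 / r" "norm (x - y)" q] r by simp
      also have "norm (x - y) powr q / ?D = norm (x - y) powr (q - ?K)" by (simp add: powr_diff)
      also have "C2 * (6 / r) powr q * (norm (x - y) powr (q - ?K) * (A x powr (q - p) + A y powr (q - p))) = f (x, y) + f (y, x)"
        using xy by (simp add: f_def norm_minus_commute distrib_left)
      finally show ?thesis using fg by (simp add: B2_def z)
    next
      assume xy: "x \<in> B'" "y \<notin> B"
      then have "nonlocal_term z \<le> g (x, y)" using nonlocal_term_far_le[OF xy] by (simp add: z g_def)
      moreover have "y \<notin> ?S" using xy small_ball B'_B by blast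
      ultimately show ?thesis using fg A2_0[of x y] by (simp add: B2_def z)
    next
      assume xy: "x \<notin> B" "y \<in> B'"
      then have "nonlocal_term z \<le> g (y, x)"
        using nonlocal_term_far_le[OF xy(2,1)] nonlocal_term_swap[of y x] by (simp add: z g_def)
      moreover have "x \<notin> ?S" using xy small_ball B'_B by blast
      ultimately show ?thesis using fg A2_0[of x y] by (simp add: B2_def z)
    next
      assume xy: "x \<notin> B'" "y \<notin> B'"
      then have "nonlocal_term z = 0" using \<phi>_0 by (simp add: nonlocal_term_def z)
      moreover have "x \<notin> ?S" using xy small_ball by blast
      ultimately show ?thesis using fg A2_0[of x y] by (simp add: B2_def z)
    qed
  qed
  have main: "(\<integral>\<^sup>+x. ennreal (A1 x) \<partial>lborel) + (\<integral>\<^sup>+z. ennreal (A2 z) \<partial>lborel) \<le>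
      (\<integral>\<^sup>+x. ennreal (B1 x) \<partial>lborel) + (\<integral>\<^sup>+z. ennreal (B2 z) \<partial>lborel)"
    using nn_integral_le_of_integral_nonneg[OF integrable_local integrable_nonlocal energy_inequality[OF sup], of A1 B1 A2 B2] le1 le2
    by simp
  let ?I1 = "\<integral>\<^sup>+x. ennreal ((norm (G x) / A x) powr p) * indicator ?S x \<partial>lborel"
  let ?I2 = "\<integral>\<^sup>+x. (\<integral>\<^sup>+y. ennreal (\<bar>ln (A x / A y)\<bar> powr q * A y powr (q - p) / norm (x - y) powr ?K) * indicator ?S y \<partial>lborel) * indicator ?S x \<partial>lborel"
  let ?J1 = "\<integral>\<^sup>+x. ennreal (A x powr (q - p)) * indicator B x \<partial>lborel"
  let ?J2 = "\<integral>\<^sup>+x. (\<integral>\<^sup>+y. ennreal (A x powr (q - p) / norm (x - y) powr ?K) * indicator (- B) y \<partial>lborel) * indicator B' x \<partial>lborel"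
  let ?c = "min ((p - 1) / 2) c2 * exp (- real m)"
  have A1_ge: "ennreal ?c * ?I1 \<le> (\<integral>\<^sup>+x. ennreal (A1 x) \<partial>lborel)"
  proof -
    have "ennreal ?c * ?I1 = (\<integral>\<^sup>+x. ennreal ?c * (ennreal ((norm (G x) / A x) powr p) * indicator ?S x) \<partial>lborel)"
      by (rule nn_integral_cmult[symmetric]) measurable
    also have "\<dots> \<le> (\<integral>\<^sup>+x. ennreal (A1 x) \<partial>lborel)"
    proof (rule nn_integral_mono)
      fix x
      have "?c * (norm (G x) / A x) powr p \<le> (p - 1) / 2 * exp (- real m) * (norm (G x) / A x) powr p"
        by (intro mult_right_mono min.cobounded1) auto
      then show "ennreal ?c * (ennreal ((norm (G x) / A x) powr p) * indicator ?S x) \<le> ennreal (A1 x)"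
        using p C2(1) by (auto simp: A1_def indicator_def ennreal_mult'[symmetric] intro!: ennreal_leI)
    qed
    finally show ?thesis .
  qed
  have A2_ge: "ennreal ?c * ?I2 \<le> (\<integral>\<^sup>+z. ennreal (A2 z) \<partial>lborel)"
  proof -
    have "?I2 = (\<integral>\<^sup>+x. (\<integral>\<^sup>+y. ennreal (indicator ?S x * indicator ?S y * lg (x, y)) \<partial>lborel) \<partial>lborel)"
    proof (rule nn_integral_cong)
      fix x
      show "(\<integral>\<^sup>+y. ennreal (\<bar>ln (A x / A y)\<bar> powr q * A y powr (q - p) / norm (x - y) powr ?K) * indicator ?S y \<partial>lborel) * indicator ?S x
        = (\<integral>\<^sup>+y. ennreal (indicator ?S x * indicator ?S y * lg (x, y)) \<partial>lborel)"
      proof (cases "x \<in> ?S")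
        case True
        then show ?thesis
          by (simp add: lg_def) (intro nn_integral_cong; simp add: indicator_def)
      qed simp
    qed
    also have "\<dots> = (\<integral>\<^sup>+z. ennreal (indicator ?S (fst z) * indicator ?S (snd z) * lg z) \<partial>lborel)"
      by (subst nn_integral_lborel_pair) simp_all
    finally have "ennreal ?c * ?I2 = (\<integral>\<^sup>+z. ennreal ?c * ennreal (indicator ?S (fst z) * indicator ?S (snd z) * lg z) \<partial>lborel)"
      by (simp add: nn_integral_cmult)
    also have "\<dots> \<le> (\<integral>\<^sup>+z. ennreal (A2 z) \<partial>lborel)"
    proof (rule nn_integral_mono)
      fix z
      have "?c * lg z \<le> c2 * exp (- real m) * lg z"
        using lg0 by (intro mult_right_mono min.cobounded2) auto
      then show "ennreal ?c * ennreal (indicator ?S (fst z) * indicator ?S (snd z) * lg z) \<le> ennreal (A2 z)"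
        using p C2(1) lg0[of z] by (auto simp: A2_def indicator_def ennreal_mult'[symmetric] intro!: ennreal_leI)
    qed
    finally show ?thesis .
  qed
  have B1_eq: "(\<integral>\<^sup>+x. ennreal (B1 x) \<partial>lborel) =
     ennreal (C1 * 6 powr p * (unit_ball_vol CARD('n) * (3 / 2) ^ CARD('n)) * r powr (real CARD('n) - p))"
  proof -
    have "(\<integral>\<^sup>+x. ennreal (B1 x) \<partial>lborel) = (\<integral>\<^sup>+x. ennreal (C1 * (6 / r) powr p) * indicator B' x \<partial>lborel)"
      by (intro nn_integral_cong) (simp add: B1_def indicator_def)
    also have "\<dots> = ennreal (C1 * (6 / r) powr p) * ennreal (unit_ball_vol CARD('n) * (3 * r / 2) ^ CARD('n))"
      using r by (simp add: nn_integral_cmult_indicator emeasure_ball)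
    also have "\<dots> = ennreal ((C1 * (6 / r) powr p) * (unit_ball_vol CARD('n) * (3 * r / 2) ^ CARD('n)))"
      using C1(1) by (intro ennreal_mult'[symmetric]) simp
    also have "(C1 * (6 / r) powr p) * (unit_ball_vol CARD('n) * (3 * r / 2) ^ CARD('n)) =
        C1 * 6 powr p * (unit_ball_vol CARD('n) * (3 / 2) ^ CARD('n)) * (r powr real CARD('n) / r powr p)"
      using r by (simp add: powr_divide powr_realpow power_divide power_mult_distrib mult_ac)
    also have "r powr real CARD('n) / r powr p = r powr (real CARD('n) - p)" by (simp add: powr_diff)
    finally show ?thesis .
  qed
  have B2_le: "(\<integral>\<^sup>+z. ennreal (B2 z) \<partial>lborel) \<le>
     ennreal (2 * C2 * 6 powr q * C3 * r powr (- (s * q))) * ?J1 + ennreal 2 * ?J2"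
  proof -
    have "(\<integral>\<^sup>+z. ennreal (B2 z) \<partial>lborel) = (\<integral>\<^sup>+z. ennreal (f z) + ennreal (f (snd z, fst z)) + (ennreal (g z) + ennreal (g (snd z, fst z))) \<partial>lborel)"
      using f0 g0 by (simp add: B2_def ennreal_plus)
    also have "\<dots> = ((\<integral>\<^sup>+z. ennreal (f z) \<partial>lborel) + (\<integral>\<^sup>+z. ennreal (f (snd z, fst z)) \<partial>lborel)) +
        ((\<integral>\<^sup>+z. ennreal (g z) \<partial>lborel) + (\<integral>\<^sup>+z. ennreal (g (snd z, fst z)) \<partial>lborel))"
      by (simp add: nn_integral_add)
    also have "(\<integral>\<^sup>+z. ennreal (f (snd z, fst z)) \<partial>lborel) = (\<integral>\<^sup>+z. ennreal (f z) \<partial>lborel)"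
      by (rule nn_integral_lborel_swap[of "\<lambda>z. ennreal (f z)"]) measurable
    also have "(\<integral>\<^sup>+z. ennreal (g (snd z, fst z)) \<partial>lborel) = (\<integral>\<^sup>+z. ennreal (g z) \<partial>lborel)"
      by (rule nn_integral_lborel_swap[of "\<lambda>z. ennreal (g z)"]) measurable
    finally have B2_eq: "(\<integral>\<^sup>+z. ennreal (B2 z) \<partial>lborel) = 2 * (\<integral>\<^sup>+z. ennreal (f z) \<partial>lborel) + 2 * (\<integral>\<^sup>+z. ennreal (g z) \<partial>lborel)"
      by (simp add: mult_2)
    have "(\<integral>\<^sup>+z. ennreal (g z) \<partial>lborel) = (\<integral>\<^sup>+x. (\<integral>\<^sup>+y. ennreal (g (x, y)) \<partial>lborel) \<partial>lborel)"
      by (rule nn_integral_lborel_pair) measurable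
    also have "\<dots> = ?J2"
    proof (rule nn_integral_cong)
      fix x
      show "(\<integral>\<^sup>+y. ennreal (g (x, y)) \<partial>lborel) =
          (\<integral>\<^sup>+y. ennreal (A x powr (q - p) / norm (x - y) powr ?K) * indicator (- B) y \<partial>lborel) * indicator B' x"
      proof (cases "x \<in> B'")
        case True
        then show ?thesis
          by (simp add: g_def) (intro nn_integral_cong; simp add: indicator_def)
      qed (simp add: g_def)
    qed
    finally have g_eq: "(\<integral>\<^sup>+z. ennreal (g z) \<partial>lborel) = ?J2" .
    let ?a = "C2 * (6 / r) powr q"
    have "(\<integral>\<^sup>+z. ennreal (f z) \<partial>lborel) = (\<integral>\<^sup>+x. (\<integral>\<^sup>+y. ennreal (f (x, y)) \<partial>lborel) \<partial>lborel)"
      by (rule nn_integral_lborel_pair) measurable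
    also have "\<dots> \<le> (\<integral>\<^sup>+x. ennreal (?a * (C3 * r powr (q - s * q))) * (ennreal (A x powr (q - p)) * indicator B x) \<partial>lborel)"
    proof (rule nn_integral_mono)
      fix x
      show "(\<integral>\<^sup>+y. ennreal (f (x, y)) \<partial>lborel) \<le> ennreal (?a * (C3 * r powr (q - s * q))) * (ennreal (A x powr (q - p)) * indicator B x)"
      proof (cases "x \<in> B")
        case True
        have "(\<integral>\<^sup>+y. ennreal (f (x, y)) \<partial>lborel) =
            (\<integral>\<^sup>+y. ennreal (?a * A x powr (q - p)) * (ennreal (norm (x - y) powr (q - ?K)) * indicator B y) \<partial>lborel)"
          using True C2(2) by (intro nn_integral_cong) (auto simp: f_def indicator_def ennreal_mult'[symmetric] mult_ac)
        also have "\<dots> = ennreal (?a * A x powr (q - p)) * (\<integral>\<^sup>+y. ennreal (norm (x - y) powr (q - ?K)) * indicator B y \<partial>lborel)"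
          by (rule nn_integral_cmult) measurable
        also have "\<dots> \<le> ennreal (?a * A x powr (q - p)) * ennreal (C3 * r powr (q - s * q))"
          by (intro mult_left_mono C3(2) True) simp
        also have "\<dots> = ennreal (?a * (C3 * r powr (q - s * q))) * ennreal (A x powr (q - p))"
          using C2(2) C3(1) by (simp add: ennreal_mult'[symmetric] mult_ac)
        finally show ?thesis using True by simp
      qed (simp add: f_def)
    qed
    also have "\<dots> = ennreal (?a * (C3 * r powr (q - s * q))) * ?J1"
      by (rule nn_integral_cmult) measurable
    also have "?a * (C3 * r powr (q - s * q)) = C2 * 6 powr q * C3 * r powr (- (s * q))"
      using r by (simp add: powr_divide powr_diff powr_minus_divide)
    finally have f_le: "(\<integral>\<^sup>+z. ennreal (f z) \<partial>lborel) \<le> ennreal (C2 * 6 powr q * C3 * r powr (- (s * q))) * ?J1" .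
    have "2 * (\<integral>\<^sup>+z. ennreal (f z) \<partial>lborel) \<le> 2 * (ennreal (C2 * 6 powr q * C3 * r powr (- (s * q))) * ?J1)"
      using f_le by (intro mult_left_mono) auto
    also have "\<dots> = (ennreal 2 * ennreal (C2 * 6 powr q * C3 * r powr (- (s * q)))) * ?J1"
      by (simp add: mult.assoc)
    also have "ennreal 2 * ennreal (C2 * 6 powr q * C3 * r powr (- (s * q))) = ennreal (2 * C2 * 6 powr q * C3 * r powr (- (s * q)))"
      by (subst ennreal_mult'[symmetric]) (simp_all add: mult.assoc)
    finally show ?thesis unfolding B2_eq g_eq by simp
  qed
  have "ennreal ?c * (?I1 + ?I2) \<le> (\<integral>\<^sup>+x. ennreal (A1 x) \<partial>lborel) + (\<integral>\<^sup>+z. ennreal (A2 z) \<partial>lborel)"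
    unfolding distrib_left by (intro add_mono A1_ge A2_ge)
  also note main
  also have "(\<integral>\<^sup>+x. ennreal (B1 x) \<partial>lborel) + (\<integral>\<^sup>+z. ennreal (B2 z) \<partial>lborel) \<le>
    ennreal (C1 * 6 powr p * (unit_ball_vol CARD('n) * (3 / 2) ^ CARD('n)) * r powr (real CARD('n) - p)) +
     (ennreal (2 * C2 * 6 powr q * C3 * r powr (- (s * q))) * ?J1 + ennreal 2 * ?J2)"
    unfolding B1_eq by (intro add_left_mono B2_le)
  finally show ?thesis by (simp add: add.assoc)
qed

end

section \<open>The logarithmic lemma\<close>

lemma nn_integral_lebesgue_on_pair_eq:
  fixes f F :: "'a::euclidean_space \<Rightarrow> 'a \<Rightarrow> ennreal"
  assumes S: "S \<in> sets lebesgue" and T: "T \<in> sets lebesgue"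
    and P: "AE x in lborel. P x" and eq: "\<And>x y. P x \<Longrightarrow> P y \<Longrightarrow> f x y = F x y"
  shows "(\<integral>\<^sup>+x. (\<integral>\<^sup>+y. f x y \<partial>lebesgue_on T) \<partial>lebesgue_on S) =
    (\<integral>\<^sup>+x. (\<integral>\<^sup>+y. F x y * indicator T y \<partial>lborel) * indicator S x \<partial>lborel)"
proof (rule nn_integral_lebesgue_on_eq[OF S])
  show "AE x in lborel. x \<in> S \<longrightarrow> (\<integral>\<^sup>+y. f x y \<partial>lebesgue_on T) = (\<integral>\<^sup>+y. F x y * indicator T y \<partial>lborel)"
    using P
  proof eventually_elim
    case (elim x)
    have "AE y in lborel. y \<in> T \<longrightarrow> f x y = F x y"
      using P by eventually_elim (simp add: eq elim)
    then show ?case using nn_integral_lebesgue_on_eq[OF T] by blast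
  qed
qed

theorem lemma4p3:
  fixes s p q :: real
  assumes "CARD('n::finite) \<ge> 2"
    and "1 < p" "p < real CARD('n)"
    and "0 < s" "s < 1"
    and "1 < q" "s * q < real CARD('n)"
  shows "\<exists>C>0. \<forall>(\<Omega> :: (real ^ 'n) set) (u :: real ^ 'n \<Rightarrow> real) d r R.
     open \<Omega> \<longrightarrow> u \<in> Dspq s p q \<Omega> \<longrightarrow> weak_supersolution s p q \<Omega> u \<longrightarrow>
     (AE x in lebesgue. 0 \<le> u x) \<longrightarrow>
     0 < d \<longrightarrow> 0 < r \<longrightarrow> 0 < R \<longrightarrow> ball 0 R \<subseteq> \<Omega> \<longrightarrow>
     ball (0 :: real ^ 'n) (2 * r) \<subseteq> ball 0 R \<longrightarrow>
     weakly_differentiable (ball 0 r) (\<lambda>x. ln (u x + d)) \<and>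
     (\<integral>\<^sup>+x. ennreal (norm (weak_grad (ball 0 r) (\<lambda>z. ln (u z + d)) x) powr p)
        \<partial>lebesgue_on (ball 0 r))
     + (\<integral>\<^sup>+x. (\<integral>\<^sup>+y. ennreal (\<bar>ln ((u x + d) / (u y + d))\<bar> powr q * (u y + d) powr (q - p)
                              / norm (x - y) powr (real CARD('n) + s * q))
          \<partial>lebesgue_on (ball 0 r)) \<partial>lebesgue_on (ball 0 r))
     \<le> ennreal (C * r powr (real CARD('n) - p))
       + ennreal (C * r powr (- (s * q)))
         * (\<integral>\<^sup>+x. ennreal ((u x + d) powr (q - p)) \<partial>lebesgue_on (ball 0 (2 * r)))
       + ennreal C
         * (\<integral>\<^sup>+x. (\<integral>\<^sup>+y. ennreal ((u x + d) powr (q - p)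
                                / norm (x - y) powr (real CARD('n) + s * q))
              \<partial>lebesgue_on (- ball 0 (2 * r))) \<partial>lebesgue_on (ball 0 (3 * r / 2)))"
proof -
  note p = assms(2,3) and s = assms(4,5) and q = assms(6,7)
  \<comment> \<open>an integer exponent keeps \<open>\<eta>\<^bsup>m\<^esup>\<close> smooth\<close>
  obtain m :: nat where m: "max p q \<le> real m" using real_arch_simple by blast
  then have pm: "p \<le> real m" and qm: "q \<le> real m" by auto
  obtain C1 where C1: "0 < C1" "\<And>(g :: real ^ 'n) z (e :: real) a Z. \<lbrakk>0 < a; 0 \<le> e; e \<le> 1; norm z \<le> Z\<rbrakk> \<Longrightarrow>
      norm g powr (p - 2) * (g \<bullet> (((1 - p) * a powr (-p) * e ^ m) *\<^sub>R g + (a powr (1 - p) * (m * e ^ (m - 1))) *\<^sub>R z))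
        + (p - 1) / 2 * (e ^ m * (norm g / a) powr p) \<le> C1 * Z powr p"
    using local_pointwise_estimate[OF p(1) pm, where 'a="real ^ 'n"] by blast
  obtain c2 C2 where C2: "0 < c2" "0 < C2" "\<And>a b x y. \<lbrakk>0 < a; 0 < b; 0 \<le> x; x \<le> 1; 0 \<le> y; y \<le> 1\<rbrakk> \<Longrightarrow>
      J q (a - b) * (a powr (1 - p) * x ^ m - b powr (1 - p) * y ^ m)
        + c2 * (\<bar>ln (a / b)\<bar> powr q * b powr (q - p) * min x y ^ m)
        \<le> C2 * (\<bar>x - y\<bar> powr q * (a powr (q - p) + b powr (q - p)))"
    using nonlocal_pointwise_estimate[OF p(1) q(1) qm] by blast
  have q0: "0 < q" using q by simp
  obtain C3 where C3: "0 < C3" "\<And>x \<rho>. 0 < \<rho> \<Longrightarrow> x \<in> ball 0 (2 * \<rho>) \<Longrightarrow>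
    (\<integral>\<^sup>+y. ennreal (norm (x - y) powr (q - (real CARD('n) + s * q))) * indicator (ball (0 :: real ^ 'n) (2 * \<rho>)) y \<partial>lborel)
      \<le> ennreal (C3 * \<rho> powr (q - s * q))"
    using near_kernel_bound[OF s(2) q0, where 'n='n] by blast
  define c where "c = min ((p - 1) / 2) c2 * exp (- real m)"
  define K1 where "K1 = C1 * 6 powr p * (unit_ball_vol CARD('n) * (3 / 2) ^ CARD('n))"
  define K2 where "K2 = 2 * C2 * 6 powr q * C3"
  \<comment> \<open>the factor \<open>2\<close> comes from the two symmetric far regions\<close>
  define C where "C = max 2 (max K1 K2) / c"
  have c: "0 < c" using p C2(1) by (simp add: c_def)
  have C: "0 < C" using c by (simp add: C_def)
  show ?thesis
  proof (intro exI[of _ C] conjI[OF C] allI impI)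
    fix \<Omega> :: "(real ^ 'n) set" and u :: "real ^ 'n \<Rightarrow> real" and d r R :: real
    assume \<Omega>: "open \<Omega>" and uD: "u \<in> Dspq s p q \<Omega>" and sup: "weak_supersolution s p q \<Omega> u"
      and u0: "AE x in lebesgue. 0 \<le> u x" and d: "0 < d" and r: "0 < r" and R: "0 < R"
      and R\<Omega>: "ball 0 R \<subseteq> \<Omega>" and rR: "ball (0 :: real ^ 'n) (2 * r) \<subseteq> ball 0 R"
    have u_loc: "u \<in> Lp_loc (q - 1) UNIV" and u_D1p: "u \<in> D1p p \<Omega>" using uD by (auto simp: Dspq_def)
    obtain E where E: "\<Omega> \<subseteq> E" "compact (- E)" "gagliardo_pow s q E u < \<infinity>"
      using uD unfolding Dspq_def by blast
    have "u \<in> borel_measurable (lebesgue_on UNIV)" using u_loc by (simp add: Lp_loc_def)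
    then obtain U0 where U0: "U0 \<in> borel_measurable borel" "AE x in lborel. x \<in> UNIV \<longrightarrow> u x = U0 x"
      by (rule ex_borel_representative[rotated]) auto
    \<comment> \<open>a Borel representative that is nonnegative everywhere\<close>
    define U where "U x = max 0 (U0 x)" for x
    have U_meas: "U \<in> borel_measurable borel" unfolding U_def[abs_def] using U0(1) by measurable
    have U_nonneg: "0 \<le> U x" for x by (simp add: U_def)
    have "AE x in lborel. 0 \<le> u x" using u0 by (simp add: AE_completion_iff)
    then have uU: "AE x in lborel. u x = U x" using U0(2) by eventually_elim (simp add: U_def)
    have \<Omega>l: "\<Omega> \<in> sets lebesgue" using \<Omega> by (auto intro: sets_completionI_sets)
    obtain g0 where "has_weak_grad \<Omega> u g0"
      using u_D1p unfolding D1p_def weakly_differentiable_def by blast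
    then have u_grad: "has_weak_grad \<Omega> u (weak_grad \<Omega> u)"
      unfolding weak_grad_def by (rule someI[of "has_weak_grad \<Omega> u"])
    then have "weak_grad \<Omega> u \<in> borel_measurable (lebesgue_on \<Omega>)"
      unfolding has_weak_grad_def Lp_loc_def by (elim conjE CollectE)
    then obtain G where G: "G \<in> borel_measurable borel" "AE x in lborel. x \<in> \<Omega> \<longrightarrow> weak_grad \<Omega> u x = G x"
      by (rule ex_borel_representative_vec[OF \<Omega>l])
    have uU\<Omega>: "AE x in lborel. x \<in> \<Omega> \<longrightarrow> u x = U x" using uU by eventually_elim simp
    have U_grad: "borel_weak_grad \<Omega> U G"
      using has_weak_grad_iff_borel_weak_grad[OF \<Omega> U_meas G(1) uU\<Omega> G(2)] u_grad by simp
    obtain \<eta> :: "real ^ 'n \<Rightarrow> real" where \<eta>: "smooth_fun \<eta>" "\<And>x. 0 \<le> \<eta> x" "\<And>x. \<eta> x \<le> 1"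
      "\<And>x. x \<notin> cball 0 (sqrt 2 * r) \<Longrightarrow> \<eta> x = 0" "\<And>x. x \<in> ball 0 r \<Longrightarrow> exp (-1) \<le> \<eta> x"
      "\<And>x y. \<bar>\<eta> x - \<eta> y\<bar> \<le> 6 / r * norm (x - y)" "\<And>x. norm (\<chi> i. partial_deriv i \<eta> x) \<le> 6 / r"
      by (rule cutoff_function[OF r]) (rule that)
    have B\<Omega>: "ball 0 (2 * r) \<subseteq> \<Omega>" using rR R\<Omega> by blast
    interpret log_test s p q d r \<Omega> E u U G \<eta> m
      by (unfold_locales; (fact p s q pm qm d r \<Omega> B\<Omega> E u_loc u_D1p U_meas U_nonneg uU U_grad \<eta>))
    let ?S = "ball (0 :: real ^ 'n) r"
    let ?K = "real CARD('n) + s * q"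
    have Sl: "?S \<in> sets lebesgue" "ball (0 :: real ^ 'n) (2 * r) \<in> sets lebesgue"
      "ball (0 :: real ^ 'n) (3 * r / 2) \<in> sets lebesgue" "- ball (0 :: real ^ 'n) (2 * r) \<in> sets lebesgue"
      by (auto intro: sets_completionI_sets)
    have S\<Omega>: "?S \<subseteq> \<Omega>" using B\<Omega> r by (intro order_trans[OF _ B\<Omega>]) auto
    have ln_grad: "borel_weak_grad ?S (\<lambda>x. ln (U x + d)) (\<lambda>x. (1 / (U x + d)) *\<^sub>R G x)"
    proof (rule borel_weak_grad_chain[OF open_ball borel_weak_grad_subset[OF U_grad S\<Omega>] U_nonneg])
      show "((\<lambda>t. ln (t + d)) has_real_derivative 1 / (t + d)) (at t)" if "0 \<le> t" for t
        using that d by (auto intro!: derivative_eq_intros)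
      show "continuous_on {0..} (\<lambda>t. 1 / (t + d))" using d by (intro continuous_intros) auto
      show "\<bar>1 / (t + d)\<bar> \<le> 1 / d" if "0 \<le> t" for t using that d by (simp add: frac_le)
    qed
    have ln_eq: "AE x in lborel. x \<in> ?S \<longrightarrow> ln (u x + d) = ln (U x + d)" using uU by eventually_elim simp
    have wd: "weakly_differentiable ?S (\<lambda>x. ln (u x + d))"
      and wg: "AE x in lborel. x \<in> ?S \<longrightarrow> weak_grad ?S (\<lambda>z. ln (u z + d)) x = (1 / (U x + d)) *\<^sub>R G x"
      by (rule weak_grad_eq_borel_weak_grad[OF open_ball ln_eq ln_grad])+
    have I1: "(\<integral>\<^sup>+x. ennreal (norm (weak_grad ?S (\<lambda>z. ln (u z + d)) x) powr p) \<partial>lebesgue_on ?S) =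
        (\<integral>\<^sup>+x. ennreal ((norm (G x) / A x) powr p) * indicator ?S x \<partial>lborel)"
    proof (rule nn_integral_lebesgue_on_eq[OF Sl(1)])
      show "AE x in lborel. x \<in> ?S \<longrightarrow> ennreal (norm (weak_grad ?S (\<lambda>z. ln (u z + d)) x) powr p) = ennreal ((norm (G x) / A x) powr p)"
        using wg
      proof eventually_elim
        case (elim x)
        have "\<bar>U x + d\<bar> = A x"
          using A_pos[of x] by (simp add: A_def)
        with elim show ?case by simp
      qed
    qed
    have I2: "(\<integral>\<^sup>+x. (\<integral>\<^sup>+y. ennreal (\<bar>ln ((u x + d) / (u y + d))\<bar> powr q * (u y + d) powr (q - p) / norm (x - y) powr ?K)
          \<partial>lebesgue_on ?S) \<partial>lebesgue_on ?S) =
        (\<integral>\<^sup>+x. (\<integral>\<^sup>+y. ennreal (\<bar>ln (A x / A y)\<bar> powr q * A y powr (q - p) / norm (x - y) powr ?K)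
            * indicator ?S y \<partial>lborel) * indicator ?S x \<partial>lborel)"
      by (rule nn_integral_lebesgue_on_pair_eq[OF Sl(1) Sl(1) uU]) (simp add: A_def)
    have J1: "(\<integral>\<^sup>+x. ennreal ((u x + d) powr (q - p)) \<partial>lebesgue_on (ball 0 (2 * r))) =
        (\<integral>\<^sup>+x. ennreal (A x powr (q - p)) * indicator (ball 0 (2 * r)) x \<partial>lborel)"
    proof (rule nn_integral_lebesgue_on_eq[OF Sl(2)])
      show "AE x in lborel. x \<in> ball 0 (2 * r) \<longrightarrow> ennreal ((u x + d) powr (q - p)) = ennreal (A x powr (q - p))"
        using uU by eventually_elim (simp add: A_def)
    qed
    have J2: "(\<integral>\<^sup>+x. (\<integral>\<^sup>+y. ennreal ((u x + d) powr (q - p) / norm (x - y) powr ?K)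
              \<partial>lebesgue_on (- ball 0 (2 * r))) \<partial>lebesgue_on (ball 0 (3 * r / 2))) =
        (\<integral>\<^sup>+x. (\<integral>\<^sup>+y. ennreal (A x powr (q - p) / norm (x - y) powr ?K) * indicator (- ball 0 (2 * r)) y \<partial>lborel)
            * indicator (ball 0 (3 * r / 2)) x \<partial>lborel)"
      by (rule nn_integral_lebesgue_on_pair_eq[OF Sl(3) Sl(4) uU]) (simp add: A_def)
    have absorb: "X \<le> ennreal (C * a) + ennreal (C * b) * Y + ennreal C * Z"
      if le: "ennreal c * X \<le> ennreal (K1 * a) + ennreal (K2 * b) * Y + ennreal 2 * Z" and ab: "0 \<le> a" "0 \<le> b"
      for X Y Z :: ennreal and a b
    proof -
      have K: "K1 / c \<le> C" "K2 / c \<le> C" "2 / c \<le> C"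
        using c by (auto simp: C_def intro!: divide_right_mono)
      have "X = ennreal (1 / c) * (ennreal c * X)"
        using c by (simp add: mult.assoc[symmetric] ennreal_mult'[symmetric])
      also have "\<dots> \<le> ennreal (1 / c) * (ennreal (K1 * a) + ennreal (K2 * b) * Y + ennreal 2 * Z)"
        by (rule mult_left_mono[OF le]) simp
      also have "\<dots> = ennreal (1 / c) * ennreal (K1 * a) + (ennreal (1 / c) * ennreal (K2 * b)) * Y + (ennreal (1 / c) * ennreal 2) * Z"
        by (simp add: distrib_left mult.assoc)
      also have "\<dots> = ennreal ((K1 / c) * a) + ennreal ((K2 / c) * b) * Y + ennreal (2 / c) * Z"
        using c by (simp add: ennreal_mult'[symmetric] del: ennreal_numeral)
      also have "\<dots> \<le> ennreal (C * a) + ennreal (C * b) * Y + ennreal C * Z"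
        using K ab by (intro add_mono mult_right_mono ennreal_leI) auto
      finally show ?thesis .
    qed
    show "weakly_differentiable ?S (\<lambda>x. ln (u x + d)) \<and>
      (\<integral>\<^sup>+x. ennreal (norm (weak_grad ?S (\<lambda>z. ln (u z + d)) x) powr p) \<partial>lebesgue_on ?S) +
      (\<integral>\<^sup>+x. (\<integral>\<^sup>+y. ennreal (\<bar>ln ((u x + d) / (u y + d))\<bar> powr q * (u y + d) powr (q - p) / norm (x - y) powr ?K)
          \<partial>lebesgue_on ?S) \<partial>lebesgue_on ?S) \<le>
      ennreal (C * r powr (real CARD('n) - p)) +
      ennreal (C * r powr (- (s * q))) * (\<integral>\<^sup>+x. ennreal ((u x + d) powr (q - p)) \<partial>lebesgue_on (ball 0 (2 * r))) +
      ennreal C * (\<integral>\<^sup>+x. (\<integral>\<^sup>+y. ennreal ((u x + d) powr (q - p) / norm (x - y) powr ?K)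
              \<partial>lebesgue_on (- ball 0 (2 * r))) \<partial>lebesgue_on (ball 0 (3 * r / 2)))"
    proof (rule conjI[OF wd], rule absorb)
      show "ennreal c *
        ((\<integral>\<^sup>+x. ennreal (norm (weak_grad ?S (\<lambda>z. ln (u z + d)) x) powr p) \<partial>lebesgue_on ?S) +
        (\<integral>\<^sup>+x. (\<integral>\<^sup>+y. ennreal (\<bar>ln ((u x + d) / (u y + d))\<bar> powr q * (u y + d) powr (q - p) / norm (x - y) powr ?K)
          \<partial>lebesgue_on ?S) \<partial>lebesgue_on ?S)) \<le>
        ennreal (K1 * r powr (real CARD('n) - p)) +
        ennreal (K2 * r powr (- (s * q))) * (\<integral>\<^sup>+x. ennreal ((u x + d) powr (q - p)) \<partial>lebesgue_on (ball 0 (2 * r))) +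
        ennreal 2 * (\<integral>\<^sup>+x. (\<integral>\<^sup>+y. ennreal ((u x + d) powr (q - p) / norm (x - y) powr ?K)
              \<partial>lebesgue_on (- ball 0 (2 * r))) \<partial>lebesgue_on (ball 0 (3 * r / 2)))"
        unfolding I1 I2 J1 J2 c_def K1_def K2_def
        by (rule logarithmic_energy_estimate[OF sup C1 C2 C3(1) C3(2)[OF r]])
    qed simp_all
  qed
qed

end
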